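(* Let $R$ be a graded-commutative noetherian ring and $\mathsf T$ a compactly generated $R$-linear triangulated category with arbitrary coproducts. Suppose $\mathsf T$ is noetherian and stratified by $R$. Then the map $$\mathsf C\longmapsto\operatorname{supp}_R\mathsf C=\bigcup_{C\in\mathsf C}\operatorname{supp}_RC$$ is a bijection from the thick subcategories of $\mathsf T^c$ (the subcategory of compact objects of $\mathsf T$) to the specialization closed subsets of $\operatorname{supp}_R\mathsf T$. The inverse map sends a specialization closed subset $\mathcal V$ to the subcategory $\{C\in\mathsf T^c\mid\operatorname{supp}_RC\subseteq\mathcal V\}$.
   Context: Graded-commutative: $R$ is $\mathbb Z$-graded with $rs=(-1)^{|r||s|}sr$ for homogeneous $r,s$. $\operatorname{Spec}R$ is the set of homogeneous prime ideals; $\mathcal V(\mathfrak a)=\{\mathfrak p\in\operatorname{Spec}R\mid\mathfrak p\supseteq\mathfrak a\}$ for a homogeneous ideal $\mathfrak a$. $R$-modules are graded and $M_{\mathfrak p}$ is homogeneous localization. A subset $\mathcal V\subseteq\operatorname{Spec}R$ is specialization closed if $\mathfrak p\in\mathcal V$, $\mathfrak p\subseteq\mathfrak q$ imply $\mathfrak q\in\mathcal V$. $\mathsf T$ has suspension $\Sigma$. A thick subcategory is a full triangulated subcategory closed under direct summands. A localizing subcategory is a full triangulated subcategory closed under coproducts; $\operatorname{Loc}_{\mathsf T}(\mathsf C)$ is the smallest one containing $\mathsf C$. An object $C$ is compact if $\operatorname{Hom}_{\mathsf T}(C,-)$ commutes with coproducts; $\mathsf T^c$ is the full subcategory of compact objects.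 $\mathsf T$ is compactly generated if $\mathsf T=\operatorname{Loc}_{\mathsf T}(\mathsf G)$ for a set $\mathsf G$ of compact objects. $\mathsf T$ is $R$-linear if there is given a homomorphism of graded rings $R\to Z^*(\mathsf T)$ to the graded center ($Z^n(\mathsf T)$ consists of natural transformations $\eta\colon\mathrm{Id}\to\Sigma^n$ with $\eta\Sigma=(-1)^n\Sigma\eta$); then $\operatorname{Hom}^*_{\mathsf T}(X,Y)=\bigoplus_i\operatorname{Hom}_{\mathsf T}(X,\Sigma^iY)$ is a graded $R$-module, and $\operatorname{End}^*_{\mathsf T}(X)=\operatorname{Hom}^*_{\mathsf T}(X,X)$. For specialization closed $\mathcal V$, let $\mathsf T_{\mathcal V}=\{X\in\mathsf T\mid\operatorname{Hom}^*_{\mathsf T}(C,X)_{\mathfrak p}=0\text{ for all }C\in\mathsf T^c,\ \mathfrak p\in\operatorname{Spec}R\setminus\mathcal V\}$. This is a localizing subcategory and there is a localization functor $L_{\mathcal V}\colon\mathsf T\to\mathsf T$ with $\operatorname{Ker}L_{\mathcal V}=\mathsf T_{\mathcal V}$, giving functorial exact triangles $\varGamma_{\mathcal V}X\to X\to L_{\mathcal V}X\to$ with $\varGamma_{\mathcal V}X\in\mathsf T_{\mathcal V}$ and $\operatorname{Hom}_{\mathsf T}(\mathsf T_{\mathcal V},L_{\mathcal V}X)=0$. For $\mathfrak p\in\operatorname{Spec}R$ put $\mathcal Z(\mathfrak p)=\{\mathfrak q\in\operatorname{Spec}R\mid\mathfrak q\not\subseteq\mathfrak p\}$, $X_{\mathfrak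 p}=L_{\mathcal Z(\mathfrak p)}X$, $\varGamma_{\mathfrak p}X=\varGamma_{\mathcal V(\mathfrak p)}(X_{\mathfrak p})$. $\varGamma_{\mathfrak p}\mathsf T$ is the essential image of $\varGamma_{\mathfrak p}$, a localizing subcategory of $\mathsf T$. The support of $X$ is $\operatorname{supp}_RX=\{\mathfrak p\in\operatorname{Spec}R\mid\varGamma_{\mathfrak p}X\neq0\}$, and $\operatorname{supp}_R\mathsf T=\bigcup_{X\in\mathsf T}\operatorname{supp}_RX$. $\mathsf T$ is stratified by $R$ if (S1) the local-global principle holds, i.e. $\operatorname{Loc}_{\mathsf T}(X)=\operatorname{Loc}_{\mathsf T}(\{\varGamma_{\mathfrak p}X\mid\mathfrak p\in\operatorname{Spec}R\})$ for every object $X$; and (S2) for each $\mathfrak p\in\operatorname{Spec}R$ the localizing subcategory $\varGamma_{\mathfrak p}\mathsf T$ is either zero or minimal (nonzero with no proper nonzero localizing subcategories). $\mathsf T$ is noetherian if the $R$-module $\operatorname{End}^*_{\mathsf T}(C)$ is finitely generated for every compact object $C$. *)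

theory Defs
  imports "HOL-Algebra.Module" "HOL-Algebra.Product_Groups" "HOL-Algebra.Ring_Divisibility"
begin

unbundle cardinal_syntax

section \<open>Smallness\<close>

text \<open>
  A "set" (as opposed to a class) is a set with fewer elements than the type \<open>'u\<close>, whose
  cardinality is required to be uncountable and regular. Only index sets of
  coproducts, Hom-sets, generating sets and the ring are required to be small, never the collection
  of objects: a category with coproducts indexed by its own collection of morphisms is a preorder.
  By the same argument of Freyd, if a nonzero additive category has small coproducts and small
  Hom-sets, then \<open>'u\<close> is automatically a strong limit, i.e. inaccessible, so that the small sets
  are those of a Grothendieck universe.  Up to bijection every small set is a subset of \<open>'u\<close>,
  which is why families are indexed by subsets of \<open>'u\<close>.
\<close>

definition universe :: "'u itself \<Rightarrow> bool" where
  "universe U \<longleftrightarrow> natLeq <o |UNIV :: 'u set| \<and> regularCard |UNIV :: 'u set|"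

definition small :: "'u itself \<Rightarrow> 'b set \<Rightarrow> bool" where
  "small U A \<longleftrightarrow> |A| <o |UNIV :: 'u set|"


section \<open>Graded rings and modules\<close>

record 'a gring = "'a ring" +
  grade :: "int \<Rightarrow> 'a set"

locale graded_ring = ring R for R :: "('a, 'y) gring_scheme" (structure) +
  assumes grade_subgroup: "additive_subgroup (grade R n) R"
    and grade_one: "\<one> \<in> grade R 0"
    and grade_mult: "\<lbrakk>r \<in> grade R m; s \<in> grade R n\<rbrakk> \<Longrightarrow> r \<otimes> s \<in> grade R (m + n)"
    and grade_decomp: "r \<in> carrier R \<Longrightarrow>
      \<exists>!c. (\<forall>n. c n \<in> grade R n) \<and> finite {n. c n \<noteq> \<zero>} \<and> r = finsum R c {n. c n \<noteq> \<zero>}"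

locale graded_commutative_ring = graded_ring +
  assumes graded_comm: "\<lbrakk>r \<in> grade R m; s \<in> grade R n\<rbrakk> \<Longrightarrow>
      r \<otimes> s = (if even (m * n) then s \<otimes> r else \<ominus> (s \<otimes> r))"

definition hcomp :: "('a, 'z) gring_scheme \<Rightarrow> 'a \<Rightarrow> int \<Rightarrow> 'a" where
  "hcomp R r = (THE c. (\<forall>n. c n \<in> grade R n) \<and> finite {n. c n \<noteq> \<zero>\<^bsub>R\<^esub>} \<and>
                       r = finsum R c {n. c n \<noteq> \<zero>\<^bsub>R\<^esub>})"

definition homogeneous_ideal :: "('a, 'z) gring_scheme \<Rightarrow> 'a set \<Rightarrow> bool" where
  "homogeneous_ideal R I \<longleftrightarrow> ideal I R \<and> (\<forall>r\<in>I. \<forall>n. hcomp R r n \<in> I)"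

text \<open>The library's \<open>primeideal\<close> is restricted to commutative rings.\<close>

definition Spec :: "('a, 'z) gring_scheme \<Rightarrow> 'a set set" where
  "Spec R = {P. homogeneous_ideal R P \<and> P \<noteq> carrier R \<and>
     (\<forall>r\<in>carrier R. \<forall>s\<in>carrier R. r \<otimes>\<^bsub>R\<^esub> s \<in> P \<longrightarrow> r \<in> P \<or> s \<in> P)}"

definition VV :: "('a, 'z) gring_scheme \<Rightarrow> 'a set \<Rightarrow> 'a set set" where
  "VV R A = {P \<in> Spec R. A \<subseteq> P}"

definition ZZ :: "('a, 'z) gring_scheme \<Rightarrow> 'a set \<Rightarrow> 'a set set" where
  "ZZ R P = {Q \<in> Spec R. \<not> Q \<subseteq> P}"

definition specialization_closed :: "('a, 'z) gring_scheme \<Rightarrow> 'a set set \<Rightarrow> bool" where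
  "specialization_closed R V \<longleftrightarrow>
     V \<subseteq> Spec R \<and> (\<forall>P\<in>V. \<forall>Q\<in>Spec R. P \<subseteq> Q \<longrightarrow> Q \<in> V)"

text \<open>The library's \<open>module\<close> locale is restricted to commutative rings; only its record type of
  modules is used here.\<close>

definition finitely_generated_module ::
  "('a, 'z) gring_scheme \<Rightarrow> ('a, 'b, 'y) module_scheme \<Rightarrow> bool" where
  "finitely_generated_module R M \<longleftrightarrow>
     (\<exists>F. finite F \<and> F \<subseteq> carrier M \<and>
       (\<forall>x\<in>carrier M. \<exists>c\<in>F \<rightarrow> carrier R. x = (\<Oplus>\<^bsub>M\<^esub>m\<in>F. c m \<odot>\<^bsub>M\<^esub> m)))"

definition loc_denominators :: "('a, 'z) gring_scheme \<Rightarrow> 'a set \<Rightarrow> 'a set" where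
  "loc_denominators R P = (\<Union>n. grade R n) - P"

text \<open>
  Homogeneous localization as left fractions: \<open>(x, s)\<close> stands for \<open>x/s\<close>, and two fractions agree
  iff they do so after passing to a common denominator \<open>a \<otimes> s = b \<otimes> t\<close>.  This is the usual
  definition of left Ore localization and needs no sign conventions for denominators of odd degree.
\<close>

definition loc_rel ::
  "('a, 'z) gring_scheme \<Rightarrow> ('a, 'b, 'y) module_scheme \<Rightarrow> 'a set \<Rightarrow> (('b \<times> 'a) \<times> ('b \<times> 'a)) set"
where
  "loc_rel R M P = {((x, s), (y, t)) | x s y t.
     x \<in> carrier M \<and> s \<in> loc_denominators R P \<and> y \<in> carrier M \<and> t \<in> loc_denominators R P \<and>
     (\<exists>a\<in>loc_denominators R P. \<exists>b\<in>loc_denominators R P.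
        a \<otimes>\<^bsub>R\<^esub> s = b \<otimes>\<^bsub>R\<^esub> t \<and> a \<odot>\<^bsub>M\<^esub> x = b \<odot>\<^bsub>M\<^esub> y)}"

definition localization ::
  "('a, 'z) gring_scheme \<Rightarrow> ('a, 'b, 'y) module_scheme \<Rightarrow> 'a set \<Rightarrow> ('b \<times> 'a) set set" where
  "localization R M P = (carrier M \<times> loc_denominators R P) // loc_rel R M P"

definition localization_zero ::
  "('a, 'z) gring_scheme \<Rightarrow> ('a, 'b, 'y) module_scheme \<Rightarrow> 'a set \<Rightarrow> ('b \<times> 'a) set" where
  "localization_zero R M P = loc_rel R M P `` {(\<zero>\<^bsub>M\<^esub>, \<one>\<^bsub>R\<^esub>)}"


section \<open>Triangulated categories\<close>

text \<open>\<open>Susp\<close> and \<open>SuspM\<close> are the suspension on objects and on morphisms; \<open>Tri\<close> is the set of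
  exact triangles, given by their three morphisms \<open>X \<rightarrow> Y \<rightarrow> Z \<rightarrow> \<Sigma>X\<close>.\<close>

record ('o, 'm) tricat =
  Ob :: "'o set"
  Mor :: "'m set"
  Dom :: "'m \<Rightarrow> 'o"
  Cod :: "'m \<Rightarrow> 'o"
  Ident :: "'o \<Rightarrow> 'm"
  Cmp :: "'m \<Rightarrow> 'm \<Rightarrow> 'm" (infixl \<open>\<bullet>\<index>\<close> 70)
  Zer :: "'o \<Rightarrow> 'o \<Rightarrow> 'm"
  Plus :: "'m \<Rightarrow> 'm \<Rightarrow> 'm"
  Susp :: "'o \<Rightarrow> 'o"
  SuspM :: "'m \<Rightarrow> 'm"
  Tri :: "('m \<times> 'm \<times> 'm) set"

definition Hom :: "('o, 'm, 'z) tricat_scheme \<Rightarrow> 'o \<Rightarrow> 'o \<Rightarrow> 'm set" where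
  "Hom T X Y = {f \<in> Mor T. Dom T f = X \<and> Cod T f = Y}"

text \<open>An abelian group in the library is the additive part of a \<open>ring\<close> record; the multiplicative
  fields are irrelevant.\<close>

definition hom_group :: "('o, 'm, 'z) tricat_scheme \<Rightarrow> 'o \<Rightarrow> 'o \<Rightarrow> 'm ring" where
  "hom_group T X Y = \<lparr>carrier = Hom T X Y, monoid.mult = undefined, one = undefined,
                      ring.zero = Zer T X Y, add = Plus T\<rparr>"

definition neg_mor :: "('o, 'm, 'z) tricat_scheme \<Rightarrow> 'm \<Rightarrow> 'm" where
  "neg_mor T f = \<ominus>\<^bsub>hom_group T (Dom T f) (Cod T f)\<^esub> f"

definition is_zero :: "('o, 'm, 'z) tricat_scheme \<Rightarrow> 'o \<Rightarrow> bool" where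
  "is_zero T Z \<longleftrightarrow> Z \<in> Ob T \<and>
     (\<forall>X\<in>Ob T. (\<exists>!f. f \<in> Hom T X Z) \<and> (\<exists>!f. f \<in> Hom T Z X))"

definition is_iso :: "('o, 'm, 'z) tricat_scheme \<Rightarrow> 'm \<Rightarrow> bool" where
  "is_iso T f \<longleftrightarrow> f \<in> Mor T \<and>
     (\<exists>g\<in>Hom T (Cod T f) (Dom T f).
        g \<bullet>\<^bsub>T\<^esub> f = Ident T (Dom T f) \<and> f \<bullet>\<^bsub>T\<^esub> g = Ident T (Cod T f))"

definition isomorphic :: "('o, 'm, 'z) tricat_scheme \<Rightarrow> 'o \<Rightarrow> 'o \<Rightarrow> bool" where
  "isomorphic T X Y \<longleftrightarrow> (\<exists>f\<in>Hom T X Y. is_iso T f)"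

definition is_biproduct :: "('o, 'm, 'z) tricat_scheme \<Rightarrow> 'o \<Rightarrow> 'o \<Rightarrow> 'o \<Rightarrow> bool" where
  "is_biproduct T X Y Z \<longleftrightarrow> X \<in> Ob T \<and> Y \<in> Ob T \<and> Z \<in> Ob T \<and>
     (\<exists>i\<in>Hom T X Z. \<exists>j\<in>Hom T Y Z. \<exists>p\<in>Hom T Z X. \<exists>q\<in>Hom T Z Y.
        p \<bullet>\<^bsub>T\<^esub> i = Ident T X \<and> q \<bullet>\<^bsub>T\<^esub> j = Ident T Y \<and> q \<bullet>\<^bsub>T\<^esub> i = Zer T X Y \<and> p \<bullet>\<^bsub>T\<^esub> j = Zer T Y X \<and>
        Plus T (i \<bullet>\<^bsub>T\<^esub> p) (j \<bullet>\<^bsub>T\<^esub> q) = Ident T Z)"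

locale category =
  fixes T :: "('o, 'm, 'z) tricat_scheme" (structure)
  assumes dom_cod: "f \<in> Mor T \<Longrightarrow> Dom T f \<in> Ob T \<and> Cod T f \<in> Ob T"
    and ident_mem: "X \<in> Ob T \<Longrightarrow> Ident T X \<in> Hom T X X"
    and comp_mem: "\<lbrakk>g \<in> Hom T Y Z; f \<in> Hom T X Y\<rbrakk> \<Longrightarrow> g \<bullet> f \<in> Hom T X Z"
    and ident_left: "f \<in> Hom T X Y \<Longrightarrow> Ident T Y \<bullet> f = f"
    and ident_right: "f \<in> Hom T X Y \<Longrightarrow> f \<bullet> Ident T X = f"
    and comp_assoc: "\<lbrakk>h \<in> Hom T Z W; g \<in> Hom T Y Z; f \<in> Hom T X Y\<rbrakk> \<Longrightarrow> h \<bullet> (g \<bullet> f) = h \<bullet> g \<bullet> f"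

locale additive_category = category +
  assumes hom_abelian_group: "\<lbrakk>X \<in> Ob T; Y \<in> Ob T\<rbrakk> \<Longrightarrow> abelian_group (hom_group T X Y)"
    and comp_add_left: "\<lbrakk>g \<in> Hom T Y Z; g' \<in> Hom T Y Z; f \<in> Hom T X Y\<rbrakk> \<Longrightarrow>
          Plus T g g' \<bullet> f = Plus T (g \<bullet> f) (g' \<bullet> f)"
    and comp_add_right: "\<lbrakk>g \<in> Hom T Y Z; f \<in> Hom T X Y; f' \<in> Hom T X Y\<rbrakk> \<Longrightarrow>
          g \<bullet> Plus T f f' = Plus T (g \<bullet> f) (g \<bullet> f')"
    and zero_object: "\<exists>Z. is_zero T Z"
    and biproducts: "\<lbrakk>X \<in> Ob T; Y \<in> Ob T\<rbrakk> \<Longrightarrow> \<exists>Z. is_biproduct T X Y Z"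

text \<open>The suspension is an automorphism of the category, so that its integral powers satisfy
  \<open>\<Sigma>\<^sup>m\<Sigma>\<^sup>n = \<Sigma>\<^sup>m\<^sup>+\<^sup>n\<close> strictly.\<close>

locale triangulated_category = additive_category +
  assumes susp_ob: "bij_betw (Susp T) (Ob T) (Ob T)"
    and susp_mor: "bij_betw (SuspM T) (Mor T) (Mor T)"
    and susp_hom: "f \<in> Hom T X Y \<Longrightarrow> SuspM T f \<in> Hom T (Susp T X) (Susp T Y)"
    and susp_ident: "X \<in> Ob T \<Longrightarrow> SuspM T (Ident T X) = Ident T (Susp T X)"
    and susp_comp: "\<lbrakk>g \<in> Hom T Y Z; f \<in> Hom T X Y\<rbrakk> \<Longrightarrow>
          SuspM T (g \<bullet> f) = SuspM T g \<bullet> SuspM T f"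
    and susp_add: "\<lbrakk>f \<in> Hom T X Y; g \<in> Hom T X Y\<rbrakk> \<Longrightarrow>
          SuspM T (Plus T f g) = Plus T (SuspM T f) (SuspM T g)"
    and tri_wf: "(u, v, w) \<in> Tri T \<Longrightarrow>
          \<exists>X Y Z. u \<in> Hom T X Y \<and> v \<in> Hom T Y Z \<and> w \<in> Hom T Z (Susp T X)"
    and TR1_ident: "\<lbrakk>X \<in> Ob T; is_zero T Z\<rbrakk> \<Longrightarrow>
          (Ident T X, Zer T X Z, Zer T Z (Susp T X)) \<in> Tri T"
    and TR1_complete: "u \<in> Mor T \<Longrightarrow> \<exists>v w. (u, v, w) \<in> Tri T"
    and TR1_iso: "\<lbrakk>(u, v, w) \<in> Tri T;
          u' \<in> Hom T X' Y'; v' \<in> Hom T Y' Z'; w' \<in> Hom T Z' (Susp T X');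
          a \<in> Hom T (Dom T u) X'; b \<in> Hom T (Cod T u) Y'; c \<in> Hom T (Cod T v) Z';
          is_iso T a; is_iso T b; is_iso T c;
          u' \<bullet> a = b \<bullet> u; v' \<bullet> b = c \<bullet> v; w' \<bullet> c = SuspM T a \<bullet> w\<rbrakk> \<Longrightarrow> (u', v', w') \<in> Tri T"
    and TR2: "\<lbrakk>u \<in> Hom T X Y; v \<in> Hom T Y Z; w \<in> Hom T Z (Susp T X)\<rbrakk> \<Longrightarrow>
          (u, v, w) \<in> Tri T \<longleftrightarrow> (v, w, neg_mor T (SuspM T u)) \<in> Tri T"
    and TR3: "\<lbrakk>(u, v, w) \<in> Tri T; (u', v', w') \<in> Tri T;
          a \<in> Hom T (Dom T u) (Dom T u'); b \<in> Hom T (Cod T u) (Cod T u'); u' \<bullet> a = b \<bullet> u\<rbrakk> \<Longrightarrow>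
          \<exists>c\<in>Hom T (Cod T v) (Cod T v'). v' \<bullet> b = c \<bullet> v \<and> w' \<bullet> c = SuspM T a \<bullet> w"
    and TR4: "\<lbrakk>u \<in> Hom T X Y; v \<in> Hom T Y Z;
          (u, i, j) \<in> Tri T; (v, k, l) \<in> Tri T; (v \<bullet> u, m, n) \<in> Tri T\<rbrakk> \<Longrightarrow>
          \<exists>f\<in>Hom T (Cod T i) (Cod T m). \<exists>g\<in>Hom T (Cod T m) (Cod T k).
            f \<bullet> i = m \<bullet> v \<and> n \<bullet> f = j \<and> g \<bullet> m = k \<and> l \<bullet> g = SuspM T u \<bullet> n \<and>
            (f, g, SuspM T i \<bullet> l) \<in> Tri T"

definition susp_pow :: "('o, 'm, 'z) tricat_scheme \<Rightarrow> int \<Rightarrow> 'o \<Rightarrow> 'o" where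
  "susp_pow T n X = (if 0 \<le> n then (Susp T ^^ nat n) X
                     else (inv_into (Ob T) (Susp T) ^^ nat (- n)) X)"

definition susp_powM :: "('o, 'm, 'z) tricat_scheme \<Rightarrow> int \<Rightarrow> 'm \<Rightarrow> 'm" where
  "susp_powM T n f = (if 0 \<le> n then (SuspM T ^^ nat n) f
                      else (inv_into (Mor T) (SuspM T) ^^ nat (- n)) f)"


subsection \<open>Coproducts and compact objects\<close>

definition locally_small :: "'u itself \<Rightarrow> ('o, 'm, 'z) tricat_scheme \<Rightarrow> bool" where
  "locally_small U T \<longleftrightarrow> (\<forall>X\<in>Ob T. \<forall>Y\<in>Ob T. small U (Hom T X Y))"

definition is_coproduct ::
  "('o, 'm, 'z) tricat_scheme \<Rightarrow> 'i set \<Rightarrow> ('i \<Rightarrow> 'o) \<Rightarrow> 'o \<Rightarrow> ('i \<Rightarrow> 'm) \<Rightarrow> bool" where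
  "is_coproduct T I X P \<iota> \<longleftrightarrow> X \<in> I \<rightarrow> Ob T \<and> P \<in> Ob T \<and> (\<forall>i\<in>I. \<iota> i \<in> Hom T (X i) P) \<and>
     (\<forall>Y\<in>Ob T. \<forall>g. (\<forall>i\<in>I. g i \<in> Hom T (X i) Y) \<longrightarrow>
        (\<exists>!h. h \<in> Hom T P Y \<and> (\<forall>i\<in>I. h \<bullet>\<^bsub>T\<^esub> \<iota> i = g i)))"

definition has_coproducts :: "'u itself \<Rightarrow> ('o, 'm, 'z) tricat_scheme \<Rightarrow> bool" where
  "has_coproducts U T \<longleftrightarrow>
     (\<forall>(I :: 'u set) X. small U I \<and> X \<in> I \<rightarrow> Ob T \<longrightarrow> (\<exists>P \<iota>. is_coproduct T I X P \<iota>))"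

text \<open>\<open>C\<close> is compact iff the canonical map \<open>\<Oplus>\<^sub>i Hom(C, X\<^sub>i) \<rightarrow> Hom(C, \<Coprod>\<^sub>i X\<^sub>i)\<close> is bijective for all
  small families.\<close>

definition compact_objects :: "'u itself \<Rightarrow> ('o, 'm, 'z) tricat_scheme \<Rightarrow> 'o set" where
  "compact_objects U T = {C \<in> Ob T. \<forall>(I :: 'u set) X P \<iota>.
     small U I \<and> is_coproduct T I X P \<iota> \<longrightarrow>
     bij_betw (\<lambda>f. \<Oplus>\<^bsub>hom_group T C P\<^esub>i\<in>{i\<in>I. f i \<noteq> Zer T C (X i)}. \<iota> i \<bullet>\<^bsub>T\<^esub> f i)
       (carrier (sum_group I (\<lambda>i. add_monoid (hom_group T C (X i)))))
       (Hom T C P)}"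


subsection \<open>Thick and localizing subcategories\<close>

text \<open>Full subcategories are given by their sets of objects.  Being nonempty and closed
  under suspensions and cones, a triangulated subcategory contains all zero objects and is closed
  under isomorphisms.\<close>

definition triangulated_subcategory :: "('o, 'm, 'z) tricat_scheme \<Rightarrow> 'o set \<Rightarrow> bool" where
  "triangulated_subcategory T S \<longleftrightarrow> S \<subseteq> Ob T \<and> S \<noteq> {} \<and>
     (\<forall>X\<in>Ob T. X \<in> S \<longleftrightarrow> Susp T X \<in> S) \<and>
     (\<forall>u v w. (u, v, w) \<in> Tri T \<and> Dom T u \<in> S \<and> Cod T u \<in> S \<longrightarrow> Cod T v \<in> S)"

definition thick_subcategory :: "('o, 'm, 'z) tricat_scheme \<Rightarrow> 'o set \<Rightarrow> bool" where
  "thick_subcategory T S \<longleftrightarrow> triangulated_subcategory T S \<and>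
     (\<forall>X Y Z. is_biproduct T X Y Z \<and> Z \<in> S \<longrightarrow> X \<in> S \<and> Y \<in> S)"

definition localizing_subcategory ::
  "'u itself \<Rightarrow> ('o, 'm, 'z) tricat_scheme \<Rightarrow> 'o set \<Rightarrow> bool" where
  "localizing_subcategory U T S \<longleftrightarrow> triangulated_subcategory T S \<and>
     (\<forall>(I :: 'u set) X P \<iota>.
        small U I \<and> X \<in> I \<rightarrow> S \<and> is_coproduct T I X P \<iota> \<longrightarrow> P \<in> S)"

definition Loc :: "'u itself \<Rightarrow> ('o, 'm, 'z) tricat_scheme \<Rightarrow> 'o set \<Rightarrow> 'o set" where
  "Loc U T C = \<Inter>{S. localizing_subcategory U T S \<and> C \<subseteq> S}"

definition compactly_generated :: "'u itself \<Rightarrow> ('o, 'm, 'z) tricat_scheme \<Rightarrow> bool" where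
  "compactly_generated U T \<longleftrightarrow>
     (\<exists>G. small U G \<and> G \<subseteq> compact_objects U T \<and> Ob T = Loc U T G)"


section \<open>Linear structure\<close>

text \<open>The condition \<open>\<eta>\<Sigma> = (-1)\<^sup>n\<Sigma>\<eta>\<close> compares morphisms \<open>\<Sigma>X \<rightarrow> \<Sigma>\<^sup>n\<^sup>+\<^sup>1X\<close>.\<close>

definition graded_center :: "('o, 'm, 'z) tricat_scheme \<Rightarrow> int \<Rightarrow> ('o \<Rightarrow> 'm) set" where
  "graded_center T n = {\<eta>.
     (\<forall>X\<in>Ob T. \<eta> X \<in> Hom T X (susp_pow T n X)) \<and>
     (\<forall>X\<in>Ob T. \<forall>Y\<in>Ob T. \<forall>f\<in>Hom T X Y. susp_powM T n f \<bullet>\<^bsub>T\<^esub> \<eta> X = \<eta> Y \<bullet>\<^bsub>T\<^esub> f) \<and>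
     (\<forall>X\<in>Ob T. \<eta> (Susp T X) =
        (if even n then SuspM T (\<eta> X) else neg_mor T (SuspM T (\<eta> X))))}"

text \<open>A homomorphism of graded rings into the graded center, given degreewise by maps
  \<open>\<phi>\<^sub>n : R\<^sub>n \<rightarrow> Z\<^sup>n(T)\<close>.  The product of \<open>\<eta>\<close> of degree \<open>m\<close> and \<open>\<zeta>\<close> of degree \<open>n\<close> is
  the composite \<open>X \<rightarrow> \<Sigma>\<^sup>nX \<rightarrow> \<Sigma>\<^sup>m\<^sup>+\<^sup>nX\<close> of \<open>\<zeta>\<^sub>X\<close> and \<open>\<Sigma>\<^sup>n\<eta>\<^sub>X\<close>; thus evaluation at \<open>X\<close> is a
  ring homomorphism to \<open>End\<^sup>*(X)\<close> with its usual composition product.\<close>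

definition R_linear ::
  "('a, 'y) gring_scheme \<Rightarrow> ('o, 'm, 'z) tricat_scheme \<Rightarrow> (int \<Rightarrow> 'a \<Rightarrow> 'o \<Rightarrow> 'm) \<Rightarrow> bool" where
  "R_linear R T \<phi> \<longleftrightarrow>
     (\<forall>n. \<forall>r\<in>grade R n. \<phi> n r \<in> graded_center T n) \<and>
     (\<forall>n. \<forall>r\<in>grade R n. \<forall>s\<in>grade R n. \<forall>X\<in>Ob T.
        \<phi> n (r \<oplus>\<^bsub>R\<^esub> s) X = Plus T (\<phi> n r X) (\<phi> n s X)) \<and>
     (\<forall>X\<in>Ob T. \<phi> 0 \<one>\<^bsub>R\<^esub> X = Ident T X) \<and>
     (\<forall>m n. \<forall>r\<in>grade R m. \<forall>s\<in>grade R n. \<forall>X\<in>Ob T.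
        \<phi> (m + n) (r \<otimes>\<^bsub>R\<^esub> s) X = susp_powM T n (\<phi> m r X) \<bullet>\<^bsub>T\<^esub> \<phi> n s X)"

definition hom_star_group ::
  "('o, 'm, 'z) tricat_scheme \<Rightarrow> 'o \<Rightarrow> 'o \<Rightarrow> (int \<Rightarrow> 'm) monoid" where
  "hom_star_group T X Y = sum_group UNIV (\<lambda>i. add_monoid (hom_group T X (susp_pow T i Y)))"

text \<open>\<open>Hom\<^sup>*(X, Y)\<close> as an \<open>R\<close>-module: for \<open>r\<close> of degree \<open>n\<close> and \<open>f : X \<rightarrow> \<Sigma>\<^sup>iY\<close> the product \<open>r f\<close>
  is \<open>X \<rightarrow> \<Sigma>\<^sup>iY \<rightarrow> \<Sigma>\<^sup>i\<^sup>+\<^sup>nY\<close>, the second map being \<open>\<Sigma>\<^sup>i\<phi>(r)\<^sub>Y\<close>.\<close>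

definition hom_star ::
  "('a, 'y) gring_scheme \<Rightarrow> ('o, 'm, 'z) tricat_scheme \<Rightarrow> (int \<Rightarrow> 'a \<Rightarrow> 'o \<Rightarrow> 'm) \<Rightarrow>
   'o \<Rightarrow> 'o \<Rightarrow> ('a, int \<Rightarrow> 'm) module" where
  "hom_star R T \<phi> X Y =
     \<lparr>carrier = carrier (hom_star_group T X Y),
      monoid.mult = undefined, one = undefined,
      ring.zero = \<one>\<^bsub>hom_star_group T X Y\<^esub>,
      add = monoid.mult (hom_star_group T X Y),
      smult = (\<lambda>r f k. \<Oplus>\<^bsub>hom_group T X (susp_pow T k Y)\<^esub>n\<in>{n. hcomp R r n \<noteq> \<zero>\<^bsub>R\<^esub>}.
                 susp_powM T (k - n) (\<phi> n (hcomp R r n) Y) \<bullet>\<^bsub>T\<^esub> f (k - n))\<rparr>"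

definition noetherian_category ::
  "'u itself \<Rightarrow> ('a, 'y) gring_scheme \<Rightarrow> ('o, 'm, 'z) tricat_scheme \<Rightarrow>
   (int \<Rightarrow> 'a \<Rightarrow> 'o \<Rightarrow> 'm) \<Rightarrow> bool" where
  "noetherian_category U R T \<phi> \<longleftrightarrow>
     (\<forall>C\<in>compact_objects U T. finitely_generated_module R (hom_star R T \<phi> C C))"


section \<open>Local cohomology, support and stratification\<close>

definition torsion_objects ::
  "'u itself \<Rightarrow> ('a, 'y) gring_scheme \<Rightarrow> ('o, 'm, 'z) tricat_scheme \<Rightarrow>
   (int \<Rightarrow> 'a \<Rightarrow> 'o \<Rightarrow> 'm) \<Rightarrow> 'a set set \<Rightarrow> 'o set" where
  "torsion_objects U R T \<phi> V = {X \<in> Ob T. \<forall>C\<in>compact_objects U T. \<forall>P\<in>Spec R - V.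
     localization R (hom_star R T \<phi> C X) P = {localization_zero R (hom_star R T \<phi> C X) P}}"

text \<open>The localization triangle \<open>\<Gamma>\<^sub>VX \<rightarrow> X \<rightarrow> L\<^sub>VX \<rightarrow> \<Sigma>\<Gamma>\<^sub>VX\<close> is determined up to unique
  isomorphism by \<open>\<Gamma>\<^sub>VX \<in> T\<^sub>V\<close> and \<open>Hom(T\<^sub>V, L\<^sub>VX) = 0\<close>; one is chosen for each \<open>X\<close>.  Only the effect
  of the functors \<open>\<Gamma>\<^sub>V\<close> and \<open>L\<^sub>V\<close> on objects is used.\<close>

definition is_localization_triangle ::
  "'u itself \<Rightarrow> ('a, 'y) gring_scheme \<Rightarrow> ('o, 'm, 'z) tricat_scheme \<Rightarrow>
   (int \<Rightarrow> 'a \<Rightarrow> 'o \<Rightarrow> 'm) \<Rightarrow> 'a set set \<Rightarrow> 'o \<Rightarrow> 'm \<times> 'm \<times> 'm \<Rightarrow> bool" where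
  "is_localization_triangle U R T \<phi> V X = (\<lambda>(u, v, w). (u, v, w) \<in> Tri T \<and> Cod T u = X \<and>
     Dom T u \<in> torsion_objects U R T \<phi> V \<and>
     (\<forall>Z\<in>torsion_objects U R T \<phi> V. Hom T Z (Cod T v) = {Zer T Z (Cod T v)}))"

definition localization_triangle ::
  "'u itself \<Rightarrow> ('a, 'y) gring_scheme \<Rightarrow> ('o, 'm, 'z) tricat_scheme \<Rightarrow>
   (int \<Rightarrow> 'a \<Rightarrow> 'o \<Rightarrow> 'm) \<Rightarrow> 'a set set \<Rightarrow> 'o \<Rightarrow> 'm \<times> 'm \<times> 'm" where
  "localization_triangle U R T \<phi> V X = (SOME t. is_localization_triangle U R T \<phi> V X t)"

definition GammaV ::
  "'u itself \<Rightarrow> ('a, 'y) gring_scheme \<Rightarrow> ('o, 'm, 'z) tricat_scheme \<Rightarrow>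
   (int \<Rightarrow> 'a \<Rightarrow> 'o \<Rightarrow> 'm) \<Rightarrow> 'a set set \<Rightarrow> 'o \<Rightarrow> 'o" where
  "GammaV U R T \<phi> V X = (case localization_triangle U R T \<phi> V X of (u, v, w) \<Rightarrow> Dom T u)"

definition LV ::
  "'u itself \<Rightarrow> ('a, 'y) gring_scheme \<Rightarrow> ('o, 'm, 'z) tricat_scheme \<Rightarrow>
   (int \<Rightarrow> 'a \<Rightarrow> 'o \<Rightarrow> 'm) \<Rightarrow> 'a set set \<Rightarrow> 'o \<Rightarrow> 'o" where
  "LV U R T \<phi> V X = (case localization_triangle U R T \<phi> V X of (u, v, w) \<Rightarrow> Cod T v)"

definition Gamma ::
  "'u itself \<Rightarrow> ('a, 'y) gring_scheme \<Rightarrow> ('o, 'm, 'z) tricat_scheme \<Rightarrow>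
   (int \<Rightarrow> 'a \<Rightarrow> 'o \<Rightarrow> 'm) \<Rightarrow> 'a set \<Rightarrow> 'o \<Rightarrow> 'o" where
  "Gamma U R T \<phi> P X = GammaV U R T \<phi> (VV R P) (LV U R T \<phi> (ZZ R P) X)"

definition Gamma_image ::
  "'u itself \<Rightarrow> ('a, 'y) gring_scheme \<Rightarrow> ('o, 'm, 'z) tricat_scheme \<Rightarrow>
   (int \<Rightarrow> 'a \<Rightarrow> 'o \<Rightarrow> 'm) \<Rightarrow> 'a set \<Rightarrow> 'o set" where
  "Gamma_image U R T \<phi> P = {Y \<in> Ob T. \<exists>X\<in>Ob T. isomorphic T (Gamma U R T \<phi> P X) Y}"

definition supp ::
  "'u itself \<Rightarrow> ('a, 'y) gring_scheme \<Rightarrow> ('o, 'm, 'z) tricat_scheme \<Rightarrow>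
   (int \<Rightarrow> 'a \<Rightarrow> 'o \<Rightarrow> 'm) \<Rightarrow> 'o \<Rightarrow> 'a set set" where
  "supp U R T \<phi> X = {P \<in> Spec R. \<not> is_zero T (Gamma U R T \<phi> P X)}"

definition supp_class ::
  "'u itself \<Rightarrow> ('a, 'y) gring_scheme \<Rightarrow> ('o, 'm, 'z) tricat_scheme \<Rightarrow>
   (int \<Rightarrow> 'a \<Rightarrow> 'o \<Rightarrow> 'm) \<Rightarrow> 'o set \<Rightarrow> 'a set set" where
  "supp_class U R T \<phi> C = (\<Union>X\<in>C. supp U R T \<phi> X)"

definition local_global_principle ::
  "'u itself \<Rightarrow> ('a, 'y) gring_scheme \<Rightarrow> ('o, 'm, 'z) tricat_scheme \<Rightarrow>
   (int \<Rightarrow> 'a \<Rightarrow> 'o \<Rightarrow> 'm) \<Rightarrow> bool" where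
  "local_global_principle U R T \<phi> \<longleftrightarrow>
     (\<forall>X\<in>Ob T. Loc U T {X} = Loc U T {Gamma U R T \<phi> P X | P. P \<in> Spec R})"

definition zero_subcategory :: "('o, 'm, 'z) tricat_scheme \<Rightarrow> 'o set \<Rightarrow> bool" where
  "zero_subcategory T S \<longleftrightarrow> (\<forall>X\<in>S. is_zero T X)"

definition minimal_localizing ::
  "'u itself \<Rightarrow> ('o, 'm, 'z) tricat_scheme \<Rightarrow> 'o set \<Rightarrow> bool" where
  "minimal_localizing U T S \<longleftrightarrow> localizing_subcategory U T S \<and> \<not> zero_subcategory T S \<and>
     (\<forall>S'. localizing_subcategory U T S' \<and> S' \<subseteq> S \<longrightarrow> zero_subcategory T S' \<or> S' = S)"

definition stratified ::
  "'u itself \<Rightarrow> ('a, 'y) gring_scheme \<Rightarrow> ('o, 'm, 'z) tricat_scheme \<Rightarrow>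
   (int \<Rightarrow> 'a \<Rightarrow> 'o \<Rightarrow> 'm) \<Rightarrow> bool" where
  "stratified U R T \<phi> \<longleftrightarrow> local_global_principle U R T \<phi> \<and>
     (\<forall>P\<in>Spec R. zero_subcategory T (Gamma_image U R T \<phi> P) \<or>
                 minimal_localizing U T (Gamma_image U R T \<phi> P))"

definition thick_subcategories_of_compacts ::
  "'u itself \<Rightarrow> ('o, 'm, 'z) tricat_scheme \<Rightarrow> 'o set set" where
  "thick_subcategories_of_compacts U T = {C. C \<subseteq> compact_objects U T \<and> thick_subcategory T C}"

end

theory Submission
  imports Defs
begin

text \<open>
  Both directions rest on an elementwise description of the support.  If \<open>Z\<close> runs through the
  compact objects of \<open>T\<^bsub>V(p)\<^esub>\<close>, then \<open>p\<close> lies in the support of \<open>X\<close> iff some morphism \<open>Z \<rightarrow> X\<close> is not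
  annihilated by any homogeneous \<open>s \<notin> p\<close>.  This uses that \<open>T\<^sub>V\<close> is generated by compact objects: if
  \<open>X\<close> in \<open>T\<^sub>V\<close> is nonzero, take a compact \<open>C\<close> with \<open>Hom(C, X) \<noteq> 0\<close> for which the radical of the
  annihilator of \<open>End\<^sup>*(C)\<close> is maximal; a nonzero morphism \<open>C \<rightarrow> X\<close> killed by an \<open>s\<close> outside that radical
  would extend to the cone of \<open>s\<close> on \<open>C\<close>, which has a larger radical.

  For compact \<open>C\<close> the support is then \<open>{p | End\<^sup>*(C)\<^sub>p \<noteq> 0}\<close>, hence specialization closed: by
  Nakayama's lemma for the finitely generated module \<open>End\<^sup>*(C)\<close>, forming the cone of an \<open>r \<in> p\<close> does not
  remove \<open>p\<close>, and after enough such cones one arrives at an object of \<open>T\<^bsub>V(p)\<^esub>\<close>.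

  Stratification gives \<open>D \<in> Loc(S)\<close> whenever the support of \<open>D\<close> is contained in that of \<open>S\<close>, and
  by Neeman's theorem a compact object of \<open>Loc(S)\<close> lies in \<open>S\<close> if \<open>S\<close> is a thick subcategory of compact
  objects.  So \<open>S\<close> is determined by its support.
\<close>

section \<open>Additive and triangulated categories\<close>

text \<open>The functors \<open>\<Gamma>\<close> and \<open>L\<close> exist here only as values on
  objects picked by \<open>SOME\<close>, so nothing can be argued by functoriality or by composing
  localizations. Vanishing of \<open>Gamma\<close> is therefore translated into a statement about
  which morphisms are annihilated by which homogeneous ring elements; as only annihilation is
  tested, the signs in the graded center never have to be computed. The second obstacle is size.
  Coproducts exist for small families, but the compact objects need not form a small set. So
  generation of \<open>T_V\<close> is proved from a small family of compact objects closed under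
  shifts and cones of ring elements, and the descent from \<open>Loc\<close> to a thick
  \<open>S\<close> begins by selecting a small part of \<open>S\<close>. Finally, "enough such
  cones" does not mean an iteration over chosen generators of a prime. An object whose radical is
  maximal is taken at once, which the noetherian ring allows, and one more cone either contradicts
  maximality or shows that the radical already contains the given element.\<close>

context category begin

lemma Hom_iff [simp]: "f \<in> Hom T X Y \<longleftrightarrow> f \<in> Mor T \<and> Dom T f = X \<and> Cod T f = Y"
  by (simp add: Hom_def)

lemma Dom_Ob [simp]: "f \<in> Mor T \<Longrightarrow> Dom T f \<in> Ob T"
  and Cod_Ob [simp]: "f \<in> Mor T \<Longrightarrow> Cod T f \<in> Ob T"
  using dom_cod by auto

lemma Hom_Ob: "f \<in> Hom T X Y \<Longrightarrow> X \<in> Ob T" "f \<in> Hom T X Y \<Longrightarrow> Y \<in> Ob T"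
  using dom_cod by auto

lemma HomD:
  assumes "f \<in> Hom T X Y"
  shows "f \<in> Mor T" "Dom T f = X" "Cod T f = Y" "X \<in> Ob T" "Y \<in> Ob T"
  using assms Hom_Ob[OF assms] by auto

lemma comp_Mor [simp]: "\<lbrakk>g \<in> Mor T; f \<in> Mor T; Dom T g = Cod T f\<rbrakk> \<Longrightarrow> g \<bullet> f \<in> Mor T"
  and Dom_comp [simp]: "\<lbrakk>g \<in> Mor T; f \<in> Mor T; Dom T g = Cod T f\<rbrakk> \<Longrightarrow> Dom T (g \<bullet> f) = Dom T f"
  and Cod_comp [simp]: "\<lbrakk>g \<in> Mor T; f \<in> Mor T; Dom T g = Cod T f\<rbrakk> \<Longrightarrow> Cod T (g \<bullet> f) = Cod T g"
  using comp_mem[of g "Dom T g" "Cod T g" f "Dom T f"] by auto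

lemma comp_assoc' [simp]:
  "\<lbrakk>h \<in> Mor T; g \<in> Mor T; f \<in> Mor T; Dom T h = Cod T g; Dom T g = Cod T f\<rbrakk>
    \<Longrightarrow> (h \<bullet> g) \<bullet> f = h \<bullet> (g \<bullet> f)"
  using comp_assoc[of h "Dom T h" "Cod T h" g "Dom T g" f "Dom T f"] by auto

lemma Ident_Mor [simp]: "X \<in> Ob T \<Longrightarrow> Ident T X \<in> Mor T"
  and Dom_Ident [simp]: "X \<in> Ob T \<Longrightarrow> Dom T (Ident T X) = X"
  and Cod_Ident [simp]: "X \<in> Ob T \<Longrightarrow> Cod T (Ident T X) = X"
  using ident_mem by auto

lemma Ident_comp [simp]: "\<lbrakk>f \<in> Mor T; Cod T f = X\<rbrakk> \<Longrightarrow> Ident T X \<bullet> f = f"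
  and comp_Ident [simp]: "\<lbrakk>f \<in> Mor T; Dom T f = X\<rbrakk> \<Longrightarrow> f \<bullet> Ident T X = f"
  using ident_left[of f "Dom T f" "Cod T f"] ident_right[of f "Dom T f" "Cod T f"] by auto

end

context additive_category begin

lemma hom_group_simps [simp]:
  "carrier (hom_group T X Y) = Hom T X Y" "zero (hom_group T X Y) = Zer T X Y"
  "add (hom_group T X Y) = Plus T"
  by (simp_all add: hom_group_def)

lemma Zer_Mor [simp]: "\<lbrakk>X \<in> Ob T; Y \<in> Ob T\<rbrakk> \<Longrightarrow> Zer T X Y \<in> Mor T"
  and Dom_Zer [simp]: "\<lbrakk>X \<in> Ob T; Y \<in> Ob T\<rbrakk> \<Longrightarrow> Dom T (Zer T X Y) = X"
  and Cod_Zer [simp]: "\<lbrakk>X \<in> Ob T; Y \<in> Ob T\<rbrakk> \<Longrightarrow> Cod T (Zer T X Y) = Y"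
  using abelian_monoid.zero_closed[OF abelian_group.axioms(1)[OF hom_abelian_group[of X Y]]]
  by auto

lemma Plus_Mor [simp]: "\<lbrakk>f \<in> Mor T; g \<in> Mor T; Dom T f = Dom T g; Cod T f = Cod T g\<rbrakk>
    \<Longrightarrow> Plus T f g \<in> Mor T"
  and Dom_Plus [simp]: "\<lbrakk>f \<in> Mor T; g \<in> Mor T; Dom T f = Dom T g; Cod T f = Cod T g\<rbrakk>
    \<Longrightarrow> Dom T (Plus T f g) = Dom T g"
  and Cod_Plus [simp]: "\<lbrakk>f \<in> Mor T; g \<in> Mor T; Dom T f = Dom T g; Cod T f = Cod T g\<rbrakk>
    \<Longrightarrow> Cod T (Plus T f g) = Cod T g"
  and Plus_commute: "\<lbrakk>f \<in> Mor T; g \<in> Mor T; Dom T f = Dom T g; Cod T f = Cod T g\<rbrakk>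
    \<Longrightarrow> Plus T f g = Plus T g f"
  using abelian_monoid.a_closed[OF abelian_group.axioms(1)[OF hom_abelian_group[of "Dom T g" "Cod T g"]], of f g]
    abelian_monoid.a_comm[OF abelian_group.axioms(1)[OF hom_abelian_group[of "Dom T g" "Cod T g"]], of f g]
  by auto

lemma Plus_assoc: "\<lbrakk>f \<in> Mor T; g \<in> Mor T; h \<in> Mor T; Dom T f = Dom T g; Cod T f = Cod T g;
    Dom T g = Dom T h; Cod T g = Cod T h\<rbrakk> \<Longrightarrow> Plus T (Plus T f g) h = Plus T f (Plus T g h)"
  using abelian_monoid.a_assoc[OF abelian_group.axioms(1)[OF hom_abelian_group[of "Dom T h" "Cod T h"]], of f g h]
  by auto

lemma Plus_Zer [simp]: "\<lbrakk>f \<in> Mor T; Dom T f = X; Cod T f = Y\<rbrakk> \<Longrightarrow> Plus T f (Zer T X Y) = f"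
  and Zer_Plus [simp]: "\<lbrakk>f \<in> Mor T; Dom T f = X; Cod T f = Y\<rbrakk> \<Longrightarrow> Plus T (Zer T X Y) f = f"
  using abelian_monoid.r_zero[OF abelian_group.axioms(1)[OF hom_abelian_group[of X Y]], of f]
    abelian_monoid.l_zero[OF abelian_group.axioms(1)[OF hom_abelian_group[of X Y]], of f]
  by auto

lemma neg_Mor [simp]: "f \<in> Mor T \<Longrightarrow> neg_mor T f \<in> Mor T"
  and Dom_neg [simp]: "f \<in> Mor T \<Longrightarrow> Dom T (neg_mor T f) = Dom T f"
  and Cod_neg [simp]: "f \<in> Mor T \<Longrightarrow> Cod T (neg_mor T f) = Cod T f"
  and Plus_neg [simp]: "\<lbrakk>f \<in> Mor T; Dom T f = X; Cod T f = Y\<rbrakk> \<Longrightarrow> Plus T f (neg_mor T f) = Zer T X Y"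
  and neg_Plus [simp]: "\<lbrakk>f \<in> Mor T; Dom T f = X; Cod T f = Y\<rbrakk> \<Longrightarrow> Plus T (neg_mor T f) f = Zer T X Y"
  and neg_neg [simp]: "f \<in> Mor T \<Longrightarrow> neg_mor T (neg_mor T f) = f"
  using abelian_group.a_inv_closed[OF hom_abelian_group[of "Dom T f" "Cod T f"], of f]
    abelian_group.r_neg[OF hom_abelian_group[of "Dom T f" "Cod T f"], of f]
    abelian_group.l_neg[OF hom_abelian_group[of "Dom T f" "Cod T f"], of f]
    abelian_group.minus_minus[OF hom_abelian_group[of "Dom T f" "Cod T f"], of f]
  by (auto simp: neg_mor_def)

lemma Plus_left_cancel:
  "\<lbrakk>Plus T f g = Plus T f h; f \<in> Hom T X Y; g \<in> Hom T X Y; h \<in> Hom T X Y\<rbrakk> \<Longrightarrow> g = h"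
  by (metis Hom_iff Plus_assoc Zer_Plus neg_Mor neg_Plus Dom_neg Cod_neg)

lemma neg_eq_iff:
  assumes "f \<in> Mor T" "g \<in> Mor T"
  shows "neg_mor T f = g \<longleftrightarrow> f = neg_mor T g" "neg_mor T f = neg_mor T g \<longleftrightarrow> f = g"
  using assms neg_neg by metis+

lemma neg_unique: "\<lbrakk>Plus T f g = Zer T X Y; f \<in> Hom T X Y; g \<in> Hom T X Y\<rbrakk> \<Longrightarrow> g = neg_mor T f"
  by (rule Plus_left_cancel[of f _ _ X Y]) auto

lemma comp_Plus: "\<lbrakk>g \<in> Mor T; f \<in> Mor T; f' \<in> Mor T; Dom T g = Cod T f; Cod T f = Cod T f';
    Dom T f = Dom T f'\<rbrakk> \<Longrightarrow> g \<bullet> Plus T f f' = Plus T (g \<bullet> f) (g \<bullet> f')"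
  by (rule comp_add_right[of g "Dom T g" "Cod T g" f "Dom T f"]) auto

lemma Plus_comp: "\<lbrakk>f \<in> Mor T; g \<in> Mor T; g' \<in> Mor T; Dom T g = Cod T f; Dom T g = Dom T g';
    Cod T g = Cod T g'\<rbrakk> \<Longrightarrow> Plus T g g' \<bullet> f = Plus T (g \<bullet> f) (g' \<bullet> f)"
  by (rule comp_add_left[of g "Dom T g" "Cod T g" g' f "Dom T f"]) auto

lemma Plus_self_Zer: "\<lbrakk>Plus T f f = f; f \<in> Hom T X Y\<rbrakk> \<Longrightarrow> f = Zer T X Y"
  by (rule Plus_left_cancel[of f _ _ X Y]) auto

lemma comp_Zer [simp]:
  assumes "g \<in> Mor T" "Dom T g = Y" "X \<in> Ob T" shows "g \<bullet> Zer T X Y = Zer T X (Cod T g)"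
proof (rule Plus_self_Zer)
  have "Y \<in> Ob T" using assms by auto
  then show "Plus T (g \<bullet> Zer T X Y) (g \<bullet> Zer T X Y) = g \<bullet> Zer T X Y"
    using comp_Plus[of g "Zer T X Y" "Zer T X Y"] assms by auto
  show "g \<bullet> Zer T X Y \<in> Hom T X (Cod T g)" using assms \<open>Y \<in> Ob T\<close> by simp
qed

lemma Zer_comp [simp]:
  assumes "f \<in> Mor T" "Cod T f = Y" "Z \<in> Ob T" shows "Zer T Y Z \<bullet> f = Zer T (Dom T f) Z"
proof (rule Plus_self_Zer)
  have "Y \<in> Ob T" using assms by auto
  then show "Plus T (Zer T Y Z \<bullet> f) (Zer T Y Z \<bullet> f) = Zer T Y Z \<bullet> f"
    using Plus_comp[of f "Zer T Y Z" "Zer T Y Z"] assms by auto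
  show "Zer T Y Z \<bullet> f \<in> Hom T (Dom T f) Z" using assms \<open>Y \<in> Ob T\<close> by simp
qed

lemma neg_comp [simp]:
  assumes "g \<in> Mor T" "f \<in> Mor T" "Dom T g = Cod T f"
  shows "neg_mor T g \<bullet> f = neg_mor T (g \<bullet> f)"
proof (rule neg_unique)
  show "Plus T (g \<bullet> f) (neg_mor T g \<bullet> f) = Zer T (Dom T f) (Cod T g)"
    by (subst Plus_comp[symmetric]) (simp_all add: assms)
qed (simp_all add: assms)

lemma comp_neg [simp]:
  assumes "g \<in> Mor T" "f \<in> Mor T" "Dom T g = Cod T f"
  shows "g \<bullet> neg_mor T f = neg_mor T (g \<bullet> f)"
proof (rule neg_unique)
  show "Plus T (g \<bullet> f) (g \<bullet> neg_mor T f) = Zer T (Dom T f) (Cod T g)"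
    by (subst comp_Plus[symmetric]) (simp_all add: assms)
qed (simp_all add: assms)

lemma neg_Zer [simp]: "\<lbrakk>X \<in> Ob T; Y \<in> Ob T\<rbrakk> \<Longrightarrow> neg_mor T (Zer T X Y) = Zer T X Y"
  by (rule neg_unique[of "Zer T X Y" _ X Y, symmetric]) auto

lemma neg_eq_Zer_iff [simp]: "\<lbrakk>f \<in> Mor T; X \<in> Ob T; Y \<in> Ob T\<rbrakk> \<Longrightarrow> neg_mor T f = Zer T X Y \<longleftrightarrow> f = Zer T X Y"
  by (metis neg_Zer neg_neg)

definition Minus :: "'b \<Rightarrow> 'b \<Rightarrow> 'b" where "Minus f g = Plus T f (neg_mor T g)"

lemma Minus_Mor [simp]: "\<lbrakk>f \<in> Mor T; g \<in> Mor T; Dom T f = Dom T g; Cod T f = Cod T g\<rbrakk>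
    \<Longrightarrow> Minus f g \<in> Mor T"
  and Dom_Minus [simp]: "\<lbrakk>f \<in> Mor T; g \<in> Mor T; Dom T f = Dom T g; Cod T f = Cod T g\<rbrakk>
    \<Longrightarrow> Dom T (Minus f g) = Dom T g"
  and Cod_Minus [simp]: "\<lbrakk>f \<in> Mor T; g \<in> Mor T; Dom T f = Dom T g; Cod T f = Cod T g\<rbrakk>
    \<Longrightarrow> Cod T (Minus f g) = Cod T g"
  by (simp_all add: Minus_def)

lemma Minus_eq_Zer_iff:
  assumes "f \<in> Mor T" "g \<in> Mor T" "Dom T f = Dom T g" "Cod T f = Cod T g"
  shows "Minus f g = Zer T (Dom T g) (Cod T g) \<longleftrightarrow> f = g"
proof
  assume "Minus f g = Zer T (Dom T g) (Cod T g)"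
  then have "neg_mor T g = neg_mor T f" unfolding Minus_def
    by (intro neg_unique) (use assms in auto)
  then show "f = g" using assms by (metis neg_neg)
qed (use assms in \<open>auto simp: Minus_def\<close>)

lemma comp_Minus: "\<lbrakk>g \<in> Mor T; f \<in> Mor T; f' \<in> Mor T; Dom T g = Cod T f; Cod T f = Cod T f';
    Dom T f = Dom T f'\<rbrakk> \<Longrightarrow> g \<bullet> Minus f f' = Minus (g \<bullet> f) (g \<bullet> f')"
  by (simp add: Minus_def comp_Plus)

lemma Minus_comp: "\<lbrakk>f \<in> Mor T; g \<in> Mor T; g' \<in> Mor T; Dom T g = Cod T f; Dom T g = Dom T g';
    Cod T g = Cod T g'\<rbrakk> \<Longrightarrow> Minus g g' \<bullet> f = Minus (g \<bullet> f) (g' \<bullet> f)"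
  by (simp add: Minus_def Plus_comp)

lemma Minus_Plus_cancel [simp]: "\<lbrakk>f \<in> Mor T; g \<in> Mor T; Dom T f = Dom T g; Cod T f = Cod T g\<rbrakk>
    \<Longrightarrow> Plus T (Minus f g) g = f"
  by (simp add: Minus_def Plus_assoc)

lemma Minus_Zer [simp]: "\<lbrakk>f \<in> Mor T; Dom T f = X; Cod T f = Y\<rbrakk> \<Longrightarrow> Minus f (Zer T X Y) = f"
  and Minus_self [simp]: "\<lbrakk>f \<in> Mor T; Dom T f = X; Cod T f = Y\<rbrakk> \<Longrightarrow> Minus f f = Zer T X Y"
  by (auto simp: Minus_def)

lemma is_zero_iff: "Z \<in> Ob T \<Longrightarrow> is_zero T Z \<longleftrightarrow> Ident T Z = Zer T Z Z"
proof
  assume "is_zero T Z" "Z \<in> Ob T"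
  then show "Ident T Z = Zer T Z Z"
    unfolding is_zero_def by (metis Hom_iff Ident_Mor Dom_Ident Cod_Ident Zer_Mor Dom_Zer Cod_Zer)
next
  assume Z: "Z \<in> Ob T" and e: "Ident T Z = Zer T Z Z"
  have 1: "f = Zer T X Z" if "f \<in> Hom T X Z" for f X
    using Ident_comp[of f Z] Zer_comp[of f Z Z] that Z e by auto
  have 2: "f = Zer T Z X" if "f \<in> Hom T Z X" for f X
    using comp_Ident[of f Z] comp_Zer[of f Z Z] that Z e by auto
  show "is_zero T Z" unfolding is_zero_def
    using Z 1 2 by (metis Hom_iff Zer_Mor Dom_Zer Cod_Zer)
qed

lemma is_zeroD: "\<lbrakk>is_zero T Z; f \<in> Hom T X Z\<rbrakk> \<Longrightarrow> f = Zer T X Z"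
  and is_zeroD': "\<lbrakk>is_zero T Z; g \<in> Hom T Z X\<rbrakk> \<Longrightarrow> g = Zer T Z X"
  and is_zero_Ob: "is_zero T Z \<Longrightarrow> Z \<in> Ob T"
  unfolding is_zero_def
  by (metis Hom_iff Dom_Ob Cod_Ob Zer_Mor Dom_Zer Cod_Zer)+

end

section \<open>The suspension and its integral powers\<close>

context triangulated_category begin

lemma SuspM_Mor [simp]: "f \<in> Mor T \<Longrightarrow> SuspM T f \<in> Mor T"
  and Dom_SuspM [simp]: "f \<in> Mor T \<Longrightarrow> Dom T (SuspM T f) = Susp T (Dom T f)"
  and Cod_SuspM [simp]: "f \<in> Mor T \<Longrightarrow> Cod T (SuspM T f) = Susp T (Cod T f)"
  using susp_hom[of f "Dom T f" "Cod T f"] by auto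

lemma Susp_Ob [simp]: "X \<in> Ob T \<Longrightarrow> Susp T X \<in> Ob T"
  using susp_ob bij_betwE by blast

lemma SuspM_comp: "\<lbrakk>g \<in> Mor T; f \<in> Mor T; Dom T g = Cod T f\<rbrakk>
    \<Longrightarrow> SuspM T (g \<bullet> f) = SuspM T g \<bullet> SuspM T f"
  by (rule susp_comp[of g "Dom T g" "Cod T g" f "Dom T f"]) auto

lemma SuspM_Plus: "\<lbrakk>f \<in> Mor T; g \<in> Mor T; Dom T f = Dom T g; Cod T f = Cod T g\<rbrakk>
    \<Longrightarrow> SuspM T (Plus T f g) = Plus T (SuspM T f) (SuspM T g)"
  by (rule susp_add[of f "Dom T f" "Cod T f"]) auto

lemma SuspM_Zer [simp]: "\<lbrakk>X \<in> Ob T; Y \<in> Ob T\<rbrakk> \<Longrightarrow> SuspM T (Zer T X Y) = Zer T (Susp T X) (Susp T Y)"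
  by (rule Plus_self_Zer) (auto simp: SuspM_Plus[symmetric])

lemma SuspM_neg [simp]: "f \<in> Mor T \<Longrightarrow> SuspM T (neg_mor T f) = neg_mor T (SuspM T f)"
  by (rule neg_unique[of _ _ "Susp T (Dom T f)" "Susp T (Cod T f)"]) (auto simp: SuspM_Plus[symmetric])

lemma susp_pow_0 [simp]: "susp_pow T 0 X = X" and susp_pow_1 [simp]: "susp_pow T 1 X = Susp T X"
  and susp_powM_0 [simp]: "susp_powM T 0 f = f" and susp_powM_1 [simp]: "susp_powM T 1 f = SuspM T f"
  by (simp_all add: susp_pow_def susp_powM_def)

lemma susp_inv_Ob [simp]: "X \<in> Ob T \<Longrightarrow> inv_into (Ob T) (Susp T) X \<in> Ob T"
  and Susp_inv [simp]: "X \<in> Ob T \<Longrightarrow> Susp T (inv_into (Ob T) (Susp T) X) = X"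
  and inv_Susp [simp]: "X \<in> Ob T \<Longrightarrow> inv_into (Ob T) (Susp T) (Susp T X) = X"
  and SuspM_inv [simp]: "f \<in> Mor T \<Longrightarrow> SuspM T (inv_into (Mor T) (SuspM T) f) = f"
  and inv_SuspM [simp]: "f \<in> Mor T \<Longrightarrow> inv_into (Mor T) (SuspM T) (SuspM T f) = f"
  and susp_inv_Mor [simp]: "f \<in> Mor T \<Longrightarrow> inv_into (Mor T) (SuspM T) f \<in> Mor T"
  using susp_ob susp_mor
  by (auto simp: bij_betw_def f_inv_into_f inv_into_f_f inv_into_into)

lemma susp_pow_Ob [simp]: assumes "X \<in> Ob T" shows "susp_pow T n X \<in> Ob T"
proof -
  have "(Susp T ^^ k) X \<in> Ob T" "(inv_into (Ob T) (Susp T) ^^ k) X \<in> Ob T" for k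
    by (induction k) (auto simp: assms)
  then show ?thesis by (simp add: susp_pow_def)
qed

lemma susp_powM_Mor [simp]: assumes "f \<in> Mor T" shows "susp_powM T n f \<in> Mor T"
proof -
  have "(SuspM T ^^ k) f \<in> Mor T" "(inv_into (Mor T) (SuspM T) ^^ k) f \<in> Mor T" for k
    by (induction k) (auto simp: assms)
  then show ?thesis by (simp add: susp_powM_def)
qed

lemma susp_pow_Suc: assumes "X \<in> Ob T" shows "susp_pow T (n + 1) X = Susp T (susp_pow T n X)"
proof (cases "n \<ge> 0")
  case True then have "nat (n + 1) = Suc (nat n)" by auto
  with True show ?thesis by (simp add: susp_pow_def)
next
  case False
  define k where "k = nat (- (n + 1))"
  have k: "nat (-n) = Suc k" "nat (- (n+1)) = k" using False by (auto simp: k_def)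
  have "(inv_into (Ob T) (Susp T) ^^ k) X \<in> Ob T" for k by (induction k) (auto simp: assms)
  with k False show ?thesis by (auto simp: susp_pow_def)
qed

lemma susp_powM_Suc: assumes "f \<in> Mor T" shows "susp_powM T (n + 1) f = SuspM T (susp_powM T n f)"
proof (cases "n \<ge> 0")
  case True then have "nat (n + 1) = Suc (nat n)" by auto
  with True show ?thesis by (simp add: susp_powM_def)
next
  case False
  define k where "k = nat (- (n + 1))"
  have k: "nat (-n) = Suc k" "nat (- (n+1)) = k" using False by (auto simp: k_def)
  have "(inv_into (Mor T) (SuspM T) ^^ k) f \<in> Mor T" for k by (induction k) (auto simp: assms)
  with k False show ?thesis by (auto simp: susp_powM_def)
qed

lemma Susp_inj: "\<lbrakk>Susp T X = Susp T Y; X \<in> Ob T; Y \<in> Ob T\<rbrakk> \<Longrightarrow> X = Y"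
  by (metis inv_Susp)
lemma SuspM_inj: "\<lbrakk>SuspM T f = SuspM T g; f \<in> Mor T; g \<in> Mor T\<rbrakk> \<Longrightarrow> f = g"
  by (metis inv_SuspM)

text \<open>Because the suspension is an automorphism, claims about its powers tend to be equivalent
  for \<open>n\<close> and \<open>n + 1\<close>; one equivalence settles positive and negative
  exponents together.\<close>

lemma int_step_induct [case_names zero step]:
  fixes n :: int
  assumes "P 0" "\<And>n. P n \<longleftrightarrow> P (n + 1)" shows "P n"
proof (induction n rule: int_induct[where k = 0])
  case (step2 i) then show ?case using assms(2)[of "i - 1"] by simp
qed (use assms in auto)

lemma Susp_eq_iff [simp]: "\<lbrakk>X \<in> Ob T; Y \<in> Ob T\<rbrakk> \<Longrightarrow> Susp T X = Susp T Y \<longleftrightarrow> X = Y"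
  and SuspM_eq_iff [simp]: "\<lbrakk>f \<in> Mor T; g \<in> Mor T\<rbrakk> \<Longrightarrow> SuspM T f = SuspM T g \<longleftrightarrow> f = g"
  using Susp_inj SuspM_inj by blast+

lemma susp_pow_add [simp]:
  assumes [simp]: "X \<in> Ob T" shows "susp_pow T m (susp_pow T n X) = susp_pow T (m + n) X"
proof (induction m rule: int_step_induct)
  case (step m)
  show ?case
    using susp_pow_Suc[of "susp_pow T n X" m] susp_pow_Suc[of X "m + n"]
    by (simp add: add.commute add.left_commute)
qed simp

lemma susp_powM_add [simp]:
  assumes [simp]: "f \<in> Mor T" shows "susp_powM T m (susp_powM T n f) = susp_powM T (m + n) f"
proof (induction m rule: int_step_induct)
  case (step m)
  show ?case
    using susp_powM_Suc[of "susp_powM T n f" m] susp_powM_Suc[of f "m + n"]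
    by (simp add: add.commute add.left_commute)
qed simp

lemma Dom_susp_powM [simp]:
  assumes [simp]: "f \<in> Mor T" shows "Dom T (susp_powM T n f) = susp_pow T n (Dom T f)"
  by (induction n rule: int_step_induct) (simp_all add: susp_powM_Suc susp_pow_Suc)

lemma Cod_susp_powM [simp]:
  assumes [simp]: "f \<in> Mor T" shows "Cod T (susp_powM T n f) = susp_pow T n (Cod T f)"
  by (induction n rule: int_step_induct) (simp_all add: susp_powM_Suc susp_pow_Suc)

lemma susp_powM_inj: "\<lbrakk>susp_powM T n f = susp_powM T n g; f \<in> Mor T; g \<in> Mor T\<rbrakk> \<Longrightarrow> f = g"
  by (metis add.left_inverse susp_powM_0 susp_powM_add)

lemma susp_powM_comp:
  assumes [simp]: "g \<in> Mor T" "f \<in> Mor T" "Dom T g = Cod T f"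
  shows "susp_powM T n (g \<bullet> f) = susp_powM T n g \<bullet> susp_powM T n f"
  by (induction n rule: int_step_induct) (simp_all add: susp_powM_Suc flip: SuspM_comp)

lemma susp_powM_Plus:
  assumes [simp]: "f \<in> Mor T" "g \<in> Mor T" "Dom T f = Dom T g" "Cod T f = Cod T g"
  shows "susp_powM T n (Plus T f g) = Plus T (susp_powM T n f) (susp_powM T n g)"
  by (induction n rule: int_step_induct) (simp_all add: susp_powM_Suc flip: SuspM_Plus)

lemma susp_powM_Zer [simp]: "\<lbrakk>X \<in> Ob T; Y \<in> Ob T\<rbrakk>
    \<Longrightarrow> susp_powM T n (Zer T X Y) = Zer T (susp_pow T n X) (susp_pow T n Y)"
  by (rule Plus_self_Zer) (auto simp: susp_powM_Plus[symmetric])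

lemma susp_powM_neg [simp]: "f \<in> Mor T \<Longrightarrow> susp_powM T n (neg_mor T f) = neg_mor T (susp_powM T n f)"
  by (rule neg_unique[of _ _ "susp_pow T n (Dom T f)" "susp_pow T n (Cod T f)"])
     (auto simp: susp_powM_Plus[symmetric])

lemma susp_powM_Ident [simp]:
  assumes [simp]: "X \<in> Ob T" shows "susp_powM T n (Ident T X) = Ident T (susp_pow T n X)"
  by (induction n rule: int_step_induct)
     (simp_all add: susp_powM_Suc susp_pow_Suc flip: susp_ident)

lemma susp_powM_eq_Zer_iff: "f \<in> Mor T \<Longrightarrow>
    susp_powM T n f = Zer T (susp_pow T n (Dom T f)) (susp_pow T n (Cod T f))
      \<longleftrightarrow> f = Zer T (Dom T f) (Cod T f)"
  by (metis susp_powM_Zer susp_powM_inj Zer_Mor Dom_Ob Cod_Ob)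

end

section \<open>Rotation of exact triangles and exactness of Hom\<close>

context triangulated_category begin

lemma tri_simps:
  assumes "(u, v, w) \<in> Tri T"
  shows "u \<in> Mor T" "v \<in> Mor T" "w \<in> Mor T" "Dom T v = Cod T u" "Dom T w = Cod T v"
    "Cod T w = Susp T (Dom T u)"
  using tri_wf[OF assms] by auto

lemma tri_rot:
  assumes "(u, v, w) \<in> Tri T" shows "(v, w, neg_mor T (SuspM T u)) \<in> Tri T"
  using TR2[of u "Dom T u" "Cod T u" v "Cod T v" w] assms tri_simps[OF assms] by auto

text \<open>The sign is forced by TR2: rotating forward produces minus the suspension of the first
  map, and this has to be \<open>w\<close>.\<close>

lemma tri_unrot:
  assumes t: "(u, v, w) \<in> Tri T" shows "(neg_mor T (susp_powM T (- 1) w), u, v) \<in> Tri T"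
proof -
  note [simp] = tri_simps[OF t]
  have w: "SuspM T (susp_powM T (- 1) w) = w"
    using susp_powM_add[of w 1 "-1"] by simp
  have s: "Susp T (susp_pow T (- 1) X) = X" "susp_pow T (-1) (Susp T X) = X" if "X \<in> Ob T" for X
    using susp_pow_add[of X 1 "-1"] susp_pow_add[of X "-1" 1] that by simp_all
  show ?thesis
    using TR2[of "neg_mor T (susp_powM T (- 1) w)" "susp_pow T (- 1) (Cod T v)" "Dom T u" u "Cod T u" v]
      t by (simp add: w s)
qed

lemma tri_comp_zero:
  assumes t: "(u, v, w) \<in> Tri T" shows "v \<bullet> u = Zer T (Dom T u) (Cod T v)"
proof -
  note [simp] = tri_simps[OF t]
  obtain N where z: "is_zero T N" using zero_object by blast
  note [simp] = is_zero_Ob[OF z]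
  have "(Ident T (Dom T u), Zer T (Dom T u) N, Zer T N (Susp T (Dom T u))) \<in> Tri T"
    using TR1_ident z by simp
  \<comment> \<open>Mapping the trivial triangle on \<open>Dom T u\<close> to the given one makes
    \<open>v \<bullet> u\<close> pass through the zero object.\<close>
  from TR3[OF this t, of "Ident T (Dom T u)" u]
  obtain c where "c \<in> Hom T N (Cod T v)" "v \<bullet> u = c \<bullet> Zer T (Dom T u) N" by auto
  then show ?thesis by simp
qed

lemma tri_comp_zero2: "(u, v, w) \<in> Tri T \<Longrightarrow> w \<bullet> v = Zer T (Cod T u) (Susp T (Dom T u))"
  using tri_comp_zero[OF tri_rot] by (simp add: tri_simps)

lemma tri_comp_zero3: "(u, v, w) \<in> Tri T \<Longrightarrow> SuspM T u \<bullet> w = Zer T (Cod T v) (Susp T (Cod T u))"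
  using tri_comp_zero[OF tri_rot[OF tri_rot]] by (simp add: tri_simps)

lemma is_zero_Susp: "is_zero T X \<Longrightarrow> is_zero T (Susp T X)"
  by (metis is_zero_Ob is_zero_iff Susp_Ob SuspM_Zer susp_ident)

text \<open>TR3 only completes the third map of a morphism of triangles. So
  \<open>Q -> 0 -> \<Sigma>Q\<close> is mapped to the rotated triangle; the completion is
  \<open>\<Sigma>b\<close>, whence the desuspension.\<close>

lemma tri_lift:
  assumes t: "(u, v, w) \<in> Tri T" and a: "a \<in> Hom T Q (Cod T u)"
    and z: "v \<bullet> a = Zer T Q (Cod T v)"
  shows "\<exists>b\<in>Hom T Q (Dom T u). a = u \<bullet> b"
proof -
  note [simp] = HomD[OF a]
  have [simp]: "Q \<in> Ob T" using Hom_Ob[OF a] by blast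
  note [simp] = tri_simps[OF t]
  obtain N where N: "is_zero T N" using zero_object by blast
  note [simp] = is_zero_Ob[OF N]
  have "(Ident T Q, Zer T Q N, Zer T N (Susp T Q)) \<in> Tri T"
    using TR1_ident N by simp
  from TR3[OF tri_rot[OF this] tri_rot[OF t], of a "Zer T N (Cod T v)"]
  obtain c where c: "c \<in> Hom T (Susp T Q) (Susp T (Dom T u))"
      "neg_mor T (SuspM T u) \<bullet> c = SuspM T a \<bullet> neg_mor T (SuspM T (Ident T Q))"
    using z by auto
  from c have e: "SuspM T u \<bullet> c = SuspM T a"
    using neg_neg[of "SuspM T u \<bullet> c"] by (simp add: susp_ident)
  define b where "b = susp_powM T (-1) c"
  have "SuspM T b = c" using c susp_powM_add[of c 1 "-1"] by (simp add: b_def)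
  moreover have "susp_pow T (-1) (Susp T X) = X" if "X \<in> Ob T" for X
    using that susp_pow_add[of X "-1" 1] by simp
  then have b: "b \<in> Hom T Q (Dom T u)" using c by (simp add: b_def)
  ultimately have "SuspM T (u \<bullet> b) = SuspM T a" using e by (simp add: SuspM_comp)
  then have "a = u \<bullet> b" using b by simp
  with b show ?thesis by blast
qed

lemma tri_zero_left:
  assumes N: "is_zero T N" and Q: "Q \<in> Ob T"
  shows "(Zer T N Q, Ident T Q, Zer T Q (Susp T N)) \<in> Tri T"
proof -
  note [simp] = is_zero_Ob[OF N] Q
  have "(Ident T Q, Zer T Q (Susp T N), Zer T (Susp T N) (Susp T Q)) \<in> Tri T"
    using TR1_ident is_zero_Susp N by simp
  then show ?thesis
    using TR2[of "Zer T N Q" N Q "Ident T Q" Q "Zer T Q (Susp T N)"] by simp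
qed

lemma tri_ext:
  assumes t: "(u, v, w) \<in> Tri T" and a: "a \<in> Hom T (Cod T u) Q"
    and z: "a \<bullet> u = Zer T (Dom T u) Q"
  shows "\<exists>b\<in>Hom T (Cod T v) Q. a = b \<bullet> v"
proof -
  note [simp] = HomD[OF a]
  have Q [simp]: "Q \<in> Ob T" using Hom_Ob[OF a] by blast
  note [simp] = tri_simps[OF t]
  obtain N where N: "is_zero T N" using zero_object by blast
  note [simp] = is_zero_Ob[OF N]
  from TR3[OF t tri_zero_left[OF N Q], of "Zer T (Dom T u) N" a] z
  have "\<exists>c\<in>Hom T (Cod T v) Q. Ident T Q \<bullet> a = c \<bullet> v" by auto
  then show ?thesis by simp
qed

lemma tri_lift2:
  assumes t: "(u, v, w) \<in> Tri T" and a: "a \<in> Hom T Q (Cod T v)"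
    and z: "w \<bullet> a = Zer T Q (Susp T (Dom T u))"
  shows "\<exists>b\<in>Hom T Q (Cod T u). a = v \<bullet> b"
  using tri_lift[OF tri_rot[OF t] a] z tri_simps[OF t] by metis

lemma tri_ext2:
  assumes t: "(u, v, w) \<in> Tri T" and a: "a \<in> Hom T (Cod T v) Q"
    and z: "a \<bullet> v = Zer T (Cod T u) Q"
  shows "\<exists>b\<in>Hom T (Susp T (Dom T u)) Q. a = b \<bullet> w"
  using tri_ext[OF tri_rot[OF t] a] z tri_simps[OF t] by metis

lemma tri_lift3:
  assumes t: "(u, v, w) \<in> Tri T" and a: "a \<in> Hom T Q (Susp T (Dom T u))"
    and z: "SuspM T u \<bullet> a = Zer T Q (Susp T (Cod T u))"
  shows "\<exists>b\<in>Hom T Q (Cod T v). a = w \<bullet> b"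
proof -
  have "neg_mor T (SuspM T u) \<bullet> a = Zer T Q (Susp T (Dom T v))"
    using a z tri_simps[OF t] Dom_Ob[of a] by simp
  moreover have "a \<in> Hom T Q (Cod T w)" using a tri_simps[OF t] by simp
  ultimately show ?thesis
    using tri_lift2[OF tri_rot[OF t]] tri_simps(5)[OF t] by metis
qed

text \<open>A suspension of an exact triangle is exact only up to sign; desuspending the test
  morphism \<open>a\<close> leaves the triangle alone.\<close>

lemma tri_lift_pow:
  assumes t: "(u, v, w) \<in> Tri T" and a: "a \<in> Hom T Q (susp_pow T n (Cod T u))"
    and z: "susp_powM T n v \<bullet> a = Zer T Q (susp_pow T n (Cod T v))"
  shows "\<exists>b\<in>Hom T Q (susp_pow T n (Dom T u)). a = susp_powM T n u \<bullet> b"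
proof -
  note [simp] = HomD[OF a]
  have [simp]: "Q \<in> Ob T" using Hom_Ob[OF a] by blast
  note [simp] = tri_simps[OF t]
  have "susp_powM T (-n) (susp_powM T n v \<bullet> a) = v \<bullet> susp_powM T (-n) a"
    by (subst susp_powM_comp) simp_all
  then have "v \<bullet> susp_powM T (-n) a = Zer T (susp_pow T (-n) Q) (Cod T v)"
    by (simp add: z)
  moreover have "susp_powM T (-n) a \<in> Hom T (susp_pow T (-n) Q) (Cod T u)" by simp
  ultimately obtain b where
    b: "b \<in> Hom T (susp_pow T (-n) Q) (Dom T u)" "susp_powM T (-n) a = u \<bullet> b"
    using tri_lift[OF t] by blast
  from b(1) have [simp]: "b \<in> Mor T" "Dom T b = susp_pow T (-n) Q" "Cod T b = Dom T u" by auto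
  have "susp_powM T n (susp_powM T (-n) a) = susp_powM T n u \<bullet> susp_powM T n b"
    unfolding b(2) by (rule susp_powM_comp) auto
  then show ?thesis by (intro bexI[of _ "susp_powM T n b"]) simp_all
qed

lemma tri_complete:
  assumes "u \<in> Mor T" obtains v w where "(u, v, w) \<in> Tri T"
  using TR1_complete[OF assms] by blast

lemma tri_complete_right:
  assumes v: "v \<in> Mor T"
  obtains u w where "(u, v, w) \<in> Tri T" "Cod T u = Dom T v"
  using tri_complete[OF v] tri_unrot tri_simps(4) by metis

lemma is_iso_Ident: "X \<in> Ob T \<Longrightarrow> is_iso T (Ident T X)"
  unfolding is_iso_def by (auto intro!: exI[of _ "Ident T X"])

end

section \<open>Triangulated subcategories\<close>

locale triangulated_sub = triangulated_category +
  fixes S assumes tsub: "triangulated_subcategory T S"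
begin

lemma sub_Ob: "X \<in> S \<Longrightarrow> X \<in> Ob T"
  using tsub unfolding triangulated_subcategory_def by blast

lemma sub_Susp: "X \<in> Ob T \<Longrightarrow> Susp T X \<in> S \<longleftrightarrow> X \<in> S"
  using tsub unfolding triangulated_subcategory_def by blast

lemma sub_susp_pow: assumes [simp]: "X \<in> Ob T" shows "susp_pow T n X \<in> S \<longleftrightarrow> X \<in> S"
  by (induction n rule: int_step_induct) (simp_all add: susp_pow_Suc sub_Susp)

lemma sub_cone: "\<lbrakk>(u, v, w) \<in> Tri T; Dom T u \<in> S; Cod T u \<in> S\<rbrakk> \<Longrightarrow> Cod T v \<in> S"
  using tsub unfolding triangulated_subcategory_def by blast

lemma sub_fibre: "\<lbrakk>(u, v, w) \<in> Tri T; Cod T u \<in> S; Cod T v \<in> S\<rbrakk> \<Longrightarrow> Dom T u \<in> S"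
  using sub_cone[OF tri_rot] by (simp add: tri_simps sub_Susp)

lemma sub_mid: "\<lbrakk>(u, v, w) \<in> Tri T; Dom T u \<in> S; Cod T v \<in> S\<rbrakk> \<Longrightarrow> Cod T u \<in> S"
  using sub_cone[OF tri_rot[OF tri_rot]] by (simp add: tri_simps sub_Susp)

lemma sub_zero: assumes "is_zero T Z" shows "Z \<in> S"
proof -
  obtain X where X: "X \<in> S" using tsub unfolding triangulated_subcategory_def by blast
  show ?thesis
    using sub_cone[OF TR1_ident[OF sub_Ob[OF X] assms]] X sub_Ob[OF X] is_zero_Ob[OF assms] by simp
qed

text \<open>The sum is built as the cone of the zero map from the desuspension of \<open>Y\<close>
  to \<open>X\<close>, so closure under cones keeps it in \<open>S\<close>.\<close>

lemma sub_split_sum: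
  assumes "X \<in> S" "Y \<in> S"
  obtains Z i j p q where "Z \<in> S" "i \<in> Hom T X Z" "j \<in> Hom T Y Z" "p \<in> Hom T Z X" "q \<in> Hom T Z Y"
    "p \<bullet> i = Ident T X" "q \<bullet> j = Ident T Y" "q \<bullet> i = Zer T X Y" "p \<bullet> j = Zer T Y X"
proof -
  note [simp] = sub_Ob[OF assms(1)] sub_Ob[OF assms(2)]
  let ?Y = "susp_pow T (-1) Y"
  have sY: "Susp T ?Y = Y" using susp_pow_add[of Y 1 "-1"] by simp
  obtain i q where t: "(Zer T ?Y X, i, q) \<in> Tri T" using tri_complete[of "Zer T ?Y X"] by auto
  note [simp] = tri_simps[OF t]
  have Z: "Cod T i \<in> S" using sub_cone[OF t] assms sub_susp_pow by simp
  obtain p where p: "p \<in> Hom T (Cod T i) X" "Ident T X = p \<bullet> i"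
    using tri_ext[OF t, of "Ident T X" X] by auto
  obtain j where j: "j \<in> Hom T Y (Cod T i)" "Ident T Y = q \<bullet> j"
    using tri_lift3[OF t, of "Ident T Y" Y] by (auto simp: sY)
  have qi: "q \<bullet> i = Zer T X Y" using tri_comp_zero2[OF t] by (simp add: sY)
  \<comment> \<open>\<open>p\<close> retracts \<open>i\<close> but need not vanish on
    \<open>j\<close>; subtracting \<open>p j q\<close> corrects this and keeps
    \<open>p' i = 1\<close> because \<open>q i = 0\<close>.\<close>
  define p' where "p' = Minus p (p \<bullet> (j \<bullet> q))"
  have p': "p' \<in> Hom T (Cod T i) X" using p j by (simp add: p'_def sY)
  have "p' \<bullet> i = Ident T X" using p j qi by (simp add: p'_def sY Minus_comp)
  moreover have "p' \<bullet> j = Zer T Y X"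
    using p j by (simp add: p'_def sY Minus_comp flip: j(2))
  ultimately show ?thesis using that[of "Cod T i" i j p' q] Z j p' qi by (auto simp: sY)
qed

end

section \<open>Retracts and direct summands\<close>

context triangulated_category begin

text \<open>A split monomorphism has third map \<open>w = \<Sigma>p \<Sigma>i w = 0\<close>, so
  \<open>v\<close> is an epimorphism, and \<open>1 - i p\<close>, which vanishes on
  \<open>i\<close>, factors as \<open>j v\<close>. The identities for \<open>j\<close> are checked
  after composition with \<open>v\<close>. Thickness is defined by biproducts, whereas the arguments
  below produce retracts.\<close>

lemma retract_biproduct:
  assumes i: "i \<in> Hom T X Z" and p: "p \<in> Hom T Z X" and pi: "p \<bullet> i = Ident T X"
  obtains W where "is_biproduct T X W Z"
proof -
  note [simp] = i p
  have XZ [simp]: "X \<in> Ob T" "Z \<in> Ob T" using Hom_Ob[OF i] by auto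
  from i p have [simp]: "i \<in> Mor T" "Dom T i = X" "Cod T i = Z" "p \<in> Mor T" "Dom T p = Z" "Cod T p = X"
    by auto
  obtain v w where t: "(i, v, w) \<in> Tri T" using tri_complete[of i] by auto
  note [simp] = tri_simps[OF t]
  let ?W = "Cod T v"
  have "SuspM T (p \<bullet> i) \<bullet> w = SuspM T p \<bullet> (SuspM T i \<bullet> w)" by (simp add: SuspM_comp)
  then have w0: "w = Zer T ?W (Susp T X)"
    by (simp add: tri_comp_zero3[OF t] pi susp_ident)
  have epi: "a = Zer T ?W (Cod T a)"
    if a: "a \<in> Mor T" "Dom T a = ?W" "a \<bullet> v = Zer T Z (Cod T a)" for a
  proof -
    have "\<exists>b\<in>Hom T (Susp T X) (Cod T a). a = b \<bullet> w"
      using tri_ext2[OF t, of a "Cod T a"] a by simp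
    then obtain b where "b \<in> Hom T (Susp T X) (Cod T a)" "a = b \<bullet> w" by blast
    then show ?thesis by (metis Cod_Ob Hom_iff comp_Zer tri_simps(1)[OF t] XZ(1) w0 a(1,2) Dom_Ob)
  qed
  have vi: "v \<bullet> i = Zer T X ?W" using tri_comp_zero[OF t] by simp
  obtain j where j: "j \<in> Hom T ?W Z" "Minus (Ident T Z) (i \<bullet> p) = j \<bullet> v"
    using tri_ext[OF t, of "Minus (Ident T Z) (i \<bullet> p)" Z] by (auto simp: Minus_comp pi)
  from j(1) have [simp]: "j \<in> Mor T" "Dom T j = ?W" "Cod T j = Z" by auto
  have "v \<bullet> (j \<bullet> v) = v"
    unfolding j(2)[symmetric] by (simp add: comp_Minus comp_assoc'[symmetric] vi del: comp_assoc')
  then have "Minus (v \<bullet> j) (Ident T ?W) \<bullet> v = Zer T Z ?W" by (simp add: Minus_comp)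
  with epi[of "Minus (v \<bullet> j) (Ident T ?W)"] have vj: "v \<bullet> j = Ident T ?W"
    using Minus_eq_Zer_iff[of "v \<bullet> j" "Ident T ?W"] by simp
  have "p \<bullet> (j \<bullet> v) = Zer T Z X"
    unfolding j(2)[symmetric] by (simp add: comp_Minus comp_assoc'[symmetric] pi del: comp_assoc')
  with epi[of "p \<bullet> j"] have pj: "p \<bullet> j = Zer T ?W X" by simp
  have "Plus T (i \<bullet> p) (j \<bullet> v) = Ident T Z"
    unfolding j(2)[symmetric] by (subst Plus_commute) simp_all
  with pi vj vi pj have "is_biproduct T X ?W Z"
    unfolding is_biproduct_def using i p j(1)
    by (intro conjI bexI[of _ i] bexI[of _ j] bexI[of _ p] bexI[of _ v]) auto
  then show ?thesis using that by blast
qed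

lemma thick_retract:
  assumes "thick_subcategory T S" "i \<in> Hom T X Z" "p \<in> Hom T Z X" "p \<bullet> i = Ident T X" "Z \<in> S"
  shows "X \<in> S"
  using retract_biproduct[OF assms(2-4)] assms(1,5) unfolding thick_subcategory_def by metis

end

section \<open>Small sets\<close>

lemma small_subset: "\<lbrakk>small U B; A \<subseteq> B\<rbrakk> \<Longrightarrow> small U A"
  unfolding small_def using card_of_mono1 ordLeq_ordLess_trans by blast

lemma small_image: "small U A \<Longrightarrow> small U (f ` A)"
  unfolding small_def using card_of_image ordLeq_ordLess_trans by blast

lemma universe_infinite:
  assumes "universe (U :: 'u itself)" shows "infinite (UNIV :: 'u set)"
proof -
  have "natLeq \<le>o |UNIV :: 'u set|" using assms unfolding universe_def by (simp add: ordLess_imp_ordLeq)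
  then have "|UNIV :: nat set| \<le>o |UNIV :: 'u set|"
    using card_of_nat ordIso_ordLeq_trans by blast
  then show ?thesis by (simp add: infinite_iff_card_of_nat)
qed

lemma small_countable:
  assumes "universe (U :: 'u itself)" "countable A" shows "small U A"
proof -
  obtain f :: "'a \<Rightarrow> nat" where "inj_on f A" using assms(2) by (auto simp: countable_def)
  then have "|A| \<le>o |UNIV :: nat set|" using card_of_ordLeq[of A UNIV] by blast
  then show ?thesis
    using assms(1) card_of_nat ordLeq_ordIso_trans ordLeq_ordLess_trans
    unfolding small_def universe_def by blast
qed

text \<open>Regularity of the cardinal enters here: infinite regular cardinals are stable under
  unions.\<close>

lemma small_UN:
  assumes "universe (U :: 'u itself)" "small U A" "\<And>a. a \<in> A \<Longrightarrow> small U (F a)"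
  shows "small U (\<Union>a\<in>A. F a)"
proof -
  have "stable |UNIV :: 'u set|"
    using regularCard_stable[of "|UNIV :: 'u set|"] assms(1) universe_infinite[OF assms(1)]
    by (simp add: universe_def card_of_card_order_on Field_card_of)
  then show ?thesis
    using stable_UNION[of "|UNIV :: 'u set|" A F] assms(2,3) by (simp add: small_def)
qed

lemma small_Un:
  assumes "universe (U :: 'u itself)" "small U A" "small U B" shows "small U (A \<union> B)"
  using card_of_Un_ordLess_infinite[OF universe_infinite[OF assms(1)]] assms(2,3)
  by (simp add: small_def)

lemma small_bij:
  fixes U :: "'u itself"
  assumes "small U A"
  obtains e :: "'a \<Rightarrow> 'u" where "inj_on e A"
  using assms ordLess_imp_ordLeq card_of_ordLeq[of A "UNIV :: 'u set"] unfolding small_def by blast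

section \<open>Coproducts\<close>

context additive_category begin

text \<open>For \<open>F \<subseteq> I\<close> the idempotent of the coproduct \<open>P\<close> that cuts off the components outside \<open>F\<close>;
  for finite \<open>F\<close> it is the sum of the \<open>\<iota> i \<bullet> pr i\<close>.\<close>

definition cut :: "'i set \<Rightarrow> 'a \<Rightarrow> ('i \<Rightarrow> 'b) \<Rightarrow> 'i set \<Rightarrow> 'b" where
  "cut I P \<iota> F = (THE h. h \<in> Hom T P P \<and>
     (\<forall>i\<in>I. h \<bullet> \<iota> i = (if i \<in> F then \<iota> i else Zer T (Dom T (\<iota> i)) P)))"

end

locale coproduct = additive_category +
  fixes I :: "'i set" and X P \<iota>
  assumes cop: "is_coproduct T I X P \<iota>"
begin

lemma cop_Ob [simp]: "P \<in> Ob T" "i \<in> I \<Longrightarrow> X i \<in> Ob T"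
  and inj_hom [simp]: "i \<in> I \<Longrightarrow> \<iota> i \<in> Mor T" "i \<in> I \<Longrightarrow> Dom T (\<iota> i) = X i" "i \<in> I \<Longrightarrow> Cod T (\<iota> i) = P"
  using cop unfolding is_coproduct_def by auto

lemma cop_unique:
  "\<lbrakk>Y \<in> Ob T; \<And>i. i \<in> I \<Longrightarrow> g i \<in> Hom T (X i) Y\<rbrakk> \<Longrightarrow> \<exists>!h. h \<in> Hom T P Y \<and> (\<forall>i\<in>I. h \<bullet> \<iota> i = g i)"
  using cop unfolding is_coproduct_def by blast

lemma cop_ind:
  "\<lbrakk>Y \<in> Ob T; \<And>i. i \<in> I \<Longrightarrow> g i \<in> Hom T (X i) Y\<rbrakk> \<Longrightarrow> \<exists>h\<in>Hom T P Y. \<forall>i\<in>I. h \<bullet> \<iota> i = g i"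
  using cop_unique by (metis (no_types, lifting))

lemma cop_eqI:
  assumes "f \<in> Hom T P Y" "g \<in> Hom T P Y" "\<And>i. i \<in> I \<Longrightarrow> f \<bullet> \<iota> i = g \<bullet> \<iota> i"
  shows "f = g"
proof -
  have "\<exists>!h. h \<in> Hom T P Y \<and> (\<forall>i\<in>I. h \<bullet> \<iota> i = g \<bullet> \<iota> i)"
    by (rule cop_unique) (use assms(2) Hom_Ob[OF assms(1)] in auto)
  then show ?thesis using assms by blast
qed

lemma cut_def': "cut I P \<iota> F \<in> Hom T P P \<and> (\<forall>i\<in>I. cut I P \<iota> F \<bullet> \<iota> i = (if i \<in> F then \<iota> i else Zer T (X i) P))"
proof -
  have "\<exists>!h. h \<in> Hom T P P \<and> (\<forall>i\<in>I. h \<bullet> \<iota> i = (if i \<in> F then \<iota> i else Zer T (Dom T (\<iota> i)) P))"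
    by (rule cop_unique) auto
  from theI'[OF this] show ?thesis unfolding cut_def by simp
qed

lemma cut_hom [simp]: "cut I P \<iota> F \<in> Mor T" "Dom T (cut I P \<iota> F) = P" "Cod T (cut I P \<iota> F) = P"
  and cut_inj: "i \<in> I \<Longrightarrow> cut I P \<iota> F \<bullet> \<iota> i = (if i \<in> F then \<iota> i else Zer T (X i) P)"
  using cut_def'[of F] by auto

lemma cut_eqI:
  "\<lbrakk>h \<in> Hom T P P; \<And>i. i \<in> I \<Longrightarrow> i \<in> F \<Longrightarrow> h \<bullet> \<iota> i = \<iota> i;
    \<And>i. i \<in> I \<Longrightarrow> i \<notin> F \<Longrightarrow> h \<bullet> \<iota> i = Zer T (X i) P\<rbrakk> \<Longrightarrow> cut I P \<iota> F = h"
  by (rule cop_eqI[of _ P]) (auto simp: cut_inj)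

definition pr :: "'i \<Rightarrow> 'b" where
  "pr i = (THE h. h \<in> Hom T P (X i) \<and>
    (\<forall>j\<in>I. h \<bullet> \<iota> j = (if j = i then Ident T (X i) else Zer T (X j) (X i))))"

lemma pr_def':
  assumes "i \<in> I"
  shows "pr i \<in> Hom T P (X i) \<and> (\<forall>j\<in>I. pr i \<bullet> \<iota> j = (if j = i then Ident T (X i) else Zer T (X j) (X i)))"
proof -
  have "\<exists>!h. h \<in> Hom T P (X i) \<and>
      (\<forall>j\<in>I. h \<bullet> \<iota> j = (if j = i then Ident T (X i) else Zer T (X j) (X i)))"
    by (rule cop_unique) (use assms in auto)
  from theI'[OF this] show ?thesis unfolding pr_def by simp
qed

lemma pr_hom [simp]: "i \<in> I \<Longrightarrow> pr i \<in> Mor T" "i \<in> I \<Longrightarrow> Dom T (pr i) = P" "i \<in> I \<Longrightarrow> Cod T (pr i) = X i"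
  and pr_inj: "\<lbrakk>i \<in> I; j \<in> I\<rbrakk> \<Longrightarrow> pr i \<bullet> \<iota> j = (if j = i then Ident T (X i) else Zer T (X j) (X i))"
  using pr_def'[of i] by auto

lemma cut_empty: "cut I P \<iota> {} = Zer T P P"
  by (rule cut_eqI) auto

lemma cut_insert:
  "\<lbrakk>i \<in> I; i \<notin> F\<rbrakk> \<Longrightarrow> cut I P \<iota> (insert i F) = Plus T (\<iota> i \<bullet> pr i) (cut I P \<iota> F)"
  by (rule cut_eqI) (auto simp: Plus_comp cut_inj pr_inj)

lemma cut_cut: "F \<subseteq> G \<Longrightarrow> cut I P \<iota> G \<bullet> cut I P \<iota> F = cut I P \<iota> F"
  by (rule cut_eqI[symmetric]) (auto simp: cut_inj)

lemma cut_absorb: "\<lbrakk>cut I P \<iota> F \<bullet> y = y; F \<subseteq> G; y \<in> Hom T C P\<rbrakk> \<Longrightarrow> cut I P \<iota> G \<bullet> y = y"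
  using cut_cut[of F G] comp_assoc'[of "cut I P \<iota> G" "cut I P \<iota> F" y] by auto

lemma pr_cut: "\<lbrakk>i \<in> I; i \<notin> F\<rbrakk> \<Longrightarrow> pr i \<bullet> cut I P \<iota> F = Zer T P (X i)"
  by (rule cop_eqI[of _ "X i"]) (auto simp: cut_inj pr_inj)

text \<open>A finite cut is a sum of the \<open>\<iota> i \<bullet> pr i\<close>, so membership in
  an additively closed \<open>K\<close> is inherited from the components. With \<open>K\<close> the
  zero map, the killed morphisms, or those factoring through \<open>S\<close>, this replaces
  computations with finite sums.\<close>

lemma cut_induct:
  assumes "finite F" "F \<subseteq> I" and y: "y \<in> Hom T C P" and h: "h \<in> Hom T P Y"
    and zero: "Zer T C Y \<in> K" and plus: "\<And>a b. \<lbrakk>a \<in> K; b \<in> K\<rbrakk> \<Longrightarrow> Plus T a b \<in> K"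
    and K: "\<And>i. i \<in> F \<Longrightarrow> h \<bullet> (\<iota> i \<bullet> (pr i \<bullet> y)) \<in> K"
  shows "h \<bullet> (cut I P \<iota> F \<bullet> y) \<in> K"
proof -
  have Ob [simp]: "C \<in> Ob T" "Y \<in> Ob T" using Hom_Ob[OF y] Hom_Ob[OF h] by auto
  show ?thesis using assms(1,2) K
  proof (induction F rule: finite_induct)
    case empty then show ?case using y h zero by (simp add: cut_empty)
  next
    case (insert i F)
    have "h \<bullet> (cut I P \<iota> (insert i F) \<bullet> y) = Plus T (h \<bullet> (\<iota> i \<bullet> (pr i \<bullet> y))) (h \<bullet> (cut I P \<iota> F \<bullet> y))"
      using insert.hyps insert.prems y h by (simp add: cut_insert Plus_comp comp_Plus)
    then show ?case using insert by (auto intro: plus)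
  qed
qed

lemma cut_pr_zero:
  assumes "finite F" "F \<subseteq> I" "y \<in> Hom T C P" "\<And>i. i \<in> F \<Longrightarrow> pr i \<bullet> y = Zer T C (X i)"
  shows "cut I P \<iota> F \<bullet> y = Zer T C P"
proof -
  have [simp]: "C \<in> Ob T" using Hom_Ob[OF assms(3)] by auto
  have "Ident T P \<bullet> (cut I P \<iota> F \<bullet> y) \<in> {Zer T C P}"
    by (rule cut_induct[OF assms(1-3)]) (use assms in \<open>auto simp: subset_iff\<close>)
  then show ?thesis using assms(3) by simp
qed

end

context additive_category begin

lemma coproduct_reindex:
  assumes J: "is_coproduct T J Y P \<kappa>" and e: "bij_betw e I J"
    and X: "\<And>i. i \<in> I \<Longrightarrow> X i = Y (e i)" and \<iota>: "\<And>i. i \<in> I \<Longrightarrow> \<iota> i = \<kappa> (e i)"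
  shows "is_coproduct T I X P \<iota>"
proof -
  interpret coproduct T J Y P \<kappa> using J by unfold_locales
  have eJ: "e i \<in> J" if "i \<in> I" for i using e that bij_betwE by blast
  let ?d = "inv_into I e"
  have d: "?d j \<in> I" "e (?d j) = j" if "j \<in> J" for j
    using that e by (auto simp: bij_betw_def f_inv_into_f inv_into_into)
  have de: "?d (e i) = i" if "i \<in> I" for i using that e by (auto simp: bij_betw_def)
  have "\<exists>!h. h \<in> Hom T P Z \<and> (\<forall>i\<in>I. h \<bullet> \<iota> i = g i)"
    if Z: "Z \<in> Ob T" and g: "\<forall>i\<in>I. g i \<in> Hom T (X i) Z" for Z g
  proof -
    have "\<exists>!h. h \<in> Hom T P Z \<and> (\<forall>j\<in>J. h \<bullet> \<kappa> j = g (?d j))"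
      by (rule cop_unique[OF Z]) (use g d X in auto)
    moreover have "(\<forall>j\<in>J. h \<bullet> \<kappa> j = g (?d j)) \<longleftrightarrow> (\<forall>i\<in>I. h \<bullet> \<iota> i = g i)" for h
      using d \<iota> eJ de by metis
    ultimately show ?thesis by simp
  qed
  then show ?thesis unfolding is_coproduct_def using eJ X \<iota> by auto
qed

text \<open>\<open>has_coproducts\<close> concerns index sets inside \<open>'u\<close>; families
  indexed by natural numbers or by sets of morphisms are carried there by an injection.\<close>

lemma small_coproduct_exists:
  fixes U :: "'u itself" and I :: "'i set"
  assumes "has_coproducts U T" "small U I" "\<And>i. i \<in> I \<Longrightarrow> X i \<in> Ob T"
  obtains P \<iota> where "is_coproduct T I X P \<iota>"
proof -
  obtain e :: "'i \<Rightarrow> 'u" where e: "inj_on e I" using small_bij[OF assms(2)] .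
  let ?Y = "X \<circ> inv_into I e"
  have "?Y \<in> e ` I \<rightarrow> Ob T" using e assms(3) by auto
  moreover have "small U (e ` I)" using assms(2) by (rule small_image)
  ultimately obtain P \<kappa> where "is_coproduct T (e ` I) ?Y P \<kappa>"
    using assms(1) unfolding has_coproducts_def by blast
  then have "is_coproduct T I X P (\<kappa> \<circ> e)"
    by (rule coproduct_reindex[where e = e]) (use e in \<open>auto simp: bij_betw_def\<close>)
  then show ?thesis using that by blast
qed

lemma coproduct_small_index:
  fixes U :: "'u itself" and I :: "'i set"
  assumes "is_coproduct T I X P \<iota>" "small U I"
  obtains e :: "'i \<Rightarrow> 'u" where "inj_on e I" "small U (e ` I)"
    "is_coproduct T (e ` I) (X \<circ> inv_into I e) P (\<iota> \<circ> inv_into I e)"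
proof -
  obtain e :: "'i \<Rightarrow> 'u" where e: "inj_on e I" using small_bij[OF assms(2)] .
  then have "is_coproduct T (e ` I) (X \<circ> inv_into I e) P (\<iota> \<circ> inv_into I e)"
    by (intro coproduct_reindex[OF assms(1), where e = "inv_into I e"])
      (auto simp: bij_betw_inv_into inj_on_imp_bij_betw)
  with e that small_image[OF assms(2)] show ?thesis by blast
qed

section \<open>Compactness in terms of finite cuts\<close>

lemma finsum_comp:
  assumes "finite F" "h \<in> Hom T Y Z" "\<And>i. i \<in> F \<Longrightarrow> f i \<in> Hom T X Y" and X: "X \<in> Ob T"
  shows "h \<bullet> (\<Oplus>\<^bsub>hom_group T X Y\<^esub>i\<in>F. f i) = (\<Oplus>\<^bsub>hom_group T X Z\<^esub>i\<in>F. h \<bullet> f i)"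
proof -
  have Ob [simp]: "Y \<in> Ob T" "Z \<in> Ob T" "X \<in> Ob T" using Hom_Ob[OF assms(2)] X by auto
  interpret Y: abelian_group "hom_group T X Y" by (rule hom_abelian_group) auto
  interpret Z: abelian_group "hom_group T X Z" by (rule hom_abelian_group) auto
  show ?thesis using assms(1,3)
  proof (induction F rule: finite_induct)
    case empty then show ?case using assms(2) by simp
  next
    case (insert i F)
    have "finsum (hom_group T X Y) f F \<in> Hom T X Y"
      using insert.prems Y.finsum_closed[of f F] by (simp add: Pi_iff)
    then show ?case using insert assms(2)
      by (simp add: Y.finsum_insert Z.finsum_insert Pi_iff comp_Plus)
  qed
qed

lemma (in coproduct) cut_finsum:
  assumes "finite F" "F \<subseteq> I" and y: "y \<in> Hom T C P"
  shows "cut I P \<iota> F \<bullet> y = (\<Oplus>\<^bsub>hom_group T C P\<^esub>i\<in>F. \<iota> i \<bullet> (pr i \<bullet> y))"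
proof -
  have [simp]: "C \<in> Ob T" using Hom_Ob[OF y] by auto
  note [simp] = HomD[OF y]
  interpret Y: abelian_group "hom_group T C P" by (rule hom_abelian_group) auto
  show ?thesis using assms(1,2)
  proof (induction F rule: finite_induct)
    case empty then show ?case by (simp add: cut_empty)
  next
    case (insert i F)
    then have [simp]: "i \<in> I" and FI: "j \<in> F \<Longrightarrow> j \<in> I" for j by auto
    then show ?case using insert
      by (subst Y.finsum_insert) (simp_all add: cut_insert Plus_comp)
  qed
qed

text \<open>The projections recover the components of a sum, so the canonical map is always
  injective; surjectivity says that each \<open>y\<close> into a coproduct is fixed by a finite cut,
  that is, comes from finitely many summands.\<close>

lemma compact_iff:
  fixes U :: "'u itself"
  shows "C \<in> compact_objects U T \<longleftrightarrow> C \<in> Ob T \<and> (\<forall>(I :: 'u set) X P \<iota>.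
     small U I \<and> is_coproduct T I X P \<iota> \<longrightarrow>
     (\<forall>y\<in>Hom T C P. \<exists>F. finite F \<and> F \<subseteq> I \<and> cut I P \<iota> F \<bullet> y = y))"
proof -
  have "bij_betw (\<lambda>f. \<Oplus>\<^bsub>hom_group T C P\<^esub>i\<in>{i\<in>I. f i \<noteq> Zer T C (X i)}. \<iota> i \<bullet> f i)
       (carrier (sum_group I (\<lambda>i. add_monoid (hom_group T C (X i))))) (Hom T C P)
     \<longleftrightarrow> (\<forall>y\<in>Hom T C P. \<exists>F. finite F \<and> F \<subseteq> I \<and> cut I P \<iota> F \<bullet> y = y)" (is "bij_betw ?\<Phi> ?A _ \<longleftrightarrow> ?R")
    if C [simp]: "C \<in> Ob T" and cop: "is_coproduct T I X P \<iota>" for I :: "'u set" and X P \<iota>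
  proof -
    interpret coproduct T I X P \<iota> using cop by unfold_locales
    have gr: "abelian_group (hom_group T C (X i))" if "i \<in> I" for i
      using that by (intro hom_abelian_group) auto
    interpret Y: abelian_group "hom_group T C P" by (rule hom_abelian_group) auto
    have A: "?A = {f \<in> \<Pi>\<^sub>E i\<in>I. Hom T C (X i). finite {i \<in> I. f i \<noteq> Zer T C (X i)}}"
      using carrier_sum_group[of I "\<lambda>i. add_monoid (hom_group T C (X i))",
        OF abelian_group.a_group[OF gr]] by simp
    have mem: "?\<Phi> f \<in> Hom T C P" if "f \<in> ?A" for f
    proof -
      have [simp]: "f i \<in> Mor T" "Dom T (f i) = C" "Cod T (f i) = X i" if "i \<in> I" for i
        using \<open>f \<in> ?A\<close> that unfolding A by (simp_all add: PiE_iff)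
      have "(\<lambda>i. \<iota> i \<bullet> f i) \<in> {i\<in>I. f i \<noteq> Zer T C (X i)} \<rightarrow> carrier (hom_group T C P)" by simp
      from Y.finsum_closed[OF this] show ?thesis by simp
    qed
    have pr\<Phi>: "pr i \<bullet> ?\<Phi> f = f i" if f: "f \<in> ?A" and i: "i \<in> I" for f i
    proof -
      let ?S = "{i\<in>I. f i \<noteq> Zer T C (X i)}"
      interpret X: abelian_group "hom_group T C (X i)" by (rule gr[OF i])
      have fin: "finite ?S" using f unfolding A by simp
      have [simp]: "f j \<in> Mor T" "Dom T (f j) = C" "Cod T (f j) = X j" if "j \<in> I" for j
        using f that unfolding A by (simp_all add: PiE_iff)
      note [simp] = i
      have "pr i \<bullet> ?\<Phi> f = (\<Oplus>\<^bsub>hom_group T C (X i)\<^esub>j\<in>?S. pr i \<bullet> (\<iota> j \<bullet> f j))"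
        by (rule finsum_comp[OF fin]) simp_all
      also have "\<dots> = (\<Oplus>\<^bsub>hom_group T C (X i)\<^esub>j\<in>?S. if i = j then f i else Zer T C (X i))"
      proof (rule X.finsum_cong', simp)
        fix j assume "j \<in> ?S"
        then have "j \<in> I" by simp
        then show "pr i \<bullet> (\<iota> j \<bullet> f j) = (if i = j then f i else Zer T C (X i))"
          using pr_inj[of i j] comp_assoc'[of "pr i" "\<iota> j" "f j"] by (auto simp del: comp_assoc')
      qed simp
      also have "\<dots> = f i"
      proof (cases "i \<in> ?S")
        case True
        then show ?thesis using X.finsum_singleton[OF True fin, of "\<lambda>_. f i"]
          unfolding hom_group_simps by simp
      next
        case False
        then have "(\<Oplus>\<^bsub>hom_group T C (X i)\<^esub>j\<in>?S. if i = j then f i else Zer T C (X i))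
            = (\<Oplus>\<^bsub>hom_group T C (X i)\<^esub>j\<in>?S. Zer T C (X i))"
          by (intro X.finsum_cong') auto
        moreover have "(\<Oplus>\<^bsub>hom_group T C (X i)\<^esub>j\<in>?S. Zer T C (X i)) = Zer T C (X i)"
          using X.finsum_zero[of ?S] by simp
        ultimately show ?thesis using False by simp
      qed
      finally show ?thesis .
    qed
    show ?thesis
    proof
      assume bij: "bij_betw ?\<Phi> ?A (Hom T C P)"
      show ?R
      proof
        fix y assume y: "y \<in> Hom T C P"
        then obtain f where f: "f \<in> ?A" "y = ?\<Phi> f" using bij unfolding bij_betw_def by blast
        let ?S = "{i\<in>I. f i \<noteq> Zer T C (X i)}"
        have fin: "finite ?S" using f unfolding A by simp
        have [simp]: "f j \<in> Mor T" "Dom T (f j) = C" "Cod T (f j) = X j" if "j \<in> I" for j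
          using f that unfolding A by (simp_all add: PiE_iff)
        have "cut I P \<iota> ?S \<bullet> y = (\<Oplus>\<^bsub>hom_group T C P\<^esub>j\<in>?S. \<iota> j \<bullet> (pr j \<bullet> y))"
          by (rule cut_finsum[OF fin _ y]) auto
        also have "\<dots> = (\<Oplus>\<^bsub>hom_group T C P\<^esub>j\<in>?S. \<iota> j \<bullet> f j)"
          by (rule Y.finsum_cong') (simp_all add: f(2) pr\<Phi>[OF f(1)])
        also have "\<dots> = y" using f(2) by simp
        finally show "\<exists>F. finite F \<and> F \<subseteq> I \<and> cut I P \<iota> F \<bullet> y = y" using fin by blast
      qed
    next
      assume R: ?R
      show "bij_betw ?\<Phi> ?A (Hom T C P)" unfolding bij_betw_def
      proof (intro conjI inj_onI subset_antisym image_subsetI subsetI)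
        fix f g assume f: "f \<in> ?A" and g: "g \<in> ?A" and e: "?\<Phi> f = ?\<Phi> g"
        have "f i = g i" if "i \<in> I" for i using pr\<Phi>[OF f that] pr\<Phi>[OF g that] e by simp
        moreover have "f \<in> extensional I" "g \<in> extensional I" using f g unfolding A by (auto simp: PiE_def)
        ultimately show "f = g" using extensionalityI by blast
      next
        fix f assume "f \<in> ?A" then show "?\<Phi> f \<in> Hom T C P" by (rule mem)
      next
        fix y assume y: "y \<in> Hom T C P"
        with R obtain F where F: "finite F" "F \<subseteq> I" "cut I P \<iota> F \<bullet> y = y" by blast
        note [simp] = HomD[OF y]
        have FI [simp]: "i \<in> F \<Longrightarrow> i \<in> I" for i using F(2) by auto
        define f where "f = (\<lambda>i\<in>I. pr i \<bullet> y)"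
        \<comment> \<open>Outside \<open>F\<close> the morphism \<open>y\<close> has no component,
          because \<open>pr i\<close> annihilates the cut to \<open>F\<close>.\<close>
        have z: "f i = Zer T C (X i)" if "i \<in> I" "i \<notin> F" for i
        proof -
          have "pr i \<bullet> y = (pr i \<bullet> cut I P \<iota> F) \<bullet> y"
            using that F(3) by simp
          then show ?thesis using that by (simp add: pr_cut f_def del: comp_assoc')
        qed
        then have sub: "{i\<in>I. f i \<noteq> Zer T C (X i)} \<subseteq> F" by auto
        then have "finite {i\<in>I. f i \<noteq> Zer T C (X i)}" using F(1) finite_subset by blast
        moreover have "f \<in> (\<Pi>\<^sub>E i\<in>I. Hom T C (X i))" by (simp add: f_def PiE_iff)
        ultimately have fA: "f \<in> ?A" unfolding A by blast
        have "y = (\<Oplus>\<^bsub>hom_group T C P\<^esub>i\<in>F. \<iota> i \<bullet> (pr i \<bullet> y))"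
          using cut_finsum[OF F(1,2) y] F(3) by simp
        also have "\<dots> = ?\<Phi> f"
        proof (rule Y.add.finprod_mono_neutral_cong_right[OF F(1) sub])
          show "\<iota> i \<bullet> (pr i \<bullet> y) = zero (hom_group T C P)" if "i \<in> F - {i\<in>I. f i \<noteq> Zer T C (X i)}" for i
            using that by (simp add: f_def)
        qed (simp_all add: f_def)
        finally show "y \<in> ?\<Phi> ` ?A" using fA by blast
      qed
    qed
  qed
  then show ?thesis unfolding compact_objects_def by (cases "C \<in> Ob T") (simp_all del: Hom_iff)
qed

lemma compact_Ob: "C \<in> compact_objects U T \<Longrightarrow> C \<in> Ob T"
  by (simp add: compact_iff)

lemma compact_cut:
  fixes U :: "'u itself" and I :: "'i set"
  assumes C: "C \<in> compact_objects U T" and cop: "is_coproduct T I X P \<iota>" and small: "small U I"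
    and y: "y \<in> Hom T C P"
  shows "\<exists>F. finite F \<and> F \<subseteq> I \<and> cut I P \<iota> F \<bullet> y = y"
proof -
  obtain e :: "'i \<Rightarrow> 'u" where e: "inj_on e I" and s: "small U (e ` I)" and
    c: "is_coproduct T (e ` I) (X \<circ> inv_into I e) P (\<iota> \<circ> inv_into I e)"
    using coproduct_small_index[OF cop small] .
  from C s c y obtain F where F: "finite F" "F \<subseteq> e ` I" "cut (e ` I) P (\<iota> \<circ> inv_into I e) F \<bullet> y = y"
    unfolding compact_iff by blast
  interpret A: coproduct T I X P \<iota> using cop by unfold_locales
  interpret B: coproduct T "e ` I" "X \<circ> inv_into I e" P "\<iota> \<circ> inv_into I e" using c by unfold_locales
  have inv: "inv_into I e (e i) = i" if "i \<in> I" for i using e that by simp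
  let ?F = "inv_into I e ` F"
  have "cut I P \<iota> ?F = cut (e ` I) P (\<iota> \<circ> inv_into I e) F"
  proof (rule A.cut_eqI)
    fix i assume i: "i \<in> I" "i \<in> ?F"
    then have "e i \<in> F" using F(2) by (auto simp: f_inv_into_f subset_iff)
    with i B.cut_inj[of "e i" F] show "cut (e ` I) P (\<iota> \<circ> inv_into I e) F \<bullet> \<iota> i = \<iota> i"
      by (simp add: inv)
  next
    fix i assume i: "i \<in> I" "i \<notin> ?F"
    then have "e i \<notin> F" using inv by force
    with i B.cut_inj[of "e i" F] show "cut (e ` I) P (\<iota> \<circ> inv_into I e) F \<bullet> \<iota> i = Zer T (X i) P"
      by (simp add: inv)
  qed simp
  moreover have "?F \<subseteq> I" by (auto dest!: subsetD[OF F(2)] simp: inv)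
  ultimately show ?thesis using F by (intro exI[of _ ?F]) (simp del: Hom_iff)
qed

end

section \<open>Closure properties of the compact objects\<close>

context triangulated_category begin

lemma coproduct_susp:
  assumes "is_coproduct T I X P \<iota>"
  shows "is_coproduct T I (\<lambda>i. susp_pow T n (X i)) (susp_pow T n P) (\<lambda>i. susp_powM T n (\<iota> i))"
proof -
  interpret coproduct T I X P \<iota> using assms by unfold_locales
  have "\<exists>!h. h \<in> Hom T (susp_pow T n P) Y \<and> (\<forall>i\<in>I. h \<bullet> susp_powM T n (\<iota> i) = g i)"
    if Y [simp]: "Y \<in> Ob T" and g: "\<forall>i\<in>I. g i \<in> Hom T (susp_pow T n (X i)) Y" for Y g
  proof -
    have "\<exists>h\<in>Hom T P (susp_pow T (-n) Y). \<forall>i\<in>I. h \<bullet> \<iota> i = susp_powM T (-n) (g i)"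
      by (rule cop_ind) (use g in auto)
    then obtain h where h: "h \<in> Hom T P (susp_pow T (-n) Y)"
      "\<And>i. i \<in> I \<Longrightarrow> h \<bullet> \<iota> i = susp_powM T (-n) (g i)" by blast
    show ?thesis
    proof (rule ex1I[of _ "susp_powM T n h"])
      have "susp_powM T n h \<bullet> susp_powM T n (\<iota> i) = g i" if "i \<in> I" for i
      proof -
        have "susp_powM T n h \<bullet> susp_powM T n (\<iota> i) = susp_powM T n (h \<bullet> \<iota> i)"
          using that h(1) by (subst susp_powM_comp) auto
        then show ?thesis using that h g by simp
      qed
      then show "susp_powM T n h \<in> Hom T (susp_pow T n P) Y \<and>
          (\<forall>i\<in>I. susp_powM T n h \<bullet> susp_powM T n (\<iota> i) = g i)" using h by simp
    next
      fix k assume k: "k \<in> Hom T (susp_pow T n P) Y \<and> (\<forall>i\<in>I. k \<bullet> susp_powM T n (\<iota> i) = g i)"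
      have "susp_powM T (-n) k = h"
      proof (rule cop_eqI)
        fix i assume i: "i \<in> I"
        have "susp_powM T (-n) (k \<bullet> susp_powM T n (\<iota> i)) = susp_powM T (-n) k \<bullet> \<iota> i"
          using i k by (subst susp_powM_comp) auto
        then show "susp_powM T (-n) k \<bullet> \<iota> i = h \<bullet> \<iota> i" using k i h(2)[OF i] by simp
      qed (use k h in auto)
      then show "k = susp_powM T n h" using k by auto
    qed
  qed
  then show ?thesis unfolding is_coproduct_def by auto
qed

lemma cut_susp:
  assumes "is_coproduct T I X P \<iota>"
  shows "cut I (susp_pow T n P) (\<lambda>i. susp_powM T n (\<iota> i)) F = susp_powM T n (cut I P \<iota> F)"
proof -
  interpret coproduct T I X P \<iota> using assms by unfold_locales
  interpret S: coproduct T I "\<lambda>i. susp_pow T n (X i)" "susp_pow T n P" "\<lambda>i. susp_powM T n (\<iota> i)"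
    using coproduct_susp[OF assms] by unfold_locales
  show ?thesis
    by (rule S.cut_eqI) (auto simp: susp_powM_comp[symmetric] cut_inj)
qed

lemma compact_susp_pow:
  fixes U :: "'u itself"
  assumes C: "C \<in> compact_objects U T" shows "susp_pow T n C \<in> compact_objects U T"
  unfolding compact_iff
proof (intro conjI allI impI ballI)
  note [simp] = compact_Ob[OF C]
  show "susp_pow T n C \<in> Ob T" by simp
  fix I :: "'u set" and X P \<iota> y
  assume a: "small U I \<and> is_coproduct T I X P \<iota>" and y: "y \<in> Hom T (susp_pow T n C) P"
  then interpret coproduct T I X P \<iota> by unfold_locales simp
  have y': "susp_powM T (-n) y \<in> Hom T C (susp_pow T (-n) P)" using y by simp
  obtain F where F: "finite F" "F \<subseteq> I"
    "cut I (susp_pow T (-n) P) (\<lambda>i. susp_powM T (-n) (\<iota> i)) F \<bullet> susp_powM T (-n) y = susp_powM T (-n) y"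
    using compact_cut[OF C coproduct_susp[OF cop] _ y'] a by blast
  then have "susp_powM T (-n) (cut I P \<iota> F) \<bullet> susp_powM T (-n) y = susp_powM T (-n) y"
    using cop by (simp add: cut_susp)
  then have "susp_powM T (-n) (cut I P \<iota> F \<bullet> y) = susp_powM T (-n) y"
    using y by (subst susp_powM_comp) auto
  then have "cut I P \<iota> F \<bullet> y = y"
    by (rule susp_powM_inj) (use y in auto)
  then show "\<exists>F. finite F \<and> F \<subseteq> I \<and> cut I P \<iota> F \<bullet> y = y" using F by blast
qed

lemma compact_Susp: "C \<in> compact_objects U T \<Longrightarrow> Susp T C \<in> compact_objects U T"
  using compact_susp_pow[of C U 1] by simp

text \<open>A five lemma argument on cuts: some finite \<open>F\<close> suffices for
  \<open>y \<bullet> v\<close>, so \<open>y\<close> minus its cut to \<open>F\<close> factors as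
  \<open>z \<bullet> w\<close>; some finite \<open>G\<close> suffices for \<open>z\<close>, and then
  \<open>F \<union> G\<close> suffices for \<open>y\<close>.\<close>

lemma compact_cone:
  fixes U :: "'u itself"
  assumes t: "(u, v, w) \<in> Tri T" and u: "Dom T u \<in> compact_objects U T" "Cod T u \<in> compact_objects U T"
  shows "Cod T v \<in> compact_objects U T"
  unfolding compact_iff
proof (intro conjI allI impI ballI)
  note [simp] = tri_simps[OF t]
  show "Cod T v \<in> Ob T" by simp
  fix I :: "'u set" and X P \<iota> y
  assume a: "small U I \<and> is_coproduct T I X P \<iota>" and y: "y \<in> Hom T (Cod T v) P"
  then interpret coproduct T I X P \<iota> by unfold_locales simp
  note [simp] = HomD[OF y]
  let ?c = "cut I P \<iota>"
  have "y \<bullet> v \<in> Hom T (Cod T u) P" by simp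
  then obtain F where F: "finite F" "F \<subseteq> I" "?c F \<bullet> (y \<bullet> v) = y \<bullet> v"
    using compact_cut[OF u(2) cop] a by blast
  have "Minus y (?c F \<bullet> y) \<bullet> v = Zer T (Cod T u) P" by (simp add: Minus_comp F(3))
  with tri_ext2[OF t, of "Minus y (?c F \<bullet> y)" P] obtain z where
    z: "z \<in> Hom T (Susp T (Dom T u)) P" "Minus y (?c F \<bullet> y) = z \<bullet> w" by auto
  then have [simp]: "z \<in> Mor T" "Dom T z = Susp T (Dom T u)" "Cod T z = P" by auto
  obtain G where G: "finite G" "G \<subseteq> I" "?c G \<bullet> z = z"
    using compact_cut[OF compact_Susp[OF u(1)] cop _ z(1)] a by blast
  let ?H = "F \<union> G"
  have "?c ?H \<bullet> (z \<bullet> w) = z \<bullet> w"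
    using cut_absorb[OF G(3), of ?H] z(1) comp_assoc'[of "?c ?H" z w] by simp
  then have "?c ?H \<bullet> Minus y (?c F \<bullet> y) = Minus y (?c F \<bullet> y)" by (simp add: z(2))
  moreover have "?c ?H \<bullet> Minus y (?c F \<bullet> y) = Minus (?c ?H \<bullet> y) (?c F \<bullet> y)"
    using cut_cut[of F ?H] comp_assoc'[of "?c ?H" "?c F" y] by (simp add: comp_Minus)
  ultimately have "Minus (?c ?H \<bullet> y) (?c F \<bullet> y) = Minus y (?c F \<bullet> y)" by simp
  then have "?c ?H \<bullet> y = y"
    using Minus_Plus_cancel[of "?c ?H \<bullet> y" "?c F \<bullet> y"] by simp
  then show "\<exists>F. finite F \<and> F \<subseteq> I \<and> cut I P \<iota> F \<bullet> y = y" using F G by blast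
qed

lemma compact_retract:
  fixes U :: "'u itself"
  assumes Z: "Z \<in> compact_objects U T" and i: "i \<in> Hom T X Z" and p: "p \<in> Hom T Z X"
    and pi: "p \<bullet> i = Ident T X"
  shows "X \<in> compact_objects U T"
  unfolding compact_iff
proof (intro conjI allI impI ballI)
  show "X \<in> Ob T" using Hom_Ob[OF i] by simp
  fix I :: "'u set" and Y P \<iota> y
  assume a: "small U I \<and> is_coproduct T I Y P \<iota>" and y: "y \<in> Hom T X P"
  then interpret coproduct T I Y P \<iota> by unfold_locales simp
  have "y \<bullet> p \<in> Hom T Z P" using y p by simp
  then obtain F where F: "finite F" "F \<subseteq> I" "cut I P \<iota> F \<bullet> (y \<bullet> p) = y \<bullet> p"
    using compact_cut[OF Z cop] a by blast
  have "y = (y \<bullet> p) \<bullet> i" using y p i pi by simp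
  also have "\<dots> = (cut I P \<iota> F \<bullet> (y \<bullet> p)) \<bullet> i" by (simp add: F(3))
  also have "\<dots> = cut I P \<iota> F \<bullet> y" using y p i pi by simp
  finally show "\<exists>F. finite F \<and> F \<subseteq> I \<and> cut I P \<iota> F \<bullet> y = y" using F by metis
qed

lemma compact_zero:
  fixes U :: "'u itself"
  assumes "is_zero T X" shows "X \<in> compact_objects U T"
  unfolding compact_iff
proof (intro conjI allI impI ballI)
  show "X \<in> Ob T" using is_zero_Ob[OF assms] .
  fix I :: "'u set" and Y P \<iota> y
  assume a: "small U I \<and> is_coproduct T I Y P \<iota>" and y: "y \<in> Hom T X P"
  then interpret coproduct T I Y P \<iota> by unfold_locales simp
  have "cut I P \<iota> {} \<bullet> y = y"
    using is_zeroD'[OF assms y] is_zero_Ob[OF assms] by simp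
  then show "\<exists>F. finite F \<and> F \<subseteq> I \<and> cut I P \<iota> F \<bullet> y = y" by blast
qed

lemma compact_thick:
  fixes U :: "'u itself"
  shows "thick_subcategory T (compact_objects U T)"
  unfolding thick_subcategory_def triangulated_subcategory_def
proof (intro conjI allI impI ballI iffI)
  show "compact_objects U T \<subseteq> Ob T" using compact_Ob by blast
  show "compact_objects U T \<noteq> {}" using compact_zero zero_object by blast
  fix X assume "X \<in> Ob T" "Susp T X \<in> compact_objects U T"
  then show "X \<in> compact_objects U T"
    using compact_susp_pow[of "Susp T X" U "-1"] susp_pow_add[of X "-1" 1] by simp
next
  fix X Y Z assume a: "is_biproduct T X Y Z \<and> Z \<in> compact_objects U T"
  then show "X \<in> compact_objects U T" "Y \<in> compact_objects U T"
    unfolding is_biproduct_def using compact_retract by blast+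
qed (use compact_Susp compact_cone in auto)

end

section \<open>Localizing subcategories\<close>

context triangulated_category begin

lemma Susp_susp_pow [simp]:
  "X \<in> Ob T \<Longrightarrow> Susp T (susp_pow T n X) = susp_pow T (n + 1) X"
  "X \<in> Ob T \<Longrightarrow> susp_pow T n (Susp T X) = susp_pow T (n + 1) X"
  "f \<in> Mor T \<Longrightarrow> SuspM T (susp_powM T n f) = susp_powM T (n + 1) f"
  "f \<in> Mor T \<Longrightarrow> susp_powM T n (SuspM T f) = susp_powM T (n + 1) f"
  using susp_pow_add[of X n 1] susp_powM_add[of f n 1] by (simp_all add: susp_pow_Suc susp_powM_Suc)

lemma localizing_triangulated_sub:
  assumes "localizing_subcategory U T S" shows "triangulated_sub T S"
  using assms unfolding localizing_subcategory_def by unfold_locales simp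

lemma localizing_coproduct:
  fixes U :: "'u itself"
  assumes S: "localizing_subcategory U T S" and cop: "is_coproduct T I X P \<iota>" and I: "small U I"
    and X: "\<And>i. i \<in> I \<Longrightarrow> X i \<in> S"
  shows "P \<in> S"
proof -
  obtain e :: "'d \<Rightarrow> 'u" where e: "inj_on e I" "small U (e ` I)"
    "is_coproduct T (e ` I) (X \<circ> inv_into I e) P (\<iota> \<circ> inv_into I e)"
    using coproduct_small_index[OF cop I] .
  have "X \<circ> inv_into I e \<in> e ` I \<rightarrow> S" using X e(1) by auto
  with S e(2,3) show ?thesis unfolding localizing_subcategory_def by blast
qed

text \<open>Ensures that the intersection defining \<open>Loc\<close> does not run over the empty
  family.\<close>

lemma localizing_Ob: "localizing_subcategory U T (Ob T)"
proof -
  have "Ob T \<noteq> {}" using zero_object is_zero_Ob by blast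
  then have "triangulated_subcategory T (Ob T)"
    unfolding triangulated_subcategory_def
    using inv_Susp susp_inv_Ob tri_simps(2) by auto
  then show ?thesis
    unfolding localizing_subcategory_def is_coproduct_def by blast
qed

lemma localizing_Inter:
  assumes ne: "\<S> \<noteq> {}" and loc: "\<And>S. S \<in> \<S> \<Longrightarrow> localizing_subcategory U T S"
  shows "localizing_subcategory U T (\<Inter>\<S>)"
proof -
  have ts: "triangulated_sub T S" if "S \<in> \<S>" for S
    using that loc localizing_triangulated_sub by blast
  obtain N where N: "is_zero T N" using zero_object by blast
  have "N \<in> \<Inter>\<S>" using triangulated_sub.sub_zero[OF ts N] by blast
  then have "\<Inter>\<S> \<noteq> {}" by blast
  moreover have "\<Inter>\<S> \<subseteq> Ob T" using ne triangulated_sub.sub_Ob[OF ts] by blast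
  moreover have "\<forall>X\<in>Ob T. X \<in> \<Inter>\<S> \<longleftrightarrow> Susp T X \<in> \<Inter>\<S>"
    using triangulated_sub.sub_Susp[OF ts] by blast
  moreover have "\<forall>u v w. (u, v, w) \<in> Tri T \<and> Dom T u \<in> \<Inter>\<S> \<and> Cod T u \<in> \<Inter>\<S> \<longrightarrow> Cod T v \<in> \<Inter>\<S>"
    using triangulated_sub.sub_cone[OF ts] by blast
  ultimately have "triangulated_subcategory T (\<Inter>\<S>)"
    unfolding triangulated_subcategory_def by blast
  moreover have "P \<in> \<Inter>\<S>" if "small U I \<and> X \<in> I \<rightarrow> \<Inter>\<S> \<and> is_coproduct T I X P \<iota>"
    for I :: "'d set" and X P \<iota>
  proof
    fix S assume S: "S \<in> \<S>"
    show "P \<in> S"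
      by (rule localizing_coproduct[OF loc[OF S], of I X P \<iota>]) (use that S in \<open>auto simp: Pi_iff\<close>)
  qed
  ultimately show ?thesis unfolding localizing_subcategory_def by blast
qed

lemma Loc_localizing: "C \<subseteq> Ob T \<Longrightarrow> localizing_subcategory U T (Loc U T C)"
  unfolding Loc_def by (rule localizing_Inter) (use localizing_Ob in auto)

lemma Loc_superset: "C \<subseteq> Loc U T C"
  unfolding Loc_def by blast

lemma Loc_least: "\<lbrakk>localizing_subcategory U T S; C \<subseteq> S\<rbrakk> \<Longrightarrow> Loc U T C \<subseteq> S"
  unfolding Loc_def by blast

lemma Loc_mono: "A \<subseteq> B \<Longrightarrow> Loc U T A \<subseteq> Loc U T B"
  unfolding Loc_def by blast

text \<open>Orthogonality to all shifts of \<open>X\<close> at once is what makes the class closed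
  under suspension.\<close>

definition left_perp :: "'a \<Rightarrow> 'a set" where
  "left_perp X = {Y \<in> Ob T. \<forall>n. \<forall>f\<in>Hom T Y (susp_pow T n X). f = Zer T Y (susp_pow T n X)}"

lemma left_perp_Susp: "Y \<in> left_perp X \<longleftrightarrow> Susp T Y \<in> left_perp X"
  if X [simp]: "X \<in> Ob T" and Y [simp]: "Y \<in> Ob T"
proof -
  have "(\<forall>f\<in>Hom T Y (susp_pow T (n - 1) X). f = Zer T Y (susp_pow T (n - 1) X)) \<longleftrightarrow>
      (\<forall>f\<in>Hom T (Susp T Y) (susp_pow T n X). f = Zer T (Susp T Y) (susp_pow T n X))" for n
  proof (intro iffI ballI)
    fix f assume a: "\<forall>f\<in>Hom T Y (susp_pow T (n - 1) X). f = Zer T Y (susp_pow T (n - 1) X)"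
      and f: "f \<in> Hom T (Susp T Y) (susp_pow T n X)"
    have "susp_powM T (-1) f \<in> Hom T Y (susp_pow T (n - 1) X)" using f by simp
    with a have "susp_powM T (-1) f = Zer T Y (susp_pow T (n - 1) X)" by blast
    then have "SuspM T (susp_powM T (-1) f) = Zer T (Susp T Y) (Susp T (susp_pow T (n - 1) X))"
      by (simp del: Susp_susp_pow)
    then show "f = Zer T (Susp T Y) (susp_pow T n X)" using f by simp
  next
    fix f assume a: "\<forall>f\<in>Hom T (Susp T Y) (susp_pow T n X). f = Zer T (Susp T Y) (susp_pow T n X)"
      and f: "f \<in> Hom T Y (susp_pow T (n - 1) X)"
    have "SuspM T f \<in> Hom T (Susp T Y) (susp_pow T n X)" using f by simp
    with a have "SuspM T f = SuspM T (Zer T Y (susp_pow T (n - 1) X))" by simp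
    then show "f = Zer T Y (susp_pow T (n - 1) X)" by (rule SuspM_inj) (use f in simp_all)
  qed
  then show ?thesis unfolding left_perp_def by simp (metis add_diff_cancel_right')
qed

lemma left_perp_localizing:
  assumes X [simp]: "X \<in> Ob T" shows "localizing_subcategory U T (left_perp X)"
proof -
  obtain N where N: "is_zero T N" using zero_object by blast
  have "N \<in> left_perp X" unfolding left_perp_def using is_zeroD'[OF N] is_zero_Ob[OF N] by blast
  moreover have "Cod T v \<in> left_perp X"
    if t: "(u, v, w) \<in> Tri T" and uv: "Dom T u \<in> left_perp X" "Cod T u \<in> left_perp X" for u v w
  proof -
    note [simp] = tri_simps[OF t]
    have "f = Zer T (Cod T v) (susp_pow T n X)" if f: "f \<in> Hom T (Cod T v) (susp_pow T n X)" for n f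
    proof -
      have "f \<bullet> v \<in> Hom T (Cod T u) (susp_pow T n X)" using f by simp
      then have "f \<bullet> v = Zer T (Cod T u) (susp_pow T n X)" using uv(2) unfolding left_perp_def by blast
      from tri_ext2[OF t f this] obtain b where b: "b \<in> Hom T (Susp T (Dom T u)) (susp_pow T n X)"
        "f = b \<bullet> w" by blast
      have "Susp T (Dom T u) \<in> left_perp X" using left_perp_Susp[of X "Dom T u"] uv(1) by simp
      then have "b = Zer T (Susp T (Dom T u)) (susp_pow T n X)"
        using b(1) unfolding left_perp_def by blast
      then show ?thesis using b(2) by simp
    qed
    then show ?thesis unfolding left_perp_def by simp
  qed
  ultimately have ts: "triangulated_subcategory T (left_perp X)"
    unfolding triangulated_subcategory_def
    using left_perp_Susp[OF X] subsetI[of "left_perp X" "Ob T"] left_perp_def by blast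
  have "P \<in> left_perp X" if "Y \<in> I \<rightarrow> left_perp X" and cop: "is_coproduct T I Y P \<iota>" for I :: "'d set" and Y P \<iota>
  proof -
    interpret coproduct T I Y P \<iota> using cop by unfold_locales
    have "f = Zer T P (susp_pow T n X)" if f: "f \<in> Hom T P (susp_pow T n X)" for n f
    proof (rule cop_eqI[OF f])
      fix i assume i: "i \<in> I"
      then have "f \<bullet> \<iota> i \<in> Hom T (Y i) (susp_pow T n X)" using f by simp
      then have "f \<bullet> \<iota> i = Zer T (Y i) (susp_pow T n X)"
        using \<open>Y \<in> I \<rightarrow> _\<close> i unfolding left_perp_def by blast
      then show "f \<bullet> \<iota> i = Zer T P (susp_pow T n X) \<bullet> \<iota> i" using i by simp
    qed simp
    then show ?thesis unfolding left_perp_def by simp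
  qed
  with ts show ?thesis unfolding localizing_subcategory_def by blast
qed

text \<open>The left orthogonal of all shifts of \<open>X\<close> is localizing, so it absorbs
  \<open>Loc U T G\<close> once it contains \<open>G\<close>; as \<open>G\<close> is closed under
  shifts, testing against \<open>X\<close> itself is enough. Applied to an identity, it shows that
  an object is zero.\<close>

lemma Loc_perp:
  assumes X [simp]: "X \<in> Ob T" and G: "G \<subseteq> Ob T" "\<And>g n. g \<in> G \<Longrightarrow> susp_pow T n g \<in> G"
    and z: "\<And>g f. \<lbrakk>g \<in> G; f \<in> Hom T g X\<rbrakk> \<Longrightarrow> f = Zer T g X"
    and Y: "Y \<in> Loc U T G" and f: "f \<in> Hom T Y X"
  shows "f = Zer T Y X"
proof -
  have "G \<subseteq> left_perp X"
  proof
    fix g assume g: "g \<in> G"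
    then have [simp]: "g \<in> Ob T" using G by blast
    have "h = Zer T g (susp_pow T n X)" if h: "h \<in> Hom T g (susp_pow T n X)" for n h
    proof -
      have "susp_powM T (-n) h \<in> Hom T (susp_pow T (-n) g) X" using h by simp
      with z G(2)[OF g] have "susp_powM T (-n) h = Zer T (susp_pow T (-n) g) X" by blast
      then have "susp_powM T n (susp_powM T (-n) h) = Zer T g (susp_pow T n X)"
        by (simp del: susp_powM_add)
      then show ?thesis using h by simp
    qed
    then show "g \<in> left_perp X" unfolding left_perp_def by simp
  qed
  from Loc_least[OF left_perp_localizing[OF X] this, of U] Y have "Y \<in> left_perp X" by blast
  then have "\<forall>f\<in>Hom T Y (susp_pow T 0 X). f = Zer T Y (susp_pow T 0 X)" unfolding left_perp_def by blast
  then show ?thesis using f by simp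
qed

section \<open>Homotopy colimits of sequences\<close>

primrec tower_map :: "(nat \<Rightarrow> 'b) \<Rightarrow> 'a \<Rightarrow> nat \<Rightarrow> 'b" where
  "tower_map f X 0 = Ident T X"
| "tower_map f X (Suc k) = f k \<bullet> tower_map f X k"

end

locale coproduct_tricat = triangulated_category +
  fixes U :: "'u itself"
  assumes univ: "universe U" and cops: "has_coproducts U T" and loc_small: "locally_small U T"
begin

abbreviation "compacts \<equiv> compact_objects U T"
abbreviation "localizing \<equiv> localizing_subcategory U T"

text \<open>The mapping telescope, described by its properties instead of its triangle. It is only a
  weak colimit, so \<open>h\<close> is not claimed to be unique; the last two clauses say that
  compact objects see it as a colimit, injectivity being recorded at stage 0.\<close>

definition telescope_colimit :: "(nat \<Rightarrow> 'a) \<Rightarrow> (nat \<Rightarrow> 'b) \<Rightarrow> 'a \<Rightarrow> (nat \<Rightarrow> 'b) \<Rightarrow> bool" where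
  "telescope_colimit X f H j \<longleftrightarrow> H \<in> Ob T \<and> (\<forall>n. j n \<in> Hom T (X n) H) \<and> (\<forall>n. j (Suc n) \<bullet> f n = j n) \<and>
    (\<forall>Y g. (\<forall>n. g n \<in> Hom T (X n) Y) \<longrightarrow> (\<forall>n. g (Suc n) \<bullet> f n = g n) \<longrightarrow>
      (\<exists>h\<in>Hom T H Y. \<forall>n. h \<bullet> j n = g n)) \<and>
    (\<forall>S. localizing S \<longrightarrow> (\<forall>n. X n \<in> S) \<longrightarrow> H \<in> S) \<and>
    (\<forall>C\<in>compacts. \<forall>a\<in>Hom T C H. \<exists>n. \<exists>b\<in>Hom T C (X n). a = j n \<bullet> b) \<and>
    (\<forall>C\<in>compacts. \<forall>a\<in>Hom T C (X 0). j 0 \<bullet> a = Zer T C H \<longrightarrow>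
      (\<exists>k. tower_map f (X 0) k \<bullet> a = Zer T C (X k)))"

lemma telescope_colimitD:
  assumes "telescope_colimit X f H j"
  shows "H \<in> Ob T" "\<And>n. j n \<in> Hom T (X n) H" "\<And>n. j (Suc n) \<bullet> f n = j n"
    "\<And>Y g. \<lbrakk>\<And>n. g n \<in> Hom T (X n) Y; \<And>n. g (Suc n) \<bullet> f n = g n\<rbrakk>
      \<Longrightarrow> \<exists>h\<in>Hom T H Y. \<forall>n. h \<bullet> j n = g n"
    "\<And>S. \<lbrakk>localizing S; \<And>n. X n \<in> S\<rbrakk> \<Longrightarrow> H \<in> S"
    "\<And>C a. \<lbrakk>C \<in> compacts; a \<in> Hom T C H\<rbrakk> \<Longrightarrow> \<exists>n. \<exists>b\<in>Hom T C (X n). a = j n \<bullet> b"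
    "\<And>C a. \<lbrakk>C \<in> compacts; a \<in> Hom T C (X 0); j 0 \<bullet> a = Zer T C H\<rbrakk>
      \<Longrightarrow> \<exists>k. tower_map f (X 0) k \<bullet> a = Zer T C (X k)"
  using assms unfolding telescope_colimit_def by (simp_all del: Hom_iff)

lemma telescope_exists:
  assumes f: "\<And>n. f n \<in> Hom T (X n) (X (Suc n))"
  shows "\<exists>H j. telescope_colimit X f H j"
proof -
  have X [simp]: "X n \<in> Ob T" for n using Hom_Ob(1)[OF f] .
  have fs [simp]: "f n \<in> Mor T" "Dom T (f n) = X n" "Cod T (f n) = X (Suc n)" for n using f[of n] by auto
  have small: "small U (UNIV :: nat set)" by (rule small_countable[OF univ countableI_type])
  obtain P \<iota> where cop: "is_coproduct T (UNIV :: nat set) X P \<iota>"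
    using small_coproduct_exists[OF cops small, of X] by auto
  interpret C: coproduct T "UNIV :: nat set" X P \<iota> using cop by unfold_locales
  have [simp]: "\<iota> n \<in> Mor T" "Dom T (\<iota> n) = X n" "Cod T (\<iota> n) = P" "C.pr n \<in> Mor T"
    "Dom T (C.pr n) = P" "Cod T (C.pr n) = X n" for n using C.inj_hom C.pr_hom by auto
  have "\<exists>h\<in>Hom T P P. \<forall>i\<in>UNIV. h \<bullet> \<iota> i = \<iota> (Suc i) \<bullet> f i"
    by (rule C.cop_ind) simp_all
  then obtain sh where [simp]: "sh \<in> Mor T" "Dom T sh = P" "Cod T sh = P"
    and sh: "\<And>i. sh \<bullet> \<iota> i = \<iota> (Suc i) \<bullet> f i" by auto
  \<comment> \<open>The telescope is the cone of \<open>1 - sh\<close> on the coproduct of all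
    stages.\<close>
  define \<theta> where "\<theta> = Minus (Ident T P) sh"
  have [simp]: "\<theta> \<in> Mor T" "Dom T \<theta> = P" "Cod T \<theta> = P" by (simp_all add: \<theta>_def)
  have \<theta>: "\<theta> \<bullet> \<iota> n = Minus (\<iota> n) (\<iota> (Suc n) \<bullet> f n)" for n
    by (simp add: \<theta>_def Minus_comp sh)
  obtain v w where t: "(\<theta>, v, w) \<in> Tri T" using tri_complete[of \<theta>] by auto
  note [simp] = tri_simps[OF t]
  let ?H = "Cod T v"
  define j where "j n = v \<bullet> \<iota> n" for n
  have jh: "j n \<in> Hom T (X n) ?H" for n by (simp add: j_def)
  then have [simp]: "j n \<in> Mor T" "Dom T (j n) = X n" "Cod T (j n) = ?H" for n by auto
  have "Minus v (v \<bullet> sh) = Zer T P ?H"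
    using tri_comp_zero[OF t] by (simp add: \<theta>_def comp_Minus)
  then have vsh: "v \<bullet> sh = v" using Minus_eq_Zer_iff[of v "v \<bullet> sh"] by simp
  have jf: "j (Suc n) \<bullet> f n = j n" for n
  proof -
    have "j (Suc n) \<bullet> f n = (v \<bullet> sh) \<bullet> \<iota> n" by (simp add: j_def sh)
    then show ?thesis by (simp add: vsh j_def)
  qed
  have ind: "\<exists>h\<in>Hom T ?H Y. \<forall>n. h \<bullet> j n = g n"
    if g: "\<And>n. g n \<in> Hom T (X n) Y" and gf: "\<And>n. g (Suc n) \<bullet> f n = g n" for Y g
  proof -
    have [simp]: "Y \<in> Ob T" using Hom_Ob(2)[OF g] .
    note [simp] = HomD[OF g]
    have "\<exists>h\<in>Hom T P Y. \<forall>i\<in>UNIV. h \<bullet> \<iota> i = g i" by (rule C.cop_ind) simp_all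
    then obtain G where Gh: "G \<in> Hom T P Y" and G: "\<And>i. G \<bullet> \<iota> i = g i" by blast
    from Gh have [simp]: "G \<in> Mor T" "Dom T G = P" "Cod T G = Y" by auto
    have "G \<bullet> \<theta> = Zer T P Y"
    proof (rule C.cop_eqI)
      fix n
      have "G \<bullet> (\<iota> (Suc n) \<bullet> f n) = g n"
        using comp_assoc'[of G "\<iota> (Suc n)" "f n"] by (simp add: G gf)
      then show "(G \<bullet> \<theta>) \<bullet> \<iota> n = Zer T P Y \<bullet> \<iota> n" by (simp add: \<theta> comp_Minus G)
    qed simp_all
    with tri_ext[OF t, of G Y] obtain h where h: "h \<in> Hom T ?H Y" "G = h \<bullet> v" by auto
    have "h \<bullet> j n = g n" for n
      using h(1) G[of n] unfolding h(2) by (simp add: j_def)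
    with h(1) show ?thesis by blast
  qed
  \<comment> \<open>In components, \<open>\<theta>\<close> sends \<open>y\<close> to
    \<open>y_0\<close> at stage 0 and to \<open>y_(k+1) - f_k y_k\<close> at stage
    \<open>k + 1\<close>. This recursion drives both \<open>inj\<close> and
    \<open>dies\<close>.\<close>
  have pr0: "C.pr 0 \<bullet> \<theta> = C.pr 0"
  proof (rule C.cop_eqI)
    fix n
    have "C.pr 0 \<bullet> (\<iota> (Suc n) \<bullet> f n) = Zer T (X n) (X 0)"
      using comp_assoc'[of "C.pr 0" "\<iota> (Suc n)" "f n"] by (simp add: C.pr_inj)
    then show "(C.pr 0 \<bullet> \<theta>) \<bullet> \<iota> n = C.pr 0 \<bullet> \<iota> n"
      by (simp add: \<theta> comp_Minus C.pr_inj)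
  qed simp_all
  have prS: "C.pr (Suc k) \<bullet> \<theta> = Minus (C.pr (Suc k)) (f k \<bullet> C.pr k)" for k
  proof (rule C.cop_eqI)
    fix n
    have "C.pr (Suc k) \<bullet> (\<iota> (Suc n) \<bullet> f n) = f k \<bullet> (C.pr k \<bullet> \<iota> n)"
      using comp_assoc'[of "C.pr (Suc k)" "\<iota> (Suc n)" "f n"]
      by (cases "n = k") (simp_all add: C.pr_inj)
    then show "(C.pr (Suc k) \<bullet> \<theta>) \<bullet> \<iota> n = Minus (C.pr (Suc k)) (f k \<bullet> C.pr k) \<bullet> \<iota> n"
      by (simp add: \<theta> comp_Minus Minus_comp)
  qed simp_all
  have cut: "\<exists>F. finite F \<and> cut UNIV P \<iota> F \<bullet> y = y" if "C \<in> compacts" "y \<in> Hom T C P" for C y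
    using compact_cut[OF that(1) cop small that(2)] by blast
  have pr_rec: "C.pr (Suc k) \<bullet> y = f k \<bullet> (C.pr k \<bullet> y)"
    if y: "y \<in> Hom T C P" and z: "C.pr (Suc k) \<bullet> (\<theta> \<bullet> y) = Zer T C (X (Suc k))" for y C k
  proof -
    note [simp] = HomD[OF y]
    have "Minus (C.pr (Suc k) \<bullet> y) (f k \<bullet> (C.pr k \<bullet> y)) = (C.pr (Suc k) \<bullet> \<theta>) \<bullet> y"
      unfolding prS by (simp add: Minus_comp)
    then show ?thesis using z Minus_eq_Zer_iff[of "C.pr (Suc k) \<bullet> y" "f k \<bullet> (C.pr k \<bullet> y)"] by simp
  qed
  \<comment> \<open>The recursion makes all components of \<open>y\<close> zero; that they determine
    \<open>y\<close> is due to compactness of \<open>C\<close>, since projections need not detect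
    maps into an infinite coproduct.\<close>
  have inj: "y = Zer T C P" if C: "C \<in> compacts" and y: "y \<in> Hom T C P" and z: "\<theta> \<bullet> y = Zer T C P" for C y
  proof -
    note [simp] = HomD[OF y]
    have pz: "C.pr k \<bullet> y = Zer T C (X k)" for k
    proof (induction k)
      case 0
      have "C.pr 0 \<bullet> y = (C.pr 0 \<bullet> \<theta>) \<bullet> y" unfolding pr0 ..
      then show ?case by (simp add: z)
    next
      case (Suc k)
      then show ?case using pr_rec[OF y, of k] by (simp add: z)
    qed
    obtain F where "finite F" "cut UNIV P \<iota> F \<bullet> y = y" using cut[OF C y] by blast
    then show ?thesis using C.cut_pr_zero[OF _ _ y, of F] pz by simp
  qed
  have H_loc: "?H \<in> S" if S: "localizing S" and XS: "\<And>n. X n \<in> S" for S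
  proof -
    interpret S: triangulated_sub T S using localizing_triangulated_sub[OF S] .
    have "P \<in> S" using localizing_coproduct[OF S cop small] XS by blast
    then show ?thesis using S.sub_cone[OF t] by simp
  qed
  have trans: "\<exists>s\<in>Hom T (X n) (X m). j m \<bullet> s = j n" if "n \<le> m" for n m
    using that
  proof (induction m rule: dec_induct)
    case base show ?case by (rule bexI[of _ "Ident T (X n)"]) simp_all
  next
    case (step m)
    then obtain s where s: "s \<in> Hom T (X n) (X m)" "j m \<bullet> s = j n" by blast
    have "j (Suc m) \<bullet> (f m \<bullet> s) = (j (Suc m) \<bullet> f m) \<bullet> s" using s(1) by simp
    also have "\<dots> = j n" unfolding jf by (rule s(2))
    finally show ?case using s(1) by (intro bexI[of _ "f m \<bullet> s"]) simp_all
  qed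
  \<comment> \<open>Injectivity of \<open>\<theta>\<close> on maps from the desuspended
    \<open>C\<close> forces \<open>w \<bullet> a = 0\<close>, so \<open>a\<close> comes from the
    coproduct, hence from finitely many stages, all of which map on to a common stage
    \<open>N\<close>.\<close>
  have fac: "\<exists>n. \<exists>b\<in>Hom T C (X n). a = j n \<bullet> b" if C: "C \<in> compacts" and a: "a \<in> Hom T C ?H" for C a
  proof -
    note [simp] = HomD[OF a]
    let ?y = "susp_powM T (-1) (w \<bullet> a)"
    have sM: "SuspM T ?y = w \<bullet> a" by simp
    have y: "?y \<in> Hom T (susp_pow T (-1) C) P" by simp
    have "SuspM T (\<theta> \<bullet> ?y) = (SuspM T \<theta> \<bullet> w) \<bullet> a"
      using y by (subst SuspM_comp) simp_all
    also have "\<dots> = SuspM T (Zer T (susp_pow T (-1) C) P)"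
      unfolding tri_comp_zero3[OF t] by simp
    finally have "\<theta> \<bullet> ?y = Zer T (susp_pow T (-1) C) P" by (rule SuspM_inj) simp_all
    from inj[OF compact_susp_pow[OF C] y this] have "SuspM T ?y = Zer T C (Susp T P)"
      by simp
    then have "w \<bullet> a = Zer T C (Susp T P)" using sM by simp
    with tri_lift2[OF t a] obtain b where b: "b \<in> Hom T C P" "a = v \<bullet> b" by auto
    obtain F where F: "finite F" "cut UNIV P \<iota> F \<bullet> b = b" using cut[OF C b(1)] by blast
    obtain N where N: "\<And>n. n \<in> F \<Longrightarrow> n \<le> N" using F(1) by (meson Max_ge)
    from trans N have "\<forall>n. \<exists>s. n \<in> F \<longrightarrow> s \<in> Hom T (X n) (X N) \<and> j N \<bullet> s = j n" by blast
    then obtain s where s: "\<And>n. n \<in> F \<Longrightarrow> s n \<in> Hom T (X n) (X N)" "\<And>n. n \<in> F \<Longrightarrow> j N \<bullet> s n = j n"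
      by metis
    have "\<exists>h\<in>Hom T P (X N). \<forall>i\<in>UNIV. h \<bullet> \<iota> i = (if i \<in> F then s i else Zer T (X i) (X N))"
      by (rule C.cop_ind) (use s(1) in auto)
    then obtain \<rho> where \<rho>: "\<rho> \<in> Hom T P (X N)" "\<And>i. \<rho> \<bullet> \<iota> i = (if i \<in> F then s i else Zer T (X i) (X N))"
      by blast
    have "v \<bullet> cut UNIV P \<iota> F = j N \<bullet> \<rho>"
    proof (rule C.cop_eqI)
      fix i
      show "(v \<bullet> cut UNIV P \<iota> F) \<bullet> \<iota> i = (j N \<bullet> \<rho>) \<bullet> \<iota> i"
        using \<rho> s[of i] by (simp add: C.cut_inj j_def)
    qed (use \<rho>(1) in simp_all)
    then have "(v \<bullet> cut UNIV P \<iota> F) \<bullet> b = (j N \<bullet> \<rho>) \<bullet> b" by simp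
    then have "a = j N \<bullet> (\<rho> \<bullet> b)" using b \<rho>(1) F(2) by simp
    moreover have "\<rho> \<bullet> b \<in> Hom T C (X N)" using b \<rho>(1) by simp
    ultimately show ?thesis by blast
  qed
  \<comment> \<open>If \<open>a\<close> dies in the telescope, then
    \<open>\<iota> 0 \<bullet> a = \<theta> \<bullet> y\<close>, and the recursion identifies the
    components of \<open>y\<close> with the images of \<open>a\<close> along the tower; only
    finitely many are nonzero.\<close>
  have dies: "\<exists>k. tower_map f (X 0) k \<bullet> a = Zer T C (X k)"
    if C: "C \<in> compacts" and a: "a \<in> Hom T C (X 0)" and z: "j 0 \<bullet> a = Zer T C ?H" for C a
  proof -
    note [simp] = HomD[OF a]
    have "v \<bullet> (\<iota> 0 \<bullet> a) = Zer T C ?H" using z by (simp add: j_def)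
    with tri_lift[OF t, of "\<iota> 0 \<bullet> a" C] obtain y where y: "y \<in> Hom T C P" "\<iota> 0 \<bullet> a = \<theta> \<bullet> y" by auto
    note [simp] = HomD[OF y(1)]
    have pi: "C.pr k \<bullet> (\<theta> \<bullet> y) = (C.pr k \<bullet> \<iota> 0) \<bullet> a" for k by (simp add: y(2)[symmetric])
    have tm: "tower_map f (X 0) k \<in> Hom T (X 0) (X k)" for k by (induction k) simp_all
    have "C.pr k \<bullet> y = tower_map f (X 0) k \<bullet> a" for k
    proof (induction k)
      case 0
      have "C.pr 0 \<bullet> y = (C.pr 0 \<bullet> \<theta>) \<bullet> y" unfolding pr0 ..
      then show ?case using pi[of 0] by (simp add: C.pr_inj)
    next
      case (Suc k)
      have "C.pr (Suc k) \<bullet> (\<theta> \<bullet> y) = Zer T C (X (Suc k))" unfolding pi by (simp add: C.pr_inj)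
      from pr_rec[OF y(1) this] show ?case using Suc tm[of k] by simp
    qed
    moreover obtain F where F: "finite F" "cut UNIV P \<iota> F \<bullet> y = y" using cut[OF C y(1)] by blast
    moreover obtain k where "k \<notin> F" using F(1) ex_new_if_finite[OF infinite_UNIV_nat] by blast
    moreover have "C.pr k \<bullet> y = (C.pr k \<bullet> cut UNIV P \<iota> F) \<bullet> y" by (simp add: F(2))
    ultimately have "tower_map f (X 0) k \<bullet> a = Zer T C (X k)"
      using C.pr_cut[of k F] by simp
    then show ?thesis by blast
  qed
  have "telescope_colimit X f ?H j"
    unfolding telescope_colimit_def using jh jf ind H_loc fac dies by (simp del: Hom_iff)
  then show ?thesis by blast
qed

end

context coproduct_tricat begin

lemma small_maps_from:
  assumes "small U G" "G \<subseteq> Ob T" "X \<in> Ob T"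
  shows "small U {y \<in> Mor T. Dom T y \<in> G \<and> Cod T y = X}"
proof (rule small_subset)
  have "small U (Hom T g X)" if "g \<in> G" for g
    using that assms loc_small unfolding locally_small_def by blast
  then show "small U (\<Union>g\<in>G. Hom T g X)" by (rule small_UN[OF univ assms(1)])
qed auto

text \<open>The maps serve as their own indices, so that every map in \<open>I\<close> factors
  through the single map \<open>\<kappa>\<close>; each tower below attaches cells in this
  way.\<close>

lemma coproduct_of_maps:
  assumes small: "small U I" and I: "\<And>y. y \<in> I \<Longrightarrow> y \<in> Mor T \<and> Cod T y = X" and X: "X \<in> Ob T"
  obtains W \<iota> \<kappa> where "is_coproduct T I (Dom T) W \<iota>" "\<kappa> \<in> Hom T W X" "\<And>y. y \<in> I \<Longrightarrow> \<kappa> \<bullet> \<iota> y = y"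
proof -
  obtain W \<iota> where cop: "is_coproduct T I (Dom T) W \<iota>"
    using small_coproduct_exists[OF cops small, of "Dom T"] I by auto
  interpret coproduct T I "Dom T" W \<iota> using cop by unfold_locales
  have "\<exists>h\<in>Hom T W X. \<forall>y\<in>I. h \<bullet> \<iota> y = y" by (rule cop_ind) (use I X in auto)
  then show ?thesis using that cop by blast
qed

section \<open>Localization with respect to a set of compact objects\<close>

text \<open>All maps from \<open>G\<close> that \<open>f\<close> annihilates die together in the
  cone of their common \<open>\<kappa>\<close>; \<open>f\<close> extends to this cone because it
  vanishes on \<open>\<kappa>\<close>.\<close>

lemma torsion_tower_step:
  assumes G: "small U G" "G \<subseteq> Ob T" and loc: "localizing S" "G \<subseteq> S"
    and \<Gamma>: "\<Gamma> \<in> S" and f: "f \<in> Hom T \<Gamma> X"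
  shows "\<exists>\<Gamma>'\<in>S. \<exists>f'\<in>Hom T \<Gamma>' X. \<exists>q\<in>Hom T \<Gamma> \<Gamma>'. f' \<bullet> q = f \<and>
    (\<forall>g\<in>G. \<forall>y\<in>Hom T g \<Gamma>. f \<bullet> y = Zer T g X \<longrightarrow> q \<bullet> y = Zer T g \<Gamma>')"
proof -
  interpret S: triangulated_sub T S using localizing_triangulated_sub[OF loc(1)] .
  note [simp] = HomD[OF f]
  define I where "I = {y \<in> Mor T. Dom T y \<in> G \<and> Cod T y = \<Gamma> \<and> f \<bullet> y = Zer T (Dom T y) X}"
  have small: "small U I"
    by (rule small_subset[OF small_maps_from[OF G, of \<Gamma>]]) (auto simp: I_def)
  have II [simp]: "y \<in> Mor T" "Cod T y = \<Gamma>" "Dom T y \<in> G" "f \<bullet> y = Zer T (Dom T y) X" if "y \<in> I" for y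
    using that unfolding I_def by auto
  obtain W \<iota> \<kappa> where cop: "is_coproduct T I (Dom T) W \<iota>" and \<kappa>: "\<kappa> \<in> Hom T W \<Gamma>"
    "\<And>y. y \<in> I \<Longrightarrow> \<kappa> \<bullet> \<iota> y = y"
    using coproduct_of_maps[OF small, of \<Gamma>] by auto
  interpret coproduct T I "Dom T" W \<iota> using cop by unfold_locales
  note [simp] = HomD[OF \<kappa>(1)]
  obtain q w where t: "(\<kappa>, q, w) \<in> Tri T" using tri_complete[of \<kappa>] by auto
  note [simp] = tri_simps[OF t]
  have "W \<in> S"
    by (rule localizing_coproduct[OF loc(1) cop small]) (use loc(2) II in blast)
  then have "Cod T q \<in> S" using S.sub_cone[OF t] \<Gamma> by simp
  moreover have "f \<bullet> \<kappa> = Zer T W X"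
    by (rule cop_eqI[of _ X]) (simp_all add: \<kappa>(2))
  then obtain f' where f': "f' \<in> Hom T (Cod T q) X" "f = f' \<bullet> q"
    using tri_ext[OF t, of f X] by auto
  moreover have "q \<bullet> y = Zer T g (Cod T q)" if "g \<in> G" "y \<in> Hom T g \<Gamma>" "f \<bullet> y = Zer T g X" for g y
  proof -
    have "y \<in> I" using that unfolding I_def by simp
    then have "q \<bullet> y = (q \<bullet> \<kappa>) \<bullet> \<iota> y" by (simp add: \<kappa>(2))
    then show ?thesis using \<open>y \<in> I\<close> that(2) unfolding tri_comp_zero[OF t] by simp
  qed
  moreover have "q \<in> Hom T \<Gamma> (Cod T q)" by simp
  ultimately show ?thesis by metis
qed

text \<open>A cellular approximation in place of Brown representability: stage 0 is the coproduct of
  all maps from \<open>G\<close> to \<open>X\<close>, and each later stage kills the kernel of the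
  previous one. On the telescope \<open>u\<close> induces a bijection on maps from \<open>G\<close>,
  and since \<open>G\<close> is closed under shifts, the cone of \<open>u\<close> receives no
  nonzero map from \<open>G\<close>.\<close>

lemma localization_triangle_exists:
  assumes G: "small U G" "G \<subseteq> compacts" "\<And>g n. g \<in> G \<Longrightarrow> susp_pow T n g \<in> G" and X: "X \<in> Ob T"
  shows "\<exists>u v w. (u, v, w) \<in> Tri T \<and> Cod T u = X \<and> Dom T u \<in> Loc U T G \<and>
    (\<forall>g\<in>G. \<forall>f\<in>Hom T g (Cod T v). f = Zer T g (Cod T v))"
proof -
  have GO: "G \<subseteq> Ob T" using G(2) compact_Ob by blast
  let ?S = "Loc U T G"
  have loc: "localizing ?S" "G \<subseteq> ?S" using Loc_localizing[OF GO] Loc_superset by auto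
  interpret S: triangulated_sub T ?S using localizing_triangulated_sub[OF loc(1)] .
  \<comment> \<open>Surjectivity is demanded only at stage 0, since
    \<open>u \<bullet> j 0 = ?f 0\<close> passes it on to the telescope.\<close>
  define P where "P n p = (fst p \<in> ?S \<and> snd p \<in> Hom T (fst p) X \<and>
    (n = 0 \<longrightarrow> (\<forall>g\<in>G. \<forall>y\<in>Hom T g X. \<exists>z\<in>Hom T g (fst p). y = snd p \<bullet> z)))" for n :: nat and p
  define Q where "Q p p' = (\<exists>q\<in>Hom T (fst p) (fst p'). snd p' \<bullet> q = snd p \<and>
    (\<forall>g\<in>G. \<forall>y\<in>Hom T g (fst p). snd p \<bullet> y = Zer T g X \<longrightarrow> q \<bullet> y = Zer T g (fst p')))" for p p'
  have "\<exists>p. P 0 p"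
  proof -
    define I where "I = {y \<in> Mor T. Dom T y \<in> G \<and> Cod T y = X}"
    have small: "small U I" unfolding I_def by (rule small_maps_from[OF G(1) GO X])
    obtain W \<iota> \<kappa> where cop: "is_coproduct T I (Dom T) W \<iota>" and \<kappa>: "\<kappa> \<in> Hom T W X"
      "\<And>y. y \<in> I \<Longrightarrow> \<kappa> \<bullet> \<iota> y = y"
      using coproduct_of_maps[OF small _ X] unfolding I_def by auto
    interpret coproduct T I "Dom T" W \<iota> using cop by unfold_locales
    have "W \<in> ?S"
      by (rule localizing_coproduct[OF loc(1) cop small]) (use loc(2) in \<open>auto simp: I_def\<close>)
    moreover have "\<exists>z\<in>Hom T g W. y = \<kappa> \<bullet> z" if "g \<in> G" "y \<in> Hom T g X" for g y
    proof -
      have "y \<in> I" using that unfolding I_def by simp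
      then show ?thesis using that by (intro bexI[of _ "\<iota> y"]) (simp_all add: \<kappa>(2))
    qed
    ultimately have "P 0 (W, \<kappa>)" using \<kappa>(1) unfolding P_def by (simp del: Hom_iff)
    then show ?thesis by blast
  qed
  moreover have "\<exists>p'. P (Suc n) p' \<and> Q p p'" if "P n p" for n p
  proof -
    have "fst p \<in> ?S" "snd p \<in> Hom T (fst p) X" using that unfolding P_def by blast+
    from torsion_tower_step[OF G(1) GO loc this] obtain \<Gamma>' f' q where
      "\<Gamma>' \<in> ?S" "f' \<in> Hom T \<Gamma>' X" "q \<in> Hom T (fst p) \<Gamma>'" "f' \<bullet> q = snd p"
      "\<forall>g\<in>G. \<forall>y\<in>Hom T g (fst p). snd p \<bullet> y = Zer T g X \<longrightarrow> q \<bullet> y = Zer T g \<Gamma>'" by blast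
    then have "P (Suc n) (\<Gamma>', f') \<and> Q p (\<Gamma>', f')" unfolding P_def Q_def by (auto simp del: Hom_iff)
    then show ?thesis by blast
  qed
  ultimately obtain p where P: "\<And>n. P n (p n)" and Q: "\<And>n. Q (p n) (p (Suc n))"
    using dependent_nat_choice[of P "\<lambda>n. Q"] by blast
  let ?\<Gamma> = "\<lambda>n. fst (p n)" and ?f = "\<lambda>n. snd (p n)"
  have pS: "?\<Gamma> n \<in> ?S" and pf: "?f n \<in> Hom T (?\<Gamma> n) X" for n using P[of n] unfolding P_def by blast+
  have onto: "\<exists>z\<in>Hom T g (?\<Gamma> 0). y = ?f 0 \<bullet> z" if "g \<in> G" "y \<in> Hom T g X" for g y
    using P[of 0] that unfolding P_def by blast
  from Q have "\<forall>n. \<exists>q. q \<in> Hom T (?\<Gamma> n) (?\<Gamma> (Suc n)) \<and> ?f (Suc n) \<bullet> q = ?f n \<and>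
    (\<forall>g\<in>G. \<forall>y\<in>Hom T g (?\<Gamma> n). ?f n \<bullet> y = Zer T g X \<longrightarrow> q \<bullet> y = Zer T g (?\<Gamma> (Suc n)))"
    unfolding Q_def by blast
  then obtain q where q: "\<And>n. q n \<in> Hom T (?\<Gamma> n) (?\<Gamma> (Suc n))" and fq: "\<And>n. ?f (Suc n) \<bullet> q n = ?f n"
    and qz: "\<And>n g y. \<lbrakk>g \<in> G; y \<in> Hom T g (?\<Gamma> n); ?f n \<bullet> y = Zer T g X\<rbrakk> \<Longrightarrow> q n \<bullet> y = Zer T g (?\<Gamma> (Suc n))"
    by metis
  obtain H j where tel: "telescope_colimit ?\<Gamma> q H j"
    using telescope_exists[of q "?\<Gamma>", OF q] by blast
  note H [simp] = telescope_colimitD(1)[OF tel]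
  note j = telescope_colimitD(2)[OF tel] and jq = telescope_colimitD(3)[OF tel]
    and ind = telescope_colimitD(4)[OF tel] and Hloc = telescope_colimitD(5)[OF tel]
    and fac = telescope_colimitD(6)[OF tel] and dies = telescope_colimitD(7)[OF tel]
  have HS: "H \<in> ?S" using Hloc[OF loc(1) pS] .
  obtain u where u: "u \<in> Hom T H X" and uj: "\<And>n. u \<bullet> j n = ?f n" using ind[OF pf fq] by blast
  note [simp] = HomD[OF u]
  note [simp] = HomD[OF j]
  note [simp] = HomD[OF q]
  have inj: "y = Zer T g H" if g: "g \<in> G" and y: "y \<in> Hom T g H" and z: "u \<bullet> y = Zer T g X" for g y
  proof -
    obtain n b where b: "b \<in> Hom T g (?\<Gamma> n)" "y = j n \<bullet> b" using fac[of g y] g G(2) y by blast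
    note [simp] = HomD[OF b(1)]
    have "?f n \<bullet> b = (u \<bullet> j n) \<bullet> b" unfolding uj ..
    also have "\<dots> = Zer T g X" using z b(2) by simp
    finally have "q n \<bullet> b = Zer T g (?\<Gamma> (Suc n))" using qz[OF g b(1)] by simp
    then have "(j (Suc n) \<bullet> q n) \<bullet> b = Zer T g H" by simp
    then show ?thesis unfolding jq b(2) .
  qed
  obtain v w where t: "(u, v, w) \<in> Tri T" using tri_complete[of u] by auto
  note [simp] = tri_simps[OF t]
  have "f = Zer T g (Cod T v)" if g: "g \<in> G" and f: "f \<in> Hom T g (Cod T v)" for g f
  proof -
    note [simp] = HomD[OF f]
    let ?y = "susp_powM T (-1) (w \<bullet> f)"
    have y: "?y \<in> Hom T (susp_pow T (-1) g) H" by simp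
    have "SuspM T (u \<bullet> ?y) = (SuspM T u \<bullet> w) \<bullet> f" by (subst SuspM_comp) simp_all
    also have "\<dots> = SuspM T (Zer T (susp_pow T (-1) g) X)"
      unfolding tri_comp_zero3[OF t] by simp
    finally have "u \<bullet> ?y = Zer T (susp_pow T (-1) g) X" by (rule SuspM_inj) simp_all
    from inj[OF G(3)[OF g] y this] have "SuspM T ?y = Zer T g (Susp T H)" by simp
    then have "w \<bullet> f = Zer T g (Susp T H)" by simp
    with tri_lift2[OF t f] obtain b where b: "b \<in> Hom T g X" "f = v \<bullet> b" by auto
    obtain z where z: "z \<in> Hom T g (?\<Gamma> 0)" "b = ?f 0 \<bullet> z" using onto[OF g b(1)] by blast
    have "f = ((v \<bullet> u) \<bullet> j 0) \<bullet> z" using b z(1) by (simp add: z(2) flip: uj)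
    then show ?thesis using z(1) unfolding tri_comp_zero[OF t] by simp
  qed
  then have "(u, v, w) \<in> Tri T \<and> Cod T u = X \<and> Dom T u \<in> ?S \<and>
    (\<forall>g\<in>G. \<forall>f\<in>Hom T g (Cod T v). f = Zer T g (Cod T v))" using t HS by (simp del: Hom_iff)
  then show ?thesis by blast
qed

section \<open>Compact objects of a localizing subcategory generated by compacts\<close>

text \<open>The property carried backwards along the tower in Neeman's argument; for an identity it
  exhibits a retract of an object of \<open>S\<close>.\<close>

definition factors_thru :: "'a set \<Rightarrow> 'b \<Rightarrow> bool" where
  "factors_thru S x \<longleftrightarrow> (\<exists>F\<in>S. \<exists>d\<in>Hom T (Dom T x) F. \<exists>b\<in>Hom T F (Cod T x). x = b \<bullet> d)"

lemma factors_thruI: "\<lbrakk>F \<in> S; d \<in> Hom T D F; b \<in> Hom T F X\<rbrakk> \<Longrightarrow> factors_thru S (b \<bullet> d)"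
  unfolding factors_thru_def by (intro bexI[of _ F] bexI[of _ d] bexI[of _ b]) auto

lemma factors_thruE:
  assumes "factors_thru S x" "x \<in> Hom T D X"
  obtains F d b where "F \<in> S" "d \<in> Hom T D F" "b \<in> Hom T F X" "x = b \<bullet> d"
proof -
  have "Dom T x = D" "Cod T x = X" using assms(2) by auto
  with assms(1) that show ?thesis unfolding factors_thru_def by blast
qed

text \<open>The two factorizations are combined through the direct sum of their middle objects,
  formed inside \<open>S\<close>.\<close>

lemma factors_thru_Plus:
  assumes S: "triangulated_subcategory T S" and x: "x \<in> Hom T D X" "factors_thru S x"
    and y: "y \<in> Hom T D X" "factors_thru S y"
  shows "factors_thru S (Plus T x y)"
proof -
  interpret triangulated_sub T S using S by unfold_locales
  obtain F d b where F: "F \<in> S" and d: "d \<in> Hom T D F" and b: "b \<in> Hom T F X" and xb: "x = b \<bullet> d"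
    using factors_thruE[OF x(2,1)] .
  obtain F' d' b' where F': "F' \<in> S" and d': "d' \<in> Hom T D F'" and b': "b' \<in> Hom T F' X" and yb: "y = b' \<bullet> d'"
    using factors_thruE[OF y(2,1)] .
  note [simp] = sub_Ob[OF F] sub_Ob[OF F'] Hom_Ob[OF x(1)]
  have [simp]: "d \<in> Mor T" "Dom T d = D" "Cod T d = F" "b \<in> Mor T" "Dom T b = F" "Cod T b = X"
    "d' \<in> Mor T" "Dom T d' = D" "Cod T d' = F'" "b' \<in> Mor T" "Dom T b' = F'" "Cod T b' = X"
    using d b d' b' by auto
  obtain Z i j p q where Z: "Z \<in> S" and ijpq: "i \<in> Hom T F Z" "j \<in> Hom T F' Z" "p \<in> Hom T Z F" "q \<in> Hom T Z F'"
    and e: "p \<bullet> i = Ident T F" "q \<bullet> j = Ident T F'" "q \<bullet> i = Zer T F F'" "p \<bullet> j = Zer T F' F"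
    using sub_split_sum[OF F F'] by metis
  from ijpq have [simp]: "i \<in> Mor T" "Dom T i = F" "Cod T i = Z" "j \<in> Mor T" "Dom T j = F'" "Cod T j = Z"
    "p \<in> Mor T" "Dom T p = Z" "Cod T p = F" "q \<in> Mor T" "Dom T q = Z" "Cod T q = F'" by auto
  have e': "p \<bullet> (i \<bullet> d) = d" "q \<bullet> (j \<bullet> d') = d'" "q \<bullet> (i \<bullet> d) = Zer T D F'" "p \<bullet> (j \<bullet> d') = Zer T D F"
    using e by (simp_all flip: comp_assoc')
  have "Plus T (b \<bullet> p) (b' \<bullet> q) \<bullet> Plus T (i \<bullet> d) (j \<bullet> d') = Plus T x y"
    by (simp add: Plus_comp comp_Plus e' xb yb)
  moreover have "factors_thru S (Plus T (b \<bullet> p) (b' \<bullet> q) \<bullet> Plus T (i \<bullet> d) (j \<bullet> d'))"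
    by (rule factors_thruI[OF Z, of _ D _ X]) simp_all
  ultimately show ?thesis by simp
qed

text \<open>The fibre of \<open>c i \<bullet> t\<close> stays in \<open>S\<close>, and the map from
  \<open>D\<close> lifts to it because \<open>c i\<close> annihilates \<open>d\<close>.\<close>

lemma kill_finitely_many:
  assumes S: "triangulated_subcategory T S" and F: "F \<in> S" and d: "d \<in> Hom T D F" and A: "finite A"
    and c: "\<And>i. i \<in> A \<Longrightarrow> Z i \<in> S \<and> c i \<in> Hom T F (Z i) \<and> c i \<bullet> d = Zer T D (Z i)"
  shows "\<exists>F'\<in>S. \<exists>t\<in>Hom T F' F. \<exists>d'\<in>Hom T D F'. t \<bullet> d' = d \<and> (\<forall>i\<in>A. c i \<bullet> t = Zer T F' (Z i))"
proof -
  interpret triangulated_sub T S using S by unfold_locales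
  note [simp] = sub_Ob[OF F] Hom_Ob[OF d]
  note [simp] = HomD[OF d]
  show ?thesis using A c
  proof (induction A rule: finite_induct)
    case empty
    show ?case using F by (intro bexI[of _ F] bexI[of _ "Ident T F"] bexI[of _ d]) simp_all
  next
    case (insert i A)
    have ci: "Z i \<in> S" "c i \<in> Hom T F (Z i)" "c i \<bullet> d = Zer T D (Z i)" using insert.prems[of i] by auto
    note [simp] = HomD[OF ci(2)]
    obtain F' t d' where F': "F' \<in> S" and th: "t \<in> Hom T F' F" and d'h: "d' \<in> Hom T D F'" and td: "t \<bullet> d' = d"
      and z: "\<And>j. j \<in> A \<Longrightarrow> c j \<bullet> t = Zer T F' (Z j)"
      using insert.IH insert.prems by blast
    have [simp]: "t \<in> Mor T" "Dom T t = F'" "Cod T t = F" "d' \<in> Mor T" "Dom T d' = D" "Cod T d' = F'" "F' \<in> Ob T"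
      using th d'h Hom_Ob[OF th] by auto
    obtain s w where tr: "(s, c i \<bullet> t, w) \<in> Tri T" "Cod T s = F'"
      using tri_complete_right[of "c i \<bullet> t"] by auto
    note [simp] = tri_simps(1,3,5,6)[OF tr(1)] tr(2)
    have "Dom T s \<in> S" using sub_fibre[OF tr(1)] F' ci(1) by simp
    moreover have "(c i \<bullet> t) \<bullet> d' = Zer T D (Z i)" using ci(3) td by simp
    then obtain d'' where d'': "d'' \<in> Hom T D (Dom T s)" "d' = s \<bullet> d''"
      using tri_lift[OF tr(1), of d' D] by auto
    moreover have "(t \<bullet> s) \<bullet> d'' = d" using d'' td by simp
    moreover have "c j \<bullet> (t \<bullet> s) = Zer T (Dom T s) (Z j)" if "j \<in> insert i A" for j
    proof -
      have cj: "c j \<in> Hom T F (Z j)" using insert.prems that by blast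
      then have "c j \<bullet> (t \<bullet> s) = (c j \<bullet> t) \<bullet> s" by simp
      also have "\<dots> = Zer T (Dom T s) (Z j)"
      proof (cases "j = i")
        case True then show ?thesis using tri_comp_zero[OF tr(1)] by simp
      next
        case False then show ?thesis using that z[of j] Hom_Ob[OF cj] by simp
      qed
      finally show ?thesis .
    qed
    moreover have "t \<bullet> s \<in> Hom T (Dom T s) F" by simp
    ultimately show ?case by blast
  qed
qed

text \<open>Neeman's induction step: by compactness only finitely many summands of the coproduct \<open>W\<close> are
  met, and these are killed one at a time by passing to fibres inside \<open>S\<close>.\<close>

lemma factors_thru_attach:
  assumes S: "triangulated_subcategory T S" "S \<subseteq> compacts"
    and cop: "is_coproduct T I A W \<iota>" and small: "small U I" and A: "\<And>i. i \<in> I \<Longrightarrow> A i \<in> S"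
    and t: "(\<kappa>, q, w) \<in> Tri T" and \<kappa>: "\<kappa> \<in> Hom T W X"
    and D: "D \<in> compacts" and a: "a \<in> Hom T D X" and fac: "factors_thru S (q \<bullet> a)"
  shows "factors_thru S a"
proof -
  interpret S: triangulated_sub T S using S(1) by unfold_locales
  interpret coproduct T I A W \<iota> using cop by unfold_locales
  have cop': "is_coproduct T I (\<lambda>i. Susp T (A i)) (Susp T W) (\<lambda>i. SuspM T (\<iota> i))"
    using coproduct_susp[OF cop, of 1] by simp
  interpret C': coproduct T I "\<lambda>i. Susp T (A i)" "Susp T W" "\<lambda>i. SuspM T (\<iota> i)" using cop' by unfold_locales
  note [simp] = tri_simps[OF t] Hom_Ob[OF a]
  note [simp] = HomD[OF \<kappa>]
  note [simp] = HomD[OF a]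
  obtain F d b where F: "F \<in> S" and d: "d \<in> Hom T D F" and b: "b \<in> Hom T F (Cod T q)" and qa: "q \<bullet> a = b \<bullet> d"
    by (rule factors_thruE[OF fac, of D "Cod T q"]) (simp, blast)
  note [simp] = S.sub_Ob[OF F]
  have [simp]: "d \<in> Mor T" "Dom T d = D" "Cod T d = F" "b \<in> Mor T" "Dom T b = F" "Cod T b = Cod T q"
    using d b by auto
  have e: "w \<bullet> b \<in> Hom T F (Susp T W)" by simp
  \<comment> \<open>The obstruction to lifting \<open>b\<close> through \<open>q\<close> is
    \<open>w \<bullet> b\<close>. It vanishes after \<open>d\<close>, but it has to vanish already
    on some object of \<open>S\<close> through which \<open>d\<close> factors.\<close>
  have "(w \<bullet> b) \<bullet> d = (w \<bullet> q) \<bullet> a" using qa by simp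
  then have ed: "w \<bullet> (b \<bullet> d) = Zer T D (Susp T W)" unfolding tri_comp_zero2[OF t] by simp
  obtain E where E: "finite E" "E \<subseteq> I" "cut I (Susp T W) (\<lambda>i. SuspM T (\<iota> i)) E \<bullet> (w \<bullet> b) = w \<bullet> b"
    using compact_cut[OF _ cop' small e] F S(2) by blast
  have EI [simp]: "i \<in> E \<Longrightarrow> i \<in> I" for i using E(2) by blast
  have "\<exists>F'\<in>S. \<exists>s\<in>Hom T F' F. \<exists>d'\<in>Hom T D F'. s \<bullet> d' = d \<and>
      (\<forall>i\<in>E. (C'.pr i \<bullet> (w \<bullet> b)) \<bullet> s = Zer T F' (Susp T (A i)))"
    by (rule kill_finitely_many[OF S(1) F d E(1)]) (use A S.sub_Susp ed in simp_all)
  then obtain F' s d' where F': "F' \<in> S" and s: "s \<in> Hom T F' F" and d': "d' \<in> Hom T D F'" and sd: "s \<bullet> d' = d"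
    and z: "\<And>i. i \<in> E \<Longrightarrow> (C'.pr i \<bullet> (w \<bullet> b)) \<bullet> s = Zer T F' (Susp T (A i))" by blast
  have [simp]: "s \<in> Mor T" "Dom T s = F'" "Cod T s = F" "d' \<in> Mor T" "Dom T d' = D" "Cod T d' = F'" "F' \<in> Ob T"
    using s d' Hom_Ob[OF s] by auto
  have "cut I (Susp T W) (\<lambda>i. SuspM T (\<iota> i)) E \<bullet> ((w \<bullet> b) \<bullet> s) = Zer T F' (Susp T W)"
    by (rule C'.cut_pr_zero[OF E(1,2)]) (use z in simp_all)
  then have "(cut I (Susp T W) (\<lambda>i. SuspM T (\<iota> i)) E \<bullet> (w \<bullet> b)) \<bullet> s = Zer T F' (Susp T W)" by simp
  then have "w \<bullet> (b \<bullet> s) = Zer T F' (Susp T W)" unfolding E(3) by simp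
  then obtain b' where b': "b' \<in> Hom T F' X" "b \<bullet> s = q \<bullet> b'"
    using tri_lift2[OF t, of "b \<bullet> s" F'] by auto
  note [simp] = HomD[OF b'(1)]
  have "q \<bullet> (b' \<bullet> d') = (b \<bullet> s) \<bullet> d'" unfolding b'(2) by simp
  also have "\<dots> = q \<bullet> a" by (simp add: sd qa)
  finally have qq: "q \<bullet> (b' \<bullet> d') = q \<bullet> a" .
  \<comment> \<open>\<open>a\<close> and \<open>b' \<bullet> d'\<close> agree after
    \<open>q\<close>, so their difference comes from \<open>W\<close>, where it meets only finitely
    many \<open>A i\<close>, all of them in \<open>S\<close>.\<close>
  define m where "m = Minus a (b' \<bullet> d')"
  have [simp]: "m \<in> Mor T" "Dom T m = D" "Cod T m = X" by (simp_all add: m_def)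
  have "q \<bullet> m = Zer T D (Cod T q)" by (simp add: m_def comp_Minus qq)
  then obtain z where z: "z \<in> Hom T D W" "m = \<kappa> \<bullet> z" using tri_lift[OF t, of m D] by auto
  note [simp] = HomD[OF z(1)]
  obtain E' where E': "finite E'" "E' \<subseteq> I" "cut I W \<iota> E' \<bullet> z = z" using compact_cut[OF D cop small z(1)] by blast
  have EI' [simp]: "i \<in> E' \<Longrightarrow> i \<in> I" for i using E'(2) by blast
  have "\<kappa> \<bullet> (cut I W \<iota> E' \<bullet> z) \<in> {x \<in> Hom T D X. factors_thru S x}"
  proof (rule cut_induct[OF E'(1,2) z(1) \<kappa>])
    have "factors_thru S (Zer T F X \<bullet> d)" by (rule factors_thruI[OF F d]) simp
    then show "Zer T D X \<in> {x \<in> Hom T D X. factors_thru S x}" by simp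
  next
    fix i assume i: "i \<in> E'"
    have "factors_thru S ((\<kappa> \<bullet> \<iota> i) \<bullet> (pr i \<bullet> z))"
      by (rule factors_thruI[of "A i" _ _ D _ X]) (use i A in simp_all)
    then show "\<kappa> \<bullet> (\<iota> i \<bullet> (pr i \<bullet> z)) \<in> {x \<in> Hom T D X. factors_thru S x}" using i by simp
  next
    fix x y assume "x \<in> {x \<in> Hom T D X. factors_thru S x}" "y \<in> {x \<in> Hom T D X. factors_thru S x}"
    then show "Plus T x y \<in> {x \<in> Hom T D X. factors_thru S x}"
      using factors_thru_Plus[OF S(1), of x D X y] by simp
  qed
  then have "factors_thru S m" unfolding E'(3) z(2) by simp
  moreover have "factors_thru S (b' \<bullet> d')" by (rule factors_thruI[OF F' d' b'(1)])
  ultimately have "factors_thru S (Plus T m (b' \<bullet> d'))"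
    using factors_thru_Plus[OF S(1), of m D X "b' \<bullet> d'"] by simp
  then show ?thesis by (simp add: m_def)
qed

text \<open>Start with \<open>D\<close> and attach cones on all maps from \<open>G\<close>. The
  telescope still lies in \<open>Loc U T G\<close> but receives no nonzero map from
  \<open>G\<close>, hence it is zero; by compactness the map from \<open>D\<close> to some finite
  stage is then zero.\<close>

lemma compact_Loc_small:
  assumes S: "thick_subcategory T S" "S \<subseteq> compacts"
    and G: "small U G" "G \<subseteq> S" "\<And>g n. g \<in> G \<Longrightarrow> susp_pow T n g \<in> G"
    and D: "D \<in> compacts" "D \<in> Loc U T G"
  shows "D \<in> S"
proof -
  have ts: "triangulated_subcategory T S" using S(1) unfolding thick_subcategory_def by blast
  interpret S: triangulated_sub T S using ts by unfold_locales
  have GO: "G \<subseteq> Ob T" using G(2) S.sub_Ob by blast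
  let ?L = "Loc U T G"
  have loc: "localizing ?L" "G \<subseteq> ?L" using Loc_localizing[OF GO] Loc_superset by auto
  interpret L: triangulated_sub T ?L using localizing_triangulated_sub[OF loc(1)] .
  define Q where "Q X X' = (\<exists>q\<in>Hom T X X'. (\<forall>g\<in>G. \<forall>y\<in>Hom T g X. q \<bullet> y = Zer T g X') \<and>
    (\<forall>a\<in>Hom T D X. factors_thru S (q \<bullet> a) \<longrightarrow> factors_thru S a))" for X X'
  have step: "\<exists>X'. X' \<in> ?L \<and> Q X X'" if XL: "X \<in> ?L" for X
  proof -
    note [simp] = L.sub_Ob[OF XL]
    define I where "I = {y \<in> Mor T. Dom T y \<in> G \<and> Cod T y = X}"
    have small: "small U I" unfolding I_def by (rule small_maps_from[OF G(1) GO]) simp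
    have I [simp]: "y \<in> Mor T" "Dom T y \<in> G" "Cod T y = X" if "y \<in> I" for y using that unfolding I_def by auto
    obtain W \<iota> \<kappa> where cop: "is_coproduct T I (Dom T) W \<iota>" and \<kappa>: "\<kappa> \<in> Hom T W X"
      "\<And>y. y \<in> I \<Longrightarrow> \<kappa> \<bullet> \<iota> y = y"
      using coproduct_of_maps[OF small, of X] by auto
    interpret coproduct T I "Dom T" W \<iota> using cop by unfold_locales
    note [simp] = HomD[OF \<kappa>(1)]
    obtain q w where t: "(\<kappa>, q, w) \<in> Tri T" using tri_complete[of \<kappa>] by auto
    note [simp] = tri_simps[OF t]
    have "W \<in> ?L"
      by (rule localizing_coproduct[OF loc(1) cop small]) (use loc(2) I in blast)
    then have "Cod T q \<in> ?L" using L.sub_cone[OF t] XL by simp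
    moreover have "q \<bullet> y = Zer T g (Cod T q)" if "g \<in> G" "y \<in> Hom T g X" for g y
    proof -
      have "y \<in> I" using that unfolding I_def by simp
      then have "q \<bullet> y = (q \<bullet> \<kappa>) \<bullet> \<iota> y" by (simp add: \<kappa>(2))
      then show ?thesis using \<open>y \<in> I\<close> that(2) unfolding tri_comp_zero[OF t] by simp
    qed
    moreover have "factors_thru S a" if "a \<in> Hom T D X" "factors_thru S (q \<bullet> a)" for a
      by (rule factors_thru_attach[OF ts S(2) cop small _ t \<kappa>(1) D(1) that]) (use G(2) I in blast)
    moreover have "q \<in> Hom T X (Cod T q)" by simp
    ultimately show ?thesis unfolding Q_def by blast
  qed
  have "\<exists>X. \<forall>n. (X n \<in> ?L \<and> (n = 0 \<longrightarrow> X n = D)) \<and> Q (X n) (X (Suc n))"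
    by (rule dependent_nat_choice) (use D(2) step in auto)
  then obtain X where XL: "\<And>n. X n \<in> ?L" and X0: "X 0 = D" and XQ: "\<And>n. Q (X n) (X (Suc n))" by blast
  have "\<forall>n. \<exists>q. q \<in> Hom T (X n) (X (Suc n)) \<and>
    (\<forall>g\<in>G. \<forall>y\<in>Hom T g (X n). q \<bullet> y = Zer T g (X (Suc n))) \<and>
    (\<forall>a\<in>Hom T D (X n). factors_thru S (q \<bullet> a) \<longrightarrow> factors_thru S a)"
    using XQ unfolding Q_def by blast
  from choice[OF this] obtain q where q: "\<And>n. q n \<in> Hom T (X n) (X (Suc n))"
    and qz: "\<And>n g y. \<lbrakk>g \<in> G; y \<in> Hom T g (X n)\<rbrakk> \<Longrightarrow> q n \<bullet> y = Zer T g (X (Suc n))"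
    and qf: "\<And>n a. \<lbrakk>a \<in> Hom T D (X n); factors_thru S (q n \<bullet> a)\<rbrakk> \<Longrightarrow> factors_thru S a"
    by blast
  obtain H j where tel: "telescope_colimit X q H j"
    using telescope_exists[of q X, OF q] by blast
  note H [simp] = telescope_colimitD(1)[OF tel]
  note j = telescope_colimitD(2)[OF tel] and jq = telescope_colimitD(3)[OF tel]
    and ind = telescope_colimitD(4)[OF tel] and Hloc = telescope_colimitD(5)[OF tel]
    and fac = telescope_colimitD(6)[OF tel] and dies = telescope_colimitD(7)[OF tel]
  have [simp]: "X n \<in> Ob T" for n using Hom_Ob[OF q[of n]] by simp
  have [simp]: "D \<in> Ob T" using compact_Ob[OF D(1)] .
  note [simp] = HomD[OF j]
  note [simp] = HomD[OF q]
  have "f = Zer T g H" if g: "g \<in> G" and f: "f \<in> Hom T g H" for g f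
  proof -
    obtain n b where b: "b \<in> Hom T g (X n)" "f = j n \<bullet> b" using fac[of g f] g G(2) S(2) f by blast
    have "(j (Suc n) \<bullet> q n) \<bullet> b = j (Suc n) \<bullet> Zer T g (X (Suc n))" using qz[OF g b(1)] b(1) by simp
    then show ?thesis unfolding jq b(2) using g GO by auto
  qed
  from Loc_perp[OF H GO G(3) this Hloc[OF loc(1) XL], of "Ident T H"] have "is_zero T H"
    using is_zero_iff[OF H] by simp
  from is_zeroD[OF this, of "j 0" D] have "j 0 \<bullet> Ident T D = Zer T D H" using X0 by simp
  have tm: "tower_map q D k \<in> Hom T D (X k)" for k by (induction k) (simp_all add: X0)
  have "Ident T D \<in> Hom T D (X 0)" using X0 by simp
  from dies[OF D(1) this \<open>j 0 \<bullet> Ident T D = Zer T D H\<close>] obtain k where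
    "tower_map q (X 0) k \<bullet> Ident T D = Zer T D (X k)" by blast
  then have k: "tower_map q D k = Zer T D (X k)" using tm[of k] X0 by simp
  \<comment> \<open>The zero map at stage \<open>k\<close> factors through \<open>S\<close>, and
    \<open>factors_thru_attach\<close> undoes one attachment after the other, down to stage 0, where
    the map is the identity of \<open>D\<close>.\<close>
  have "factors_thru S (tower_map q D n) \<Longrightarrow> factors_thru S (tower_map q D 0)" for n
  proof (induction n)
    case (Suc n)
    then have "factors_thru S (q n \<bullet> tower_map q D n)" by simp
    from qf[OF tm this] show ?case by (rule Suc.IH)
  qed
  moreover obtain N where N: "is_zero T N" using zero_object by blast
  have "factors_thru S (Zer T N (X k) \<bullet> Zer T D N)"
    by (rule factors_thruI[OF S.sub_zero[OF N]]) (use is_zero_Ob[OF N] in simp_all)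
  then have "factors_thru S (tower_map q D k)" using is_zero_Ob[OF N] k by simp
  ultimately have "factors_thru S (Ident T D)" by (metis tower_map.simps(1))
  then obtain F d b where "F \<in> S" "d \<in> Hom T D F" "b \<in> Hom T F D" "Ident T D = b \<bullet> d"
    by (rule factors_thruE[of _ _ D D]) (simp, blast)
  then show ?thesis using thick_retract[OF S(1), of d D F b] by metis
qed

text \<open>The objects reached from small subsets of \<open>C\<close> form a localizing
  subcategory, since a small union of small sets is small. A thick \<open>S\<close> need not be
  small, whereas the tower requires coproducts over all maps from the generators.\<close>

lemma Loc_small_generation:
  assumes C: "C \<subseteq> Ob T" and D: "D \<in> Loc U T C"
  shows "\<exists>G\<subseteq>C. small U G \<and> D \<in> Loc U T G"
proof -
  define S where "S = {X. \<exists>G\<subseteq>C. small U G \<and> X \<in> Loc U T G}"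
  have ts: "triangulated_sub T (Loc U T G)" if "G \<subseteq> C" for G
    using that C Loc_localizing[of G U] localizing_triangulated_sub by blast
  have sm: "small U {}" "small U {c}" for c :: 'a using small_countable[OF univ] by auto
  obtain N where N: "is_zero T N" using zero_object by blast
  have "S \<subseteq> Ob T" unfolding S_def using triangulated_sub.sub_Ob[OF ts] by blast
  moreover have "N \<in> S" unfolding S_def using triangulated_sub.sub_zero[OF ts[of "{}"] N] sm(1) by blast
  moreover have "X \<in> S \<longleftrightarrow> Susp T X \<in> S" if "X \<in> Ob T" for X
    unfolding S_def using triangulated_sub.sub_Susp[OF ts that] by blast
  moreover have "Cod T v \<in> S" if t: "(u, v, w) \<in> Tri T" and uv: "Dom T u \<in> S" "Cod T u \<in> S" for u v w
  proof -
    obtain G H where GH: "G \<subseteq> C" "small U G" "Dom T u \<in> Loc U T G" "H \<subseteq> C" "small U H" "Cod T u \<in> Loc U T H"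
      using uv unfolding S_def by blast
    then have "Dom T u \<in> Loc U T (G \<union> H)" "Cod T u \<in> Loc U T (G \<union> H)"
      using Loc_mono[of G "G \<union> H" U] Loc_mono[of H "G \<union> H" U] by auto
    with GH have "Cod T v \<in> Loc U T (G \<union> H)" using triangulated_sub.sub_cone[OF ts t] by blast
    then show ?thesis unfolding S_def using GH small_Un[OF univ] by blast
  qed
  ultimately have "triangulated_subcategory T S" unfolding triangulated_subcategory_def by blast
  moreover have "P \<in> S" if I: "small U I" and X: "X \<in> I \<rightarrow> S" and cop: "is_coproduct T I X P \<iota>"
    for I :: "'d set" and X P \<iota>
  proof -
    have "\<forall>i\<in>I. \<exists>G. G \<subseteq> C \<and> small U G \<and> X i \<in> Loc U T G" using X unfolding S_def by auto
    then obtain G where G: "\<And>i. i \<in> I \<Longrightarrow> G i \<subseteq> C \<and> small U (G i) \<and> X i \<in> Loc U T (G i)" by metis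
    let ?G = "\<Union>i\<in>I. G i"
    have "?G \<subseteq> C" using G by blast
    moreover have "small U ?G" using small_UN[OF univ I] G by blast
    moreover have "X i \<in> Loc U T ?G" if "i \<in> I" for i
      using G[OF that] Loc_mono[of "G i" ?G U] that by blast
    then have "P \<in> Loc U T ?G"
      using localizing_coproduct[OF Loc_localizing cop I] \<open>?G \<subseteq> C\<close> C by blast
    ultimately show ?thesis unfolding S_def by blast
  qed
  ultimately have "localizing S" unfolding localizing_subcategory_def by blast
  moreover have "C \<subseteq> S"
  proof
    fix c assume "c \<in> C" then show "c \<in> S" unfolding S_def using sm(2) Loc_superset[of "{c}" U] by blast
  qed
  ultimately have "D \<in> S" using Loc_least D by blast
  then show ?thesis unfolding S_def by blast
qed

lemma small_shift_closure:
  assumes "small U G" shows "small U (\<Union>n. susp_pow T n ` G)"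
  by (rule small_UN[OF univ small_countable[OF univ countableI_type]]) (rule small_image[OF assms])

theorem compact_Loc_thick:
  assumes S: "thick_subcategory T S" "S \<subseteq> compacts" and D: "D \<in> compacts" "D \<in> Loc U T S"
  shows "D \<in> S"
proof -
  interpret S: triangulated_sub T S using S(1) unfolding thick_subcategory_def by unfold_locales blast
  have "S \<subseteq> Ob T" using S.sub_Ob by blast
  from Loc_small_generation[OF this D(2)] obtain G where G: "G \<subseteq> S" "small U G" "D \<in> Loc U T G" by blast
  let ?G = "\<Union>n. susp_pow T n ` G"
  show ?thesis
  proof (rule compact_Loc_small[OF S small_shift_closure[OF G(2)] _ _ D(1)])
    show "?G \<subseteq> S" using G(1) S.sub_Ob S.sub_susp_pow by blast
    have "g = susp_pow T 0 g" for g by simp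
    then have "G \<subseteq> ?G" by blast
    then show "D \<in> Loc U T ?G" using Loc_mono[of G ?G U] G(3) by blast
    fix g n assume "g \<in> ?G"
    then obtain m h where "h \<in> G" "g = susp_pow T m h" by blast
    then have "susp_pow T n g = susp_pow T (n + m) h" using G(1) S.sub_Ob by auto
    then show "susp_pow T n g \<in> ?G" using \<open>h \<in> G\<close> by blast
  qed
qed

end

section \<open>Homogeneous elements and primes\<close>

context graded_ring begin

lemma grade_carrier: "r \<in> grade R n \<Longrightarrow> r \<in> carrier R"
  using additive_subgroup.a_subset[OF grade_subgroup] by blast

lemma grade_zero: "\<zero> \<in> grade R n"
  using additive_subgroup.zero_closed[OF grade_subgroup] .

lemma grade_add: "\<lbrakk>r \<in> grade R n; s \<in> grade R n\<rbrakk> \<Longrightarrow> r \<oplus> s \<in> grade R n"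
  using additive_subgroup.a_closed[OF grade_subgroup] .

lemma grade_minus: "r \<in> grade R n \<Longrightarrow> \<ominus> r \<in> grade R n"
  using additive_subgroup.a_inv_closed[OF grade_subgroup] .

lemma hcomp_props:
  assumes "r \<in> carrier R"
  shows "hcomp R r n \<in> grade R n" "finite {n. hcomp R r n \<noteq> \<zero>}"
    "r = finsum R (hcomp R r) {n. hcomp R r n \<noteq> \<zero>}"
  using theI'[OF grade_decomp[OF assms]] unfolding hcomp_def by blast+

lemma hcomp_homogeneous:
  assumes "s \<in> grade R n" shows "hcomp R s = (\<lambda>m. if m = n then s else \<zero>)"
proof -
  let ?c = "\<lambda>m. if m = n then s else \<zero>"
  have sR: "s \<in> carrier R" using grade_carrier[OF assms] .
  have e: "{m. ?c m \<noteq> \<zero>} = (if s = \<zero> then {} else {n})" by auto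
  have "(\<forall>m. ?c m \<in> grade R m) \<and> finite {m. ?c m \<noteq> \<zero>} \<and> s = finsum R ?c {m. ?c m \<noteq> \<zero>}"
    using assms grade_zero sR unfolding e by (auto simp: finsum_insert)
  then show ?thesis unfolding hcomp_def by (rule the1_equality[OF grade_decomp[OF sR]])
qed

end

context graded_commutative_ring begin

lemma Spec_props:
  assumes "P \<in> Spec R"
  shows "ideal P R" "\<And>r n. r \<in> P \<Longrightarrow> hcomp R r n \<in> P" "P \<subseteq> carrier R" "\<one> \<notin> P"
    "\<And>r s. \<lbrakk>r \<in> carrier R; s \<in> carrier R; r \<otimes> s \<in> P\<rbrakk> \<Longrightarrow> r \<in> P \<or> s \<in> P"
proof -
  show id: "ideal P R" using assms unfolding Spec_def homogeneous_ideal_def by blast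
  show "\<And>r n. r \<in> P \<Longrightarrow> hcomp R r n \<in> P" using assms unfolding Spec_def homogeneous_ideal_def by blast
  show "P \<subseteq> carrier R" using id additive_subgroup.a_subset ideal.axioms(1) by blast
  show "\<one> \<notin> P" using assms ideal.one_imp_carrier[OF id] unfolding Spec_def by blast
  show "\<And>r s. \<lbrakk>r \<in> carrier R; s \<in> carrier R; r \<otimes> s \<in> P\<rbrakk> \<Longrightarrow> r \<in> P \<or> s \<in> P"
    using assms unfolding Spec_def by blast
qed

lemma Spec_mult_notin:
  assumes "P \<in> Spec R" "r \<in> grade R m - P" "s \<in> grade R n - P" shows "r \<otimes> s \<in> grade R (m + n) - P"
  using Spec_props(5)[OF assms(1), of r s] assms grade_mult[of r m s n] grade_carrier by blast

text \<open>Cones can be formed only for homogeneous elements, so it is on these that an inclusion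
  of a prime in an ideal is verified.\<close>

lemma Spec_subset_homogeneous:
  assumes P: "P \<in> Spec R" and I: "ideal I R" and h: "\<And>n r. \<lbrakk>r \<in> grade R n; r \<in> P\<rbrakk> \<Longrightarrow> r \<in> I"
  shows "P \<subseteq> I"
proof
  fix r assume r: "r \<in> P"
  then have rR: "r \<in> carrier R" using Spec_props(3)[OF P] by blast
  have "hcomp R r n \<in> I" for n using h hcomp_props(1)[OF rR] Spec_props(2)[OF P r] by blast
  moreover have "finsum R c A \<in> I" if "finite A" "\<And>n. c n \<in> I" for c and A :: "int set"
    using that(1)
  proof (induction A rule: finite_induct)
    case empty
    then show ?case using additive_subgroup.zero_closed[OF ideal.axioms(1)[OF I]] by simp
  next
    case (insert n A)
    have "c n \<in> carrier R" for n using that(2) additive_subgroup.a_subset[OF ideal.axioms(1)[OF I]] by blast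
    then show ?case
      using insert that(2) additive_subgroup.a_closed[OF ideal.axioms(1)[OF I]] by (simp add: finsum_insert Pi_iff)
  qed
  ultimately show "r \<in> I" using hcomp_props[OF rR] by metis
qed

end

section \<open>The action of the ring on morphisms\<close>

locale linear_tricat = coproduct_tricat T U + R: graded_commutative_ring R
  for T :: "('o, 'm, 'z) tricat_scheme" (structure) and U :: "'u itself" and R :: "('r, 'y) gring_scheme" +
  fixes \<phi> :: "int \<Rightarrow> 'r \<Rightarrow> 'o \<Rightarrow> 'm"
  assumes lin: "R_linear R T \<phi>"
begin

lemma phi_center: "r \<in> grade R n \<Longrightarrow> \<phi> n r \<in> graded_center T n"
  using lin unfolding R_linear_def by blast

lemma phi_hom [simp]:
  assumes "r \<in> grade R n" "X \<in> Ob T"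
  shows "\<phi> n r X \<in> Mor T" "Dom T (\<phi> n r X) = X" "Cod T (\<phi> n r X) = susp_pow T n X"
  using phi_center[OF assms(1)] assms(2) unfolding graded_center_def by auto

lemma phi_nat:
  assumes "r \<in> grade R n" "f \<in> Hom T X Y"
  shows "susp_powM T n f \<bullet> \<phi> n r X = \<phi> n r Y \<bullet> f"
  using phi_center[OF assms(1)] assms(2) Hom_Ob[OF assms(2)] unfolding graded_center_def by blast

lemma phi_Susp:
  assumes "r \<in> grade R n" "X \<in> Ob T"
  shows "\<phi> n r (Susp T X) = (if even n then SuspM T (\<phi> n r X) else neg_mor T (SuspM T (\<phi> n r X)))"
  using phi_center[OF assms(1)] assms(2) unfolding graded_center_def by blast

lemma phi_add:
  "\<lbrakk>r \<in> grade R n; s \<in> grade R n; X \<in> Ob T\<rbrakk> \<Longrightarrow> \<phi> n (r \<oplus>\<^bsub>R\<^esub> s) X = Plus T (\<phi> n r X) (\<phi> n s X)"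
  using lin unfolding R_linear_def by blast

lemma phi_one: "X \<in> Ob T \<Longrightarrow> \<phi> 0 \<one>\<^bsub>R\<^esub> X = Ident T X"
  using lin unfolding R_linear_def by blast

lemma phi_mult:
  "\<lbrakk>r \<in> grade R m; s \<in> grade R n; X \<in> Ob T\<rbrakk>
    \<Longrightarrow> \<phi> (m + n) (r \<otimes>\<^bsub>R\<^esub> s) X = susp_powM T n (\<phi> m r X) \<bullet> \<phi> n s X"
  using lin unfolding R_linear_def by blast

text \<open>The sign is \<open>(-1)^(n i)\<close>, but it is left open: later arguments test
  vanishing or move the sign into the ring element.\<close>

lemma phi_susp_pow:
  assumes r [simp]: "r \<in> grade R n" and X [simp]: "X \<in> Ob T"
  shows "\<phi> n r (susp_pow T i X) = susp_powM T i (\<phi> n r X) \<or>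
    \<phi> n r (susp_pow T i X) = neg_mor T (susp_powM T i (\<phi> n r X))"
proof (induction i rule: int_step_induct)
  case (step i)
  let ?a = "\<phi> n r (susp_pow T i X)" and ?b = "susp_powM T i (\<phi> n r X)"
  have "\<phi> n r (susp_pow T (i + 1) X) = SuspM T ?a \<or> \<phi> n r (susp_pow T (i + 1) X) = neg_mor T (SuspM T ?a)"
    using phi_Susp[OF r, of "susp_pow T i X"] by (simp split: if_splits)
  moreover have "susp_powM T (i + 1) (\<phi> n r X) = SuspM T ?b" by simp
  moreover have "SuspM T ?a = SuspM T ?b \<longleftrightarrow> ?a = ?b"
    "SuspM T ?a = neg_mor T (SuspM T ?b) \<longleftrightarrow> ?a = neg_mor T ?b"
    using SuspM_eq_iff[of ?a ?b] SuspM_eq_iff[of ?a "neg_mor T ?b"] by (simp_all del: SuspM_eq_iff Susp_susp_pow)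
  moreover have "neg_mor T (SuspM T ?a) = SuspM T ?b \<longleftrightarrow> SuspM T ?a = neg_mor T (SuspM T ?b)"
    "neg_mor T (SuspM T ?a) = neg_mor T (SuspM T ?b) \<longleftrightarrow> SuspM T ?a = SuspM T ?b"
    by (rule neg_eq_iff; simp)+
  ultimately show ?case by metis
qed simp

section \<open>Morphisms annihilated by homogeneous elements\<close>

definition kills :: "int \<Rightarrow> 'r \<Rightarrow> 'm \<Rightarrow> bool" where
  "kills n s x \<longleftrightarrow> \<phi> n s (Cod T x) \<bullet> x = Zer T (Dom T x) (susp_pow T n (Cod T x))"

text \<open>Naturality lets \<open>s\<close> act at the source, which is the form in which
  \<open>x\<close> extends over the cone of \<open>s\<close> on its domain.\<close>

lemma kills_alt:
  assumes "s \<in> grade R n" "x \<in> Mor T"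
  shows "kills n s x \<longleftrightarrow> susp_powM T n x \<bullet> \<phi> n s (Dom T x) = Zer T (Dom T x) (susp_pow T n (Cod T x))"
  unfolding kills_def using phi_nat[of s n x "Dom T x" "Cod T x"] assms by simp

lemma kills_Zer: "\<lbrakk>s \<in> grade R n; X \<in> Ob T; Y \<in> Ob T\<rbrakk> \<Longrightarrow> kills n s (Zer T X Y)"
  unfolding kills_def by simp

lemma kills_comp_right:
  assumes "kills n s x" "s \<in> grade R n" "x \<in> Mor T" "y \<in> Mor T" "Dom T x = Cod T y"
  shows "kills n s (x \<bullet> y)"
proof -
  have "\<phi> n s (Cod T x) \<bullet> (x \<bullet> y) = (\<phi> n s (Cod T x) \<bullet> x) \<bullet> y"
    using assms by (simp flip: comp_assoc')
  also have "\<dots> = Zer T (Dom T y) (susp_pow T n (Cod T x))"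
    using assms unfolding kills_def by simp
  finally show ?thesis using assms unfolding kills_def by simp
qed

lemma kills_comp_left:
  assumes "kills n s x" "s \<in> grade R n" "x \<in> Mor T" "y \<in> Mor T" "Dom T y = Cod T x"
  shows "kills n s (y \<bullet> x)"
proof -
  have "\<phi> n s (Cod T y) \<bullet> (y \<bullet> x) = (\<phi> n s (Cod T y) \<bullet> y) \<bullet> x"
    using assms by simp
  also have "\<dots> = (susp_powM T n y \<bullet> \<phi> n s (Cod T x)) \<bullet> x"
    using phi_nat[of s n y "Cod T x" "Cod T y"] assms by simp
  also have "\<dots> = susp_powM T n y \<bullet> (\<phi> n s (Cod T x) \<bullet> x)" using assms by simp
  also have "\<dots> = Zer T (Dom T x) (susp_pow T n (Cod T y))"
    using assms unfolding kills_def by simp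
  finally show ?thesis using assms unfolding kills_def by simp
qed

lemma kills_Plus:
  assumes "kills n s x" "kills n s y" "s \<in> grade R n" "x \<in> Mor T" "y \<in> Mor T" "Dom T x = Dom T y" "Cod T x = Cod T y"
  shows "kills n s (Plus T x y)"
  using assms unfolding kills_def by (simp add: comp_Plus)

lemma kills_neg: "\<lbrakk>kills n s x; s \<in> grade R n; x \<in> Mor T\<rbrakk> \<Longrightarrow> kills n s (neg_mor T x)"
  unfolding kills_def by simp

lemma kills_susp_pow:
  assumes [simp]: "s \<in> grade R n" "x \<in> Mor T"
  shows "kills n s (susp_powM T i x) \<longleftrightarrow> kills n s x"
proof -
  have e: "susp_powM T i (\<phi> n s (Cod T x)) \<bullet> susp_powM T i x = susp_powM T i (\<phi> n s (Cod T x) \<bullet> x)"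
    by (simp add: susp_powM_comp)
  have "kills n s (susp_powM T i x) \<longleftrightarrow> susp_powM T i (\<phi> n s (Cod T x)) \<bullet> susp_powM T i x =
      Zer T (susp_pow T i (Dom T x)) (susp_pow T (n + i) (Cod T x))"
    using phi_susp_pow[of s n "Cod T x" i] unfolding kills_def by (auto simp: add.commute)
  also have "\<dots> \<longleftrightarrow> kills n s x"
    unfolding e kills_def using susp_powM_eq_Zer_iff[of "\<phi> n s (Cod T x) \<bullet> x" i] by (simp add: add.commute)
  finally show ?thesis .
qed

lemma kills_mult_left:
  assumes "kills n s x" "s \<in> grade R n" "r \<in> grade R m" "x \<in> Mor T"
  shows "kills (m + n) (r \<otimes>\<^bsub>R\<^esub> s) x"
  using assms unfolding kills_def by (simp add: phi_mult add.commute)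

text \<open>The sign relating \<open>\<Sigma>\<^sup>m \<phi>(s)\<close> and \<open>\<phi>(s)\<Sigma>\<^sup>m\<close> is irrelevant for vanishing.\<close>

lemma kills_mult:
  assumes k: "kills n s (\<phi> m r (Cod T x) \<bullet> x)" and [simp]: "s \<in> grade R n" "r \<in> grade R m" "x \<in> Mor T"
  shows "kills (n + m) (s \<otimes>\<^bsub>R\<^esub> r) x"
proof -
  let ?X = "Cod T x"
  have "\<phi> n s (susp_pow T m ?X) \<bullet> (\<phi> m r ?X \<bullet> x) = Zer T (Dom T x) (susp_pow T (n + m) ?X)"
    using k unfolding kills_def by simp
  then have "susp_powM T m (\<phi> n s ?X) \<bullet> (\<phi> m r ?X \<bullet> x) = Zer T (Dom T x) (susp_pow T (n + m) ?X)"
    using phi_susp_pow[of s n ?X m] by (auto simp: add.commute)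
  then show ?thesis
    using phi_mult[of s n r m ?X] unfolding kills_def by (simp add: add.commute)
qed

lemma kills_mult_right:
  assumes "kills n s x" "s \<in> grade R n" "r \<in> grade R m" "x \<in> Mor T"
  shows "kills (n + m) (s \<otimes>\<^bsub>R\<^esub> r) x"
  by (rule kills_mult, rule kills_comp_left) (use assms in simp_all)

text \<open>In other words, \<open>x\<close> becomes zero in the homogeneous localization of its Hom
  module at \<open>P\<close>.\<close>

definition killed :: "'r set \<Rightarrow> 'm \<Rightarrow> bool" where
  "killed P x \<longleftrightarrow> (\<exists>n. \<exists>s\<in>grade R n - P. kills n s x)"

lemma killed_Zer: "\<lbrakk>P \<in> Spec R; X \<in> Ob T; Y \<in> Ob T\<rbrakk> \<Longrightarrow> killed P (Zer T X Y)"
  unfolding killed_def using R.grade_one R.Spec_props(4) kills_Zer by blast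

lemma killed_comp_right:
  "\<lbrakk>killed P x; x \<in> Mor T; y \<in> Mor T; Dom T x = Cod T y\<rbrakk> \<Longrightarrow> killed P (x \<bullet> y)"
  unfolding killed_def using kills_comp_right by blast

lemma killed_comp_left:
  "\<lbrakk>killed P x; x \<in> Mor T; y \<in> Mor T; Dom T y = Cod T x\<rbrakk> \<Longrightarrow> killed P (y \<bullet> x)"
  unfolding killed_def using kills_comp_left by blast

lemma killed_susp_pow: "x \<in> Mor T \<Longrightarrow> killed P (susp_powM T i x) \<longleftrightarrow> killed P x"
  unfolding killed_def using kills_susp_pow by blast

lemma killed_phi:
  assumes "P \<in> Spec R" "s \<in> grade R n - P" "x \<in> Mor T" "killed P (\<phi> n s (Cod T x) \<bullet> x)"
  shows "killed P x"
  using assms kills_mult R.Spec_mult_notin unfolding killed_def by (metis DiffD1)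

text \<open>Since \<open>P\<close> is prime, a product of denominators is a denominator, and it
  kills whatever one of its factors kills, on whichever side that factor stands.\<close>

lemma killed_common:
  assumes P: "P \<in> Spec R" and "finite A" "\<And>x. x \<in> A \<Longrightarrow> x \<in> Mor T \<and> killed P x"
  shows "\<exists>n. \<exists>s\<in>grade R n - P. \<forall>x\<in>A. kills n s x"
  using assms(2,3)
proof (induction A rule: finite_induct)
  case empty
  then show ?case using R.grade_one R.Spec_props(4)[OF P] by blast
next
  case (insert x A)
  obtain n s where s: "s \<in> grade R n - P" "\<forall>x\<in>A. kills n s x" using insert by blast
  obtain m r where r: "r \<in> grade R m - P" "kills m r x" using insert.prems unfolding killed_def by blast
  have "kills (n + m) (s \<otimes>\<^bsub>R\<^esub> r) y" if "y \<in> insert x A" for y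
  proof (cases "y = x")
    case True
    then show ?thesis using kills_mult_left[of m r x s n] s r insert.prems[of x] by simp
  next
    case False
    then show ?thesis using kills_mult_right[of n s y r m] s r insert.prems[of y] that by simp
  qed
  moreover have "s \<otimes>\<^bsub>R\<^esub> r \<in> grade R (n + m) - P" using R.Spec_mult_notin[OF P s(1) r(1)] .
  ultimately show ?case by blast
qed

lemma killed_Plus:
  assumes P: "P \<in> Spec R" and "killed P x" "killed P y" "x \<in> Mor T" "y \<in> Mor T" "Dom T x = Dom T y" "Cod T x = Cod T y"
  shows "killed P (Plus T x y)"
proof -
  have "\<exists>n. \<exists>s\<in>grade R n - P. \<forall>z\<in>{x, y}. kills n s z" by (rule killed_common[OF P]) (use assms in auto)
  then obtain n s where "s \<in> grade R n - P" "kills n s x" "kills n s y" by auto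
  then show ?thesis unfolding killed_def using kills_Plus assms by blast
qed

text \<open>For \<open>\<C>\<close> closed under shifts, the condition says
  \<open>Hom\<^sup>*(C, X)\<^sub>P = 0\<close> for all \<open>C \<in> \<C>\<close>. Torsion objects
  arise from \<open>\<C> = compacts\<close>, vanishing of \<open>Gamma\<close> from the compact
  objects that are torsion for \<open>VV R P\<close>.\<close>

definition tor_class :: "'r set \<Rightarrow> 'o set \<Rightarrow> 'o set" where
  "tor_class P \<C> = {X \<in> Ob T. \<forall>C\<in>\<C>. \<forall>x\<in>Hom T C X. killed P x}"

lemma tor_class_susp:
  assumes "X \<in> tor_class P \<C>" "\<C> \<subseteq> Ob T" "\<And>C n. C \<in> \<C> \<Longrightarrow> susp_pow T n C \<in> \<C>"
  shows "susp_pow T n X \<in> tor_class P \<C>"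
proof -
  have X [simp]: "X \<in> Ob T" using assms(1) unfolding tor_class_def by blast
  have "killed P x" if C: "C \<in> \<C>" and x: "x \<in> Hom T C (susp_pow T n X)" for C x
  proof -
    have "susp_powM T (-n) x \<in> Hom T (susp_pow T (-n) C) X" using x by simp
    then have "killed P (susp_powM T (-n) x)" using assms(1,3) C unfolding tor_class_def by blast
    then show ?thesis using x by (simp add: killed_susp_pow)
  qed
  then show ?thesis unfolding tor_class_def by simp
qed

text \<open>Exactness of localization, done with elements. For a cone, some \<open>s\<close> kills
  \<open>w \<bullet> x\<close>, so \<open>s x\<close> lifts along a shift of \<open>v\<close> to a
  killed \<open>y\<close>; a further denominator kills \<open>s x\<close>, hence \<open>x\<close> is
  killed. For a coproduct, compactness of \<open>C\<close> makes \<open>x\<close> a finite sum of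
  killed components.\<close>

lemma tor_class_localizing:
  assumes P: "P \<in> Spec R" and \<C>: "\<C> \<subseteq> compacts" "\<And>C n. C \<in> \<C> \<Longrightarrow> susp_pow T n C \<in> \<C>"
  shows "localizing (tor_class P \<C>)"
proof -
  have \<C>O: "\<C> \<subseteq> Ob T" using \<C>(1) compact_Ob by blast
  obtain N where N: "is_zero T N" using zero_object by blast
  have "killed P x" if "x \<in> Hom T C N" for C x
    using is_zeroD[OF N that] killed_Zer[OF P] Hom_Ob[OF that] by metis
  then have "N \<in> tor_class P \<C>" unfolding tor_class_def using is_zero_Ob[OF N] by blast
  moreover have "X \<in> tor_class P \<C> \<longleftrightarrow> Susp T X \<in> tor_class P \<C>" if "X \<in> Ob T" for X
    using tor_class_susp[OF _ \<C>O \<C>(2), of X P 1] tor_class_susp[OF _ \<C>O \<C>(2), of "Susp T X" P "-1"] that by auto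
  moreover have "Cod T v \<in> tor_class P \<C>"
    if t: "(u, v, w) \<in> Tri T" and u: "Dom T u \<in> tor_class P \<C>" "Cod T u \<in> tor_class P \<C>" for u v w
  proof -
    note [simp] = tri_simps[OF t]
    have "killed P x" if C: "C \<in> \<C>" and x: "x \<in> Hom T C (Cod T v)" for C x
    proof -
      note [simp] = HomD[OF x]
      have "Susp T (Dom T u) \<in> tor_class P \<C>" using tor_class_susp[OF u(1) \<C>O \<C>(2), of 1] by simp
      moreover have "w \<bullet> x \<in> Hom T C (Susp T (Dom T u))" by simp
      ultimately have "killed P (w \<bullet> x)" using C unfolding tor_class_def by blast
      then obtain n s where s: "s \<in> grade R n - P" "kills n s (w \<bullet> x)" unfolding killed_def by blast
      then have [simp]: "s \<in> grade R n" by simp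
      have "susp_powM T n w \<bullet> (\<phi> n s (Cod T v) \<bullet> x) = (susp_powM T n w \<bullet> \<phi> n s (Cod T v)) \<bullet> x" by simp
      also have "\<dots> = Zer T C (susp_pow T n (Susp T (Dom T u)))"
        using s(2) unfolding kills_def phi_nat[of s n w "Cod T v" "Susp T (Dom T u)", simplified]
        by simp
      finally obtain y where y: "y \<in> Hom T C (susp_pow T n (Cod T u))"
        "\<phi> n s (Cod T v) \<bullet> x = susp_powM T n v \<bullet> y"
        using tri_lift_pow[OF tri_rot[OF t], of "\<phi> n s (Cod T v) \<bullet> x" C n] by auto
      have "susp_pow T n (Cod T u) \<in> tor_class P \<C>" using tor_class_susp[OF u(2) \<C>O \<C>(2)] .
      then have "killed P y" using y(1) C unfolding tor_class_def by blast
      then have "killed P (\<phi> n s (Cod T x) \<bullet> x)" using y by (simp add: killed_comp_left)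
      then show ?thesis using killed_phi[OF P s(1), of x] by simp
    qed
    then show ?thesis unfolding tor_class_def by simp
  qed
  ultimately have "triangulated_subcategory T (tor_class P \<C>)"
    unfolding triangulated_subcategory_def tor_class_def by blast
  moreover have "Q \<in> tor_class P \<C>"
    if small: "small U I" and X: "X \<in> I \<rightarrow> tor_class P \<C>" and cop: "is_coproduct T I X Q \<iota>"
    for I :: "'u set" and X Q \<iota>
  proof -
    interpret coproduct T I X Q \<iota> using cop by unfold_locales
    have "killed P x" if C: "C \<in> \<C>" and x: "x \<in> Hom T C Q" for C x
    proof -
      note [simp] = HomD[OF x]
      obtain F where F: "finite F" "F \<subseteq> I" "cut I Q \<iota> F \<bullet> x = x"
        using compact_cut[OF _ cop small x] C \<C>(1) by blast
      have FI [simp]: "i \<in> F \<Longrightarrow> i \<in> I" for i using F(2) by blast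
      have "Ident T Q \<bullet> (cut I Q \<iota> F \<bullet> x) \<in> {z \<in> Hom T C Q. killed P z}"
      proof (rule cut_induct[OF F(1,2) x])
        fix i assume i: "i \<in> F"
        have "pr i \<bullet> x \<in> Hom T C (X i)" using i by simp
        moreover have "X i \<in> tor_class P \<C>" using X FI[OF i] by blast
        ultimately have "killed P (pr i \<bullet> x)" using C unfolding tor_class_def by blast
        then have "killed P (\<iota> i \<bullet> (pr i \<bullet> x))" using i by (simp add: killed_comp_left)
        then show "Ident T Q \<bullet> (\<iota> i \<bullet> (pr i \<bullet> x)) \<in> {z \<in> Hom T C Q. killed P z}" using i by simp
      next
        show "Zer T C Q \<in> {z \<in> Hom T C Q. killed P z}" using killed_Zer[OF P, of C Q] by simp
      next
        fix a b assume "a \<in> {z \<in> Hom T C Q. killed P z}" "b \<in> {z \<in> Hom T C Q. killed P z}"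
        then show "Plus T a b \<in> {z \<in> Hom T C Q. killed P z}" using killed_Plus[OF P, of a b] by simp
      qed simp
      then show ?thesis using F(3) by simp
    qed
    then show ?thesis unfolding tor_class_def by simp
  qed
  ultimately show ?thesis unfolding localizing_subcategory_def by blast
qed

section \<open>Graded localization of the morphism modules\<close>

lemma hom_star_carrier:
  assumes [simp]: "C \<in> Ob T" "X \<in> Ob T"
  shows "carrier (hom_star R T \<phi> C X) =
    {f. (\<forall>i. f i \<in> Hom T C (susp_pow T i X)) \<and> finite {i. f i \<noteq> Zer T C (susp_pow T i X)}}"
proof -
  have "Group.group (add_monoid (hom_group T C (susp_pow T i X)))" for i
    by (rule abelian_group.a_group[OF hom_abelian_group]) simp_all
  then show ?thesis
    unfolding hom_star_def hom_star_group_def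
    using carrier_sum_group[of UNIV "\<lambda>i. add_monoid (hom_group T C (susp_pow T i X))"]
    by (simp add: PiE_iff del: Hom_iff)
qed

lemma hom_star_smult:
  assumes C [simp]: "C \<in> Ob T" "X \<in> Ob T" and s [simp]: "s \<in> grade R n" and "s \<noteq> \<zero>\<^bsub>R\<^esub>"
    and f: "f \<in> carrier (hom_star R T \<phi> C X)"
  shows "smult (hom_star R T \<phi> C X) s f k = susp_powM T (k - n) (\<phi> n s X) \<bullet> f (k - n)"
proof -
  have fk: "f k \<in> Hom T C (susp_pow T k X)" for k using f unfolding hom_star_carrier[OF C] by blast
  interpret abelian_group "hom_group T C (susp_pow T k X)" by (rule hom_abelian_group) simp_all
  have e: "{m. hcomp R s m \<noteq> \<zero>\<^bsub>R\<^esub>} = {n}" using assms(4) by (auto simp: R.hcomp_homogeneous[OF s])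
  show ?thesis
    unfolding hom_star_def using fk[of "k - n"]
    by (simp add: e finsum_insert) (simp add: R.hcomp_homogeneous[OF s])
qed

lemma hom_star_smult_zero_iff:
  assumes C [simp]: "C \<in> Ob T" "X \<in> Ob T" and s [simp]: "s \<in> grade R n" and "s \<noteq> \<zero>\<^bsub>R\<^esub>"
    and f: "f \<in> carrier (hom_star R T \<phi> C X)"
  shows "smult (hom_star R T \<phi> C X) s f = zero (hom_star R T \<phi> C X) \<longleftrightarrow> (\<forall>k. kills n s (f k))"
proof -
  have [simp]: "f k \<in> Mor T" "Dom T (f k) = C" "Cod T (f k) = susp_pow T k X" for k
    using f unfolding hom_star_carrier[OF C] by auto
  have z: "zero (hom_star R T \<phi> C X) = (\<lambda>k. Zer T C (susp_pow T k X))"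
    unfolding hom_star_def hom_star_group_def by (simp add: restrict_def)
  have "smult (hom_star R T \<phi> C X) s f (k + n) = Zer T C (susp_pow T (k + n) X) \<longleftrightarrow> kills n s (f k)" for k
    using phi_susp_pow[of s n X k] unfolding hom_star_smult[OF assms] kills_def
    by (auto simp: add.commute)
  moreover have "(\<forall>k. A (k + n)) \<longleftrightarrow> (\<forall>k :: int. A k)" for A by (metis diff_add_cancel)
  from this[of "\<lambda>k. smult (hom_star R T \<phi> C X) s f k = Zer T C (susp_pow T k X)"]
  have "(\<forall>k. smult (hom_star R T \<phi> C X) s f k = Zer T C (susp_pow T k X)) \<longleftrightarrow>
      (\<forall>k. smult (hom_star R T \<phi> C X) s f (k + n) = Zer T C (susp_pow T (k + n) X))" by blast
  ultimately show ?thesis unfolding z fun_eq_iff by simp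
qed

lemma loc_rel_iff:
  "((x, s), (y, t)) \<in> loc_rel R M P \<longleftrightarrow> x \<in> carrier M \<and> s \<in> loc_denominators R P \<and>
    y \<in> carrier M \<and> t \<in> loc_denominators R P \<and>
    (\<exists>a\<in>loc_denominators R P. \<exists>b\<in>loc_denominators R P.
        a \<otimes>\<^bsub>R\<^esub> s = b \<otimes>\<^bsub>R\<^esub> t \<and> a \<odot>\<^bsub>M\<^esub> x = b \<odot>\<^bsub>M\<^esub> y)"
  unfolding loc_rel_def by simp

text \<open>An element of \<open>Hom\<^sup>*(C, X)\<close> has finitely many nonzero components, so
  denominators for them multiply to a single one. If all morphisms are killed, any two fractions
  become related and the quotient is one class; conversely a morphism is tested as an element
  concentrated in one degree.\<close>

lemma localization_trivial_iff:
  assumes C [simp]: "C \<in> Ob T" "X \<in> Ob T" and P: "P \<in> Spec R"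
  shows "localization R (hom_star R T \<phi> C X) P = {localization_zero R (hom_star R T \<phi> C X) P} \<longleftrightarrow>
    (\<forall>n. \<forall>x\<in>Hom T C (susp_pow T n X). killed P x)"
proof -
  let ?M = "hom_star R T \<phi> C X" and ?D = "loc_denominators R P"
  have one: "\<one>\<^bsub>R\<^esub> \<in> ?D" unfolding loc_denominators_def using R.grade_one R.Spec_props(4)[OF P] by blast
  have zP: "\<zero>\<^bsub>R\<^esub> \<in> P" using additive_subgroup.zero_closed[OF ideal.axioms(1)[OF R.Spec_props(1)[OF P]]] .
  have DR: "s \<in> ?D \<Longrightarrow> s \<in> carrier R" for s unfolding loc_denominators_def using R.grade_carrier by blast
  have M0: "zero ?M = (\<lambda>k. Zer T C (susp_pow T k X))"
    unfolding hom_star_def hom_star_group_def by (simp add: restrict_def)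
  have zM: "zero ?M \<in> carrier ?M" unfolding hom_star_carrier[OF C] M0 by simp
  show ?thesis
  proof
    assume loc: "localization R ?M P = {localization_zero R ?M P}"
    show "\<forall>n. \<forall>x\<in>Hom T C (susp_pow T n X). killed P x"
    proof (intro allI ballI)
      fix n x assume x: "x \<in> Hom T C (susp_pow T n X)"
      define f where "f = (\<lambda>k. if k = n then x else Zer T C (susp_pow T k X))"
      have fM: "f \<in> carrier ?M"
        unfolding hom_star_carrier[OF C] using x
        by (auto simp: f_def intro: finite_subset[of _ "{n}"])
      have "loc_rel R ?M P `` {(f, \<one>\<^bsub>R\<^esub>)} \<in> localization R ?M P"
        unfolding localization_def quotient_def using fM one by blast
      then have "loc_rel R ?M P `` {(f, \<one>\<^bsub>R\<^esub>)} = loc_rel R ?M P `` {(zero ?M, \<one>\<^bsub>R\<^esub>)}"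
        unfolding loc localization_zero_def by (rule singletonD)
      moreover have "((f, \<one>\<^bsub>R\<^esub>), (f, \<one>\<^bsub>R\<^esub>)) \<in> loc_rel R ?M P"
        unfolding loc_rel_iff using fM one by blast
      ultimately have "((zero ?M, \<one>\<^bsub>R\<^esub>), (f, \<one>\<^bsub>R\<^esub>)) \<in> loc_rel R ?M P" by blast
      then obtain a b where ab: "a \<in> ?D" "b \<in> ?D" "a \<otimes>\<^bsub>R\<^esub> \<one>\<^bsub>R\<^esub> = b \<otimes>\<^bsub>R\<^esub> \<one>\<^bsub>R\<^esub>"
        "smult ?M a (zero ?M) = smult ?M b f" unfolding loc_rel_iff by blast
      then have [simp]: "a = b" using DR by simp
      obtain m where b: "b \<in> grade R m" "b \<notin> P" "b \<noteq> \<zero>\<^bsub>R\<^esub>"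
        using ab(2) zP unfolding loc_denominators_def by blast
      have "smult ?M b (zero ?M) = zero ?M"
        unfolding hom_star_smult_zero_iff[OF C b(1,3) zM] using b(1) by (simp add: M0 kills_Zer)
      then have "smult ?M b f = zero ?M" using ab(4) by simp
      then have "kills m b (f n)" using hom_star_smult_zero_iff[OF C b(1,3) fM] by blast
      then show "killed P x" unfolding killed_def using b by (auto simp: f_def)
    qed
  next
    assume kill: "\<forall>n. \<forall>x\<in>Hom T C (susp_pow T n X). killed P x"
    have rel: "((f, s), (g, t)) \<in> loc_rel R ?M P"
      if f: "f \<in> carrier ?M" and g: "g \<in> carrier ?M" and s: "s \<in> ?D" and t: "t \<in> ?D" for f g s t
    proof -
      let ?A = "\<lambda>f. f ` {i. f i \<noteq> Zer T C (susp_pow T i X)}"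
      have fh: "\<And>i. f i \<in> Hom T C (susp_pow T i X)" and gh: "\<And>i. g i \<in> Hom T C (susp_pow T i X)"
        and fin: "finite (?A f \<union> ?A g)"
        using f g unfolding hom_star_carrier[OF C] by blast+
      have "z \<in> Mor T \<and> killed P z" if z: "z \<in> ?A f \<union> ?A g" for z
      proof -
        from z obtain i where "z \<in> Hom T C (susp_pow T i X)" using fh gh by blast
        then show ?thesis using kill by auto
      qed
      from killed_common[OF P fin this] obtain l c where c: "c \<in> grade R l - P"
        "\<forall>x\<in>?A f \<union> ?A g. kills l c x" by blast
      have cf: "kills l c (f i)" "kills l c (g i)" for i
      proof -
        have "kills l c (Zer T C (susp_pow T i X))" using c(1) by (intro kills_Zer) simp_all
        then show "kills l c (f i)" "kills l c (g i)"
          using c(2) by (cases "f i = Zer T C (susp_pow T i X)"; cases "g i = Zer T C (susp_pow T i X)"; auto)+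
      qed
      obtain m n where sm: "s \<in> grade R m - P" and tn: "t \<in> grade R n - P"
        using s t unfolding loc_denominators_def by blast
      \<comment> \<open>\<open>s'\<close> is \<open>s\<close> with the sign of graded commutation,
        so that \<open>t s = s' t\<close>; multiplying by the common annihilator \<open>c\<close>
        gives the common denominator \<open>(c t) s = (c s') t\<close>.\<close>
      define s' where "s' = (if even (n * m) then s else \<ominus>\<^bsub>R\<^esub> s)"
      have carr: "s \<in> carrier R" "t \<in> carrier R" "c \<in> carrier R" using sm tn c(1) R.grade_carrier by blast+
      have "\<ominus>\<^bsub>R\<^esub> s \<in> P \<Longrightarrow> s \<in> P"
        using additive_subgroup.a_inv_closed[OF ideal.axioms(1)[OF R.Spec_props(1)[OF P]]] carr(1)
        by (metis R.minus_minus)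
      then have s'm: "s' \<in> grade R m - P" using sm R.grade_minus unfolding s'_def by auto
      have ts: "t \<otimes>\<^bsub>R\<^esub> s = s' \<otimes>\<^bsub>R\<^esub> t"
        using R.graded_comm[of t n s m] sm tn carr unfolding s'_def by (auto simp: R.l_minus)
      let ?a = "c \<otimes>\<^bsub>R\<^esub> t" and ?b = "c \<otimes>\<^bsub>R\<^esub> s'"
      have a: "?a \<in> grade R (l + n) - P" and b: "?b \<in> grade R (l + m) - P"
        using R.Spec_mult_notin[OF P c(1)] tn s'm by blast+
      have "?a \<otimes>\<^bsub>R\<^esub> s = ?b \<otimes>\<^bsub>R\<^esub> t"
        using carr R.grade_carrier[of s' m] s'm ts by (simp add: R.m_assoc)
      moreover have "smult ?M ?a f = zero ?M"
      proof (subst hom_star_smult_zero_iff[OF C _ _ f])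
        show "\<forall>k. kills (l + n) ?a (f k)" using kills_mult_right[OF cf(1)] c(1) tn fh by auto
      qed (use a zP in auto)
      moreover have "smult ?M ?b g = zero ?M"
      proof (subst hom_star_smult_zero_iff[OF C _ _ g])
        show "\<forall>k. kills (l + m) ?b (g k)" using kills_mult_right[OF cf(2)] c(1) s'm gh by auto
      qed (use b zP in auto)
      ultimately have "\<exists>a\<in>?D. \<exists>b\<in>?D. a \<otimes>\<^bsub>R\<^esub> s = b \<otimes>\<^bsub>R\<^esub> t \<and> smult ?M a f = smult ?M b g"
        using a b unfolding loc_denominators_def by (intro bexI[of _ ?a] bexI[of _ ?b]) auto
      then show ?thesis unfolding loc_rel_iff using f g s t by blast
    qed
    have "loc_rel R ?M P `` {z} = carrier ?M \<times> ?D" if "z \<in> carrier ?M \<times> ?D" for z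
      using that rel unfolding loc_rel_def by auto
    then show "localization R ?M P = {localization_zero R ?M P}"
      unfolding localization_def localization_zero_def quotient_def using zM one by auto
  qed
qed

lemma torsion_objects_eq:
  assumes V: "V \<subseteq> Spec R"
  shows "torsion_objects U R T \<phi> V = Ob T \<inter> (\<Inter>P\<in>Spec R - V. tor_class P compacts)"
proof -
  have "(\<forall>C\<in>compacts. localization R (hom_star R T \<phi> C X) P = {localization_zero R (hom_star R T \<phi> C X) P})
      \<longleftrightarrow> X \<in> tor_class P compacts" if X [simp]: "X \<in> Ob T" and P: "P \<in> Spec R" for X P
  proof -
    have "(\<forall>C\<in>compacts. \<forall>n. \<forall>x\<in>Hom T C (susp_pow T n X). killed P x) \<longleftrightarrow> X \<in> tor_class P compacts"
    proof
      assume a: "\<forall>C\<in>compacts. \<forall>n. \<forall>x\<in>Hom T C (susp_pow T n X). killed P x"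
      have "killed P x" if "C \<in> compacts" "x \<in> Hom T C X" for C x
        using a that susp_pow_0[of X] by metis
      then show "X \<in> tor_class P compacts" unfolding tor_class_def using X by blast
    next
      assume "X \<in> tor_class P compacts"
      then have "susp_pow T n X \<in> tor_class P compacts" for n
        by (rule tor_class_susp) (use compact_Ob compact_susp_pow in blast)+
      then show "\<forall>C\<in>compacts. \<forall>n. \<forall>x\<in>Hom T C (susp_pow T n X). killed P x"
        unfolding tor_class_def by blast
    qed
    then show ?thesis by (simp add: localization_trivial_iff[OF compact_Ob X P] del: Hom_iff)
  qed
  note main = this
  show ?thesis
  proof (intro subset_antisym subsetI)
    fix X assume "X \<in> torsion_objects U R T \<phi> V"
    then have X: "X \<in> Ob T" and "\<And>P. P \<in> Spec R - V \<Longrightarrow> \<forall>C\<in>compacts.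
        localization R (hom_star R T \<phi> C X) P = {localization_zero R (hom_star R T \<phi> C X) P}"
      unfolding torsion_objects_def by auto
    then show "X \<in> Ob T \<inter> (\<Inter>P\<in>Spec R - V. tor_class P compacts)" using main[OF X] by simp
  next
    fix X assume X: "X \<in> Ob T \<inter> (\<Inter>P\<in>Spec R - V. tor_class P compacts)"
    then have XO: "X \<in> Ob T" by simp
    have "localization R (hom_star R T \<phi> C X) P = {localization_zero R (hom_star R T \<phi> C X) P}"
      if C: "C \<in> compacts" and P: "P \<in> Spec R - V" for C P
    proof -
      have "X \<in> tor_class P compacts" using X P by blast
      then have "\<forall>C\<in>compacts. localization R (hom_star R T \<phi> C X) P = {localization_zero R (hom_star R T \<phi> C X) P}"
        using main[OF XO, of P] P by simp
      then show ?thesis using C by (rule bspec)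
    qed
    then show "X \<in> torsion_objects U R T \<phi> V" unfolding torsion_objects_def using XO by simp
  qed
qed

end

locale noetherian_tricat = linear_tricat T U R \<phi>
  for T :: "('o, 'm, 'z) tricat_scheme" (structure) and U :: "'u itself" and R :: "('r, 'y) gring_scheme"
    and \<phi> :: "int \<Rightarrow> 'r \<Rightarrow> 'o \<Rightarrow> 'm" +
  assumes noeth: "noetherian_ring R" and R_small: "small U (carrier R)" and gen: "compactly_generated U T"
begin

section \<open>Supports of endomorphism rings\<close>

text \<open>The primes \<open>P\<close> with \<open>End\<^sup>*(X)\<^sub>P \<noteq> 0\<close>, and their intersection.\<close>

definition esupp :: "'o \<Rightarrow> 'r set set" where
  "esupp X = {P \<in> Spec R. \<not> killed P (Ident T X)}"

definition rad :: "'o \<Rightarrow> 'r set" where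
  "rad X = \<Inter>(insert (carrier R) (esupp X))"

text \<open>The inserted \<open>carrier R\<close> keeps the intersection an ideal when the support
  is empty.\<close>

lemma rad_ideal: "ideal (rad X) R"
  unfolding rad_def
proof (rule R.i_Intersect)
  show "ideal I R" if "I \<in> insert (carrier R) (esupp X)" for I
    using that R.oneideal R.Spec_props(1) unfolding esupp_def by auto
qed simp

lemma rad_mem: "r \<in> rad X \<longleftrightarrow> r \<in> carrier R \<and> (\<forall>P\<in>esupp X. r \<in> P)"
  unfolding rad_def by auto

text \<open>In a noetherian ring a chain of ideals contains its union, so Zorn's lemma applies. This
  is the induction principle behind both arguments with Koszul cones.\<close>

lemma rad_maximal:
  assumes "\<A> \<noteq> {}" shows "\<exists>C\<in>\<A>. \<forall>D\<in>\<A>. rad C \<subseteq> rad D \<longrightarrow> rad D = rad C"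
proof -
  have "\<exists>M\<in>rad ` \<A>. \<forall>X\<in>rad ` \<A>. M \<subseteq> X \<longrightarrow> X = M"
  proof (rule subset_Zorn_nonempty)
    fix \<C> assume c: "\<C> \<noteq> {}" "subset.chain (rad ` \<A>) \<C>"
    then have "subset.chain {I. ideal I R} \<C>"
      using rad_ideal unfolding pred_on.chain_def by blast
    then have "\<Union>\<C> \<in> \<C>" using noetherian_ring.ideal_chain_is_trivial[OF noeth c(1)] by blast
    then show "\<Union>\<C> \<in> rad ` \<A>" using c(2) unfolding pred_on.chain_def by blast
  qed (use assms in simp)
  then show ?thesis by blast
qed

lemma killed_of_Ident_Dom: "\<lbrakk>killed P (Ident T X); x \<in> Mor T; Dom T x = X\<rbrakk> \<Longrightarrow> killed P x"
  using killed_comp_left[of P "Ident T X" x] Dom_Ob[of x] by auto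

lemma killed_of_Ident_Cod: "\<lbrakk>killed P (Ident T X); x \<in> Mor T; Cod T x = X\<rbrakk> \<Longrightarrow> killed P x"
  using killed_comp_right[of P "Ident T X" x] Cod_Ob[of x] by auto

lemma killed_Ident_susp_pow: "X \<in> Ob T \<Longrightarrow> killed P (Ident T (susp_pow T n X)) \<longleftrightarrow> killed P (Ident T X)"
  using killed_susp_pow[of "Ident T X" P n] by simp

lemma esupp_susp_pow: "X \<in> Ob T \<Longrightarrow> esupp (susp_pow T n X) = esupp X"
  unfolding esupp_def by (simp add: killed_Ident_susp_pow)

text \<open>If \<open>s\<close> kills \<open>w\<close>, then multiplication by \<open>s\<close> on
  the third object factors through a suspension of \<open>v\<close>, so it is killed together with
  \<open>v\<close>.\<close>

lemma killed_Ident_tri: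
  assumes P: "P \<in> Spec R" and t: "(u, v, w) \<in> Tri T" and v: "killed P v" and w: "killed P w"
  shows "killed P (Ident T (Cod T v))"
proof -
  note [simp] = tri_simps[OF t]
  let ?D = "Cod T v"
  obtain n s where s: "s \<in> grade R n - P" "kills n s w" using w unfolding killed_def by blast
  then have [simp]: "s \<in> grade R n" by simp
  have "susp_powM T n w \<bullet> \<phi> n s ?D = Zer T ?D (susp_pow T n (Cod T w))"
    using kills_alt[of s n w] s(2) by simp
  then obtain y where y: "y \<in> Hom T ?D (susp_pow T n (Cod T u))" "\<phi> n s ?D = susp_powM T n v \<bullet> y"
    using tri_lift_pow[OF tri_rot[OF t], of "\<phi> n s ?D" ?D n] by auto
  have "killed P (susp_powM T n v)" using v by (simp add: killed_susp_pow)
  then have "killed P (susp_powM T n v \<bullet> y)" using y(1) by (simp add: killed_comp_right)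
  then have "killed P (\<phi> n s (Cod T (Ident T ?D)) \<bullet> Ident T ?D)" by (simp flip: y(2))
  then show ?thesis using killed_phi[OF P s(1), of "Ident T ?D"] by simp
qed

text \<open>Consecutive maps of a triangle compose to zero; up to sign, shift and naturality these
  composites are \<open>s\<close> times \<open>v\<close> and \<open>s\<close> times
  \<open>w\<close>.\<close>

lemma kills_cone:
  assumes s [simp]: "s \<in> grade R n" and C [simp]: "C \<in> Ob T" and t: "(\<phi> n s C, v, w) \<in> Tri T"
  shows "kills n s v" "kills n s w"
proof -
  note [simp] = tri_simps[OF t, simplified]
  have "susp_powM T n v \<bullet> susp_powM T n (\<phi> n s C) = susp_powM T n (v \<bullet> \<phi> n s C)"
    by (simp add: susp_powM_comp)
  also have "\<dots> = Zer T (susp_pow T n C) (susp_pow T n (Cod T v))"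
    unfolding tri_comp_zero[OF t] by simp
  finally show "kills n s v"
    using phi_susp_pow[of s n C n] kills_alt[of s n v] by auto
  show "kills n s w"
    using tri_comp_zero3[OF t] phi_susp_pow[of s n C 1] unfolding kills_def by (auto simp: add.commute)
qed

text \<open>The cone is the Koszul object of \<open>s\<close> on \<open>C\<close>. If
  \<open>s \<notin> P\<close>, then \<open>s\<close> kills \<open>v\<close> and \<open>w\<close>; if
  the identity of \<open>C\<close> is killed at \<open>P\<close>, they are killed since they start
  or end at shifts of \<open>C\<close>. In both cases \<open>killed_Ident_tri\<close>
  applies.\<close>

lemma esupp_cone:
  assumes s [simp]: "s \<in> grade R n" and C [simp]: "C \<in> Ob T" and t: "(\<phi> n s C, v, w) \<in> Tri T"
  shows "esupp (Cod T v) \<subseteq> {P \<in> esupp C. s \<in> P}"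
proof
  note [simp] = tri_simps[OF t, simplified]
  fix P assume P: "P \<in> esupp (Cod T v)"
  then have PS: "P \<in> Spec R" and nk: "\<not> killed P (Ident T (Cod T v))" unfolding esupp_def by auto
  have "s \<in> P"
  proof (rule ccontr)
    assume "s \<notin> P"
    then have "killed P v" "killed P w" using kills_cone[OF assms] s unfolding killed_def by blast+
    then show False using killed_Ident_tri[OF PS t] nk by blast
  qed
  moreover have "\<not> killed P (Ident T C)"
  proof
    assume k: "killed P (Ident T C)"
    then have "killed P v" using killed_of_Ident_Dom[of P "susp_pow T n C" v] by (simp add: killed_Ident_susp_pow)
    moreover have "killed P w" using k killed_of_Ident_Cod[of P "susp_pow T 1 C" w] killed_Ident_susp_pow[of C P 1] by simp
    ultimately show False using killed_Ident_tri[OF PS t] nk by blast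
  qed
  ultimately show "P \<in> {P \<in> esupp C. s \<in> P}" using PS unfolding esupp_def by simp
qed

lemma compact_cone_phi:
  assumes s: "s \<in> grade R n" and C: "C \<in> compacts" and t: "(\<phi> n s C, v, w) \<in> Tri T"
  shows "Cod T v \<in> compacts"
  by (rule compact_cone[OF t]) (use s C compact_Ob[OF C] compact_susp_pow[OF C] in simp_all)

section \<open>Torsion objects\<close>

abbreviation "torsion V \<equiv> torsion_objects U R T \<phi> V"

lemma torsion_localizing:
  assumes "V \<subseteq> Spec R" shows "localizing (torsion V)"
proof -
  have "torsion V = \<Inter>(insert (Ob T) ((\<lambda>P. tor_class P compacts) ` (Spec R - V)))"
    unfolding torsion_objects_eq[OF assms] by simp
  moreover have "localizing S" if S: "S \<in> insert (Ob T) ((\<lambda>P. tor_class P compacts) ` (Spec R - V))" for S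
  proof (cases "S = Ob T")
    case False
    then obtain P where "P \<in> Spec R" "S = tor_class P compacts" using S by blast
    then show ?thesis using tor_class_localizing[OF _ subset_refl compact_susp_pow] by blast
  qed (use localizing_Ob in simp)
  ultimately show ?thesis using localizing_Inter[of _ U] by (metis insert_not_empty)
qed

lemma torsion_Ob: "V \<subseteq> Spec R \<Longrightarrow> X \<in> torsion V \<Longrightarrow> X \<in> Ob T"
  using torsion_objects_eq by blast

lemma torsion_susp_pow: "\<lbrakk>V \<subseteq> Spec R; X \<in> torsion V\<rbrakk> \<Longrightarrow> susp_pow T n X \<in> torsion V"
  using triangulated_sub.sub_susp_pow[OF localizing_triangulated_sub[OF torsion_localizing]] torsion_Ob by blast

lemma torsion_killed:
  "\<lbrakk>V \<subseteq> Spec R; X \<in> torsion V; C \<in> compacts; x \<in> Hom T C X; P \<in> Spec R; P \<notin> V\<rbrakk> \<Longrightarrow> killed P x"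
  unfolding torsion_objects_eq tor_class_def by blast

text \<open>For compact \<open>C\<close> the identity decides: it is one of the test morphisms, and
  every morphism into \<open>C\<close> factors through it.\<close>

lemma compact_torsion_iff:
  assumes V: "V \<subseteq> Spec R" and C: "C \<in> compacts"
  shows "C \<in> torsion V \<longleftrightarrow> esupp C \<subseteq> V"
proof
  assume t: "C \<in> torsion V"
  have i: "Ident T C \<in> Hom T C C" using compact_Ob[OF C] by simp
  show "esupp C \<subseteq> V" using torsion_killed[OF V t C i] unfolding esupp_def by blast
next
  assume e: "esupp C \<subseteq> V"
  have "C \<in> tor_class P compacts" if "P \<in> Spec R - V" for P
  proof -
    have "killed P (Ident T C)" using that e unfolding esupp_def by blast
    then show ?thesis unfolding tor_class_def using compact_Ob[OF C] killed_of_Ident_Cod[of P C] by simp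
  qed
  then show "C \<in> torsion V" unfolding torsion_objects_eq[OF V] using compact_Ob[OF C] by blast
qed

text \<open>Two demands are reconciled here: coproducts over all maps out of \<open>K\<close>
  require smallness, while the argument with maximal radicals requires stability under shifts and
  Koszul cones. By the last clause \<open>K\<close> detects zero objects.\<close>

definition koszul_family :: "'o set \<Rightarrow> bool" where
  "koszul_family K \<longleftrightarrow> small U K \<and> K \<subseteq> compacts \<and> (\<forall>C\<in>K. \<forall>n. susp_pow T n C \<in> K) \<and>
    (\<forall>C\<in>K. \<forall>n. \<forall>s\<in>grade R n. \<exists>v w. (\<phi> n s C, v, w) \<in> Tri T \<and> Cod T v \<in> K) \<and>
    (\<forall>X\<in>Ob T. (\<forall>C\<in>K. \<forall>f\<in>Hom T C X. f = Zer T C X) \<longrightarrow> is_zero T X)"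

text \<open>The shifts of a generating set are closed up by a countable iteration: an object of one
  stage has its cones in the next, and every stage stays small because \<open>R\<close> is
  small.\<close>

lemma koszul_family_exists: "\<exists>K. koszul_family K"
proof -
  obtain G where G: "small U G" "G \<subseteq> compacts" "Ob T = Loc U T G"
    using gen unfolding compactly_generated_def by blast
  define sh where "sh A = (\<Union>n. susp_pow T n ` A)" for A
  have small_sh: "small U (sh A)" if "small U A" for A
    unfolding sh_def by (rule small_shift_closure[OF that])
  have sh_sup: "A \<subseteq> sh A" for A unfolding sh_def by (rule subsetI) (auto intro!: exI[of _ 0] image_eqI)
  have sh_compact: "sh A \<subseteq> compacts" if "A \<subseteq> compacts" for A
    unfolding sh_def using that compact_susp_pow by blast
  have sh_closed: "susp_pow T n C \<in> sh A" if A: "A \<subseteq> compacts" and C: "C \<in> sh A" for A C n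
  proof -
    obtain m D where D: "D \<in> A" "C = susp_pow T m D" using C unfolding sh_def by blast
    then have "D \<in> Ob T" using A compact_Ob by blast
    then have "susp_pow T n C = susp_pow T (n + m) D" using D(2) by simp
    then show ?thesis using D(1) unfolding sh_def by blast
  qed
  have "\<exists>v w. (\<phi> n s C, v, w) \<in> Tri T" if "s \<in> grade R n" "C \<in> Ob T" for n s C
    using TR1_complete phi_hom(1)[OF that] by blast
  \<comment> \<open>A single cone is fixed for each element and object; the set of all cones is a
    whole isomorphism class, which need not be small.\<close>
  then have "\<forall>n s C. \<exists>v. s \<in> grade R n \<and> C \<in> Ob T \<longrightarrow> (\<exists>w. (\<phi> n s C, v, w) \<in> Tri T)" by blast
  then obtain vv where vv: "\<And>n s C. \<lbrakk>s \<in> grade R n; C \<in> Ob T\<rbrakk> \<Longrightarrow> \<exists>w. (\<phi> n s C, vv n s C, w) \<in> Tri T"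
    by metis
  define cones where "cones A = (\<Union>C\<in>A. \<Union>n. \<Union>s\<in>grade R n. {Cod T (vv n s C)})" for A
  have small1: "small U {a}" for a :: 'o by (rule small_countable[OF univ]) simp
  have small_cones: "small U (cones A)" if "small U A" for A
    unfolding cones_def
    by (intro small_UN[OF univ] that small1 small_countable[OF univ countableI_type]
        small_subset[OF R_small] subsetI R.grade_carrier)
  have cones_compact: "cones A \<subseteq> compacts" if "A \<subseteq> compacts" for A
  proof -
    have "Cod T (vv n s C) \<in> compacts" if CA: "C \<in> A" and s: "s \<in> grade R n" for C n s
    proof -
      have C: "C \<in> compacts" using CA \<open>A \<subseteq> compacts\<close> by blast
      obtain w where "(\<phi> n s C, vv n s C, w) \<in> Tri T" using vv[OF s compact_Ob[OF C]] by blast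
      from compact_cone_phi[OF s C this] show ?thesis .
    qed
    then show ?thesis unfolding cones_def by blast
  qed
  define K where "K = rec_nat (sh G) (\<lambda>_ A. sh (A \<union> cones A))"
  have K0: "K 0 = sh G" and KS: "K (Suc k) = sh (K k \<union> cones (K k))" for k by (simp_all add: K_def)
  have Ks: "small U (K k)" and Kc: "K k \<subseteq> compacts" for k
  proof (induction k)
    case 0
    { case 1 show ?case unfolding K0 by (rule small_sh[OF G(1)]) }
    { case 2 show ?case unfolding K0 by (rule sh_compact[OF G(2)]) }
  next
    case (Suc k)
    { case 1 show ?case unfolding KS by (intro small_sh small_Un[OF univ] small_cones Suc) }
    { case 2 show ?case unfolding KS by (intro sh_compact Un_least cones_compact Suc) }
  qed
  let ?K = "\<Union>k. K k"
  have k1: "small U ?K" by (rule small_UN[OF univ small_countable[OF univ countableI_type] Ks])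
  have k2: "?K \<subseteq> compacts" using Kc by blast
  have k3: "susp_pow T n C \<in> ?K" if C: "C \<in> ?K" for C n
  proof -
    obtain k where k: "C \<in> K k" using C by blast
    have "susp_pow T n C \<in> K k"
    proof (cases k)
      case 0
      then show ?thesis using k sh_closed[OF G(2)] K0 by simp
    next
      case (Suc j)
      have "K j \<union> cones (K j) \<subseteq> compacts" using Kc cones_compact by blast
      from sh_closed[OF this] show ?thesis using k unfolding Suc KS by blast
    qed
    then show ?thesis by blast
  qed
  have k4: "\<exists>v w. (\<phi> n s C, v, w) \<in> Tri T \<and> Cod T v \<in> ?K" if CK: "C \<in> ?K" and s: "s \<in> grade R n" for C n s
  proof -
    obtain k where k: "C \<in> K k" using CK by blast
    then have C: "C \<in> compacts" using Kc by blast
    obtain w where w: "(\<phi> n s C, vv n s C, w) \<in> Tri T" using vv[OF s compact_Ob[OF C]] by blast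
    have "Cod T (vv n s C) \<in> cones (K k)" unfolding cones_def using k s by blast
    then have "Cod T (vv n s C) \<in> K (Suc k)" unfolding KS using sh_sup by blast
    then show ?thesis using w by blast
  qed
  have k5: "is_zero T X" if X [simp]: "X \<in> Ob T" and z: "\<forall>C\<in>?K. \<forall>f\<in>Hom T C X. f = Zer T C X" for X
  proof -
    have GO: "sh G \<subseteq> Ob T" using sh_compact[OF G(2)] compact_Ob by blast
    have "Loc U T G \<subseteq> Loc U T (sh G)" by (rule Loc_mono[OF sh_sup])
    then have XL: "X \<in> Loc U T (sh G)" using G(3) X by blast
    have "f = Zer T C X" if "C \<in> sh G" "f \<in> Hom T C X" for C f
    proof -
      have "C \<in> K 0" using that(1) K0 by simp
      then show ?thesis using z that(2) by blast
    qed
    from Loc_perp[OF X GO sh_closed[OF G(2)] this XL, of "Ident T X"]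
    have "Ident T X = Zer T X X" by simp
    then show ?thesis by (simp add: is_zero_iff)
  qed
  have "koszul_family ?K" unfolding koszul_family_def
    by (intro conjI ballI allI impI; (rule k1 | rule k2 | ((rule k3 | rule k4 | rule k5); assumption)))
  then show ?thesis by blast
qed

text \<open>Among the compact objects mapping nontrivially to \<open>X\<close> one with maximal radical is itself torsion:
  otherwise passing to the cone of a homogeneous element outside the radical enlarges it.\<close>

lemma torsion_zero:
  assumes V: "V \<subseteq> Spec R" and K: "koszul_family K" and X: "X \<in> torsion V"
    and z: "\<And>C f. \<lbrakk>C \<in> K; C \<in> torsion V; f \<in> Hom T C X\<rbrakk> \<Longrightarrow> f = Zer T C X"
  shows "is_zero T X"
proof (rule ccontr)
  assume nz: "\<not> is_zero T X"
  have XO [simp]: "X \<in> Ob T" by (rule torsion_Ob[OF V X])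
  define \<A> where "\<A> = {C \<in> K. \<exists>f\<in>Hom T C X. f \<noteq> Zer T C X}"
  have "\<A> \<noteq> {}" using nz XO K unfolding koszul_family_def \<A>_def by blast
  from rad_maximal[OF this] obtain C where CA: "C \<in> \<A>"
    and max: "\<And>D. \<lbrakk>D \<in> \<A>; rad C \<subseteq> rad D\<rbrakk> \<Longrightarrow> rad D = rad C" by blast
  then obtain f where CK: "C \<in> K" and f: "f \<in> Hom T C X" and fz: "f \<noteq> Zer T C X" unfolding \<A>_def by blast
  have Cc: "C \<in> compacts" using CK K unfolding koszul_family_def by blast
  note [simp] = compact_Ob[OF Cc]
  note [simp] = HomD[OF f]
  have "C \<notin> torsion V" using z[OF CK _ f] fz by blast
  then obtain P where P: "P \<in> esupp C" "P \<notin> V" using compact_torsion_iff[OF V Cc] by blast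
  then have PS: "P \<in> Spec R" unfolding esupp_def by blast
  have "killed P f" by (rule torsion_killed[OF V X Cc f PS P(2)])
  then obtain n s where s: "s \<in> grade R n" "s \<notin> P" "kills n s f" unfolding killed_def by blast
  note [simp] = s(1)
  obtain v w where t: "(\<phi> n s C, v, w) \<in> Tri T" and DK: "Cod T v \<in> K"
    using K CK s(1) unfolding koszul_family_def by blast
  note [simp] = tri_simps[OF t, simplified]
  let ?D = "Cod T v"
  have "susp_powM T n f \<bullet> \<phi> n s C = Zer T C (susp_pow T n X)" using kills_alt[of s n f] s(3) by simp
  then obtain g where g: "g \<in> Hom T ?D (susp_pow T n X)" "susp_powM T n f = g \<bullet> v"
    using tri_ext[OF t, of "susp_powM T n f" "susp_pow T n X"] by auto
  \<comment> \<open>\<open>g\<close> ends in a suspension of \<open>X\<close>; as \<open>K\<close>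
    is closed under shifts, desuspending yields a competitor of \<open>C\<close> in
    \<open>\<A>\<close>.\<close>
  let ?E = "susp_pow T (-n) ?D" and ?g = "susp_powM T (-n) g"
  have "g \<noteq> Zer T ?D (susp_pow T n X)"
  proof
    assume "g = Zer T ?D (susp_pow T n X)"
    then have "susp_powM T n f = susp_powM T n (Zer T C X)" using g(2) by simp
    then have "f = Zer T C X" by (rule susp_powM_inj) simp_all
    then show False using fz by simp
  qed
  then have "?g \<noteq> Zer T ?E X" using susp_powM_eq_Zer_iff[of g "-n"] g(1) by simp
  moreover have "?g \<in> Hom T ?E X" using g(1) by simp
  moreover have "?E \<in> K" using K DK unfolding koszul_family_def by blast
  ultimately have EA: "?E \<in> \<A>" unfolding \<A>_def by blast
  have es: "Q \<in> esupp C \<and> s \<in> Q" if "Q \<in> esupp ?E" for Q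
    using esupp_cone[OF s(1) _ t] that by (auto simp: esupp_susp_pow)
  then have "rad C \<subseteq> rad ?E" by (auto simp: rad_mem)
  then have "rad ?E = rad C" by (rule max[OF EA])
  moreover have "s \<in> rad ?E" using es R.grade_carrier[OF s(1)] by (auto simp: rad_mem)
  moreover have "s \<notin> rad C" using P(1) s(2) by (auto simp: rad_mem)
  ultimately show False by blast
qed

text \<open>In the approximation triangle of a torsion \<open>Z\<close> by
  \<open>K \<inter> torsion V\<close>, the third object is again torsion and receives no nonzero map
  from this set, so \<open>torsion_zero\<close> makes it vanish.\<close>

lemma torsion_generated:
  assumes V: "V \<subseteq> Spec R" and K: "koszul_family K" and Z: "Z \<in> torsion V"
  shows "Z \<in> Loc U T (K \<inter> torsion V)"
    and "\<And>X. X \<in> Ob T \<Longrightarrow> \<exists>u v w. (u, v, w) \<in> Tri T \<and> Cod T u = X \<and> Dom T u \<in> torsion V \<and>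
      (\<forall>g\<in>K \<inter> torsion V. \<forall>f\<in>Hom T g (Cod T v). f = Zer T g (Cod T v))"
proof -
  let ?G = "K \<inter> torsion V"
  have G: "small U ?G" "?G \<subseteq> compacts" "\<And>g n. g \<in> ?G \<Longrightarrow> susp_pow T n g \<in> ?G"
    using K small_subset[of U K ?G] torsion_susp_pow[OF V] unfolding koszul_family_def by blast+
  have GO: "?G \<subseteq> Ob T" using G(2) compact_Ob by blast
  have sub: "Loc U T ?G \<subseteq> torsion V" by (rule Loc_least[OF torsion_localizing[OF V]]) simp
  show ex: "\<exists>u v w. (u, v, w) \<in> Tri T \<and> Cod T u = X \<and> Dom T u \<in> torsion V \<and>
      (\<forall>g\<in>?G. \<forall>f\<in>Hom T g (Cod T v). f = Zer T g (Cod T v))" if "X \<in> Ob T" for X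
    using localization_triangle_exists[OF G that] sub by blast
  interpret L: triangulated_sub T "Loc U T ?G" by (rule localizing_triangulated_sub[OF Loc_localizing[OF GO]])
  interpret V: triangulated_sub T "torsion V" by (rule localizing_triangulated_sub[OF torsion_localizing[OF V]])
  obtain u v w where t: "(u, v, w) \<in> Tri T" "Cod T u = Z" "Dom T u \<in> Loc U T ?G"
    and z: "\<forall>g\<in>?G. \<forall>f\<in>Hom T g (Cod T v). f = Zer T g (Cod T v)"
    using localization_triangle_exists[OF G torsion_Ob[OF V Z]] by blast
  have "Cod T v \<in> torsion V" using V.sub_cone[OF t(1)] t(2,3) sub Z by blast
  then have "is_zero T (Cod T v)" by (rule torsion_zero[OF V K]) (use z in blast)
  then show "Z \<in> Loc U T ?G" using L.sub_mid[OF t(1) t(3)] L.sub_zero t(2) by blast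
qed

lemma torsion_perp:
  assumes V: "V \<subseteq> Spec R" and Y: "Y \<in> Ob T"
    and z: "\<And>C f. \<lbrakk>C \<in> compacts; C \<in> torsion V; f \<in> Hom T C Y\<rbrakk> \<Longrightarrow> f = Zer T C Y"
    and Z: "Z \<in> torsion V" and f: "f \<in> Hom T Z Y"
  shows "f = Zer T Z Y"
proof -
  obtain K where K: "koszul_family K" using koszul_family_exists by blast
  let ?G = "K \<inter> torsion V"
  have G: "?G \<subseteq> compacts" "\<And>g n. g \<in> ?G \<Longrightarrow> susp_pow T n g \<in> ?G"
    using K torsion_susp_pow[OF V] unfolding koszul_family_def by blast+
  have GO: "?G \<subseteq> Ob T" using G compact_Ob by blast
  show ?thesis
    by (rule Loc_perp[OF Y GO G(2) _ torsion_generated(1)[OF V K Z] f]) (use z G(1) in blast)+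
qed

section \<open>Local cohomology\<close>

text \<open>Orthogonality to the small set \<open>K \<inter> torsion V\<close> spreads to all
  torsion objects because the set generates them; the triangle picked by \<open>SOME\<close> then
  inherits the properties.\<close>

lemma localization_triangle:
  assumes V: "V \<subseteq> Spec R" and X: "X \<in> Ob T"
  shows "is_localization_triangle U R T \<phi> V X (localization_triangle U R T \<phi> V X)"
proof -
  obtain K where K: "koszul_family K" using koszul_family_exists by blast
  \<comment> \<open>\<open>torsion_generated\<close> expects some torsion object also for its second
    statement; the zero object serves.\<close>
  obtain N where "is_zero T N" using zero_object by blast
  then have N: "N \<in> torsion V"
    using triangulated_sub.sub_zero[OF localizing_triangulated_sub[OF torsion_localizing[OF V]]] by blast
  obtain u v w where t: "(u, v, w) \<in> Tri T" "Cod T u = X" "Dom T u \<in> torsion V"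
    and z: "\<forall>g\<in>K \<inter> torsion V. \<forall>f\<in>Hom T g (Cod T v). f = Zer T g (Cod T v)"
    using torsion_generated(2)[OF V K N X] by blast
  let ?G = "K \<inter> torsion V"
  have G: "?G \<subseteq> Ob T" "\<And>g n. g \<in> ?G \<Longrightarrow> susp_pow T n g \<in> ?G"
    using K torsion_susp_pow[OF V] torsion_Ob[OF V] unfolding koszul_family_def by blast+
  have "Hom T Z (Cod T v) = {Zer T Z (Cod T v)}" if Z: "Z \<in> torsion V" for Z
  proof -
    have L: "Cod T v \<in> Ob T" using tri_simps(2)[OF t(1)] by simp
    have "f = Zer T Z (Cod T v)" if "f \<in> Hom T Z (Cod T v)" for f
      by (rule Loc_perp[OF L G _ torsion_generated(1)[OF V K Z] that]) (use z in blast)+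
    moreover have "Zer T Z (Cod T v) \<in> Hom T Z (Cod T v)" using torsion_Ob[OF V Z] L by simp
    ultimately show ?thesis by blast
  qed
  then have "is_localization_triangle U R T \<phi> V X (u, v, w)"
    unfolding is_localization_triangle_def using t by simp
  then show ?thesis unfolding localization_triangle_def by (rule someI)
qed

lemma localization_props:
  assumes V: "V \<subseteq> Spec R" and X: "X \<in> Ob T"
  shows "\<exists>u v w. (u, v, w) \<in> Tri T \<and> Cod T u = X \<and> Dom T u = GammaV U R T \<phi> V X \<and>
      Cod T v = LV U R T \<phi> V X"
    and "GammaV U R T \<phi> V X \<in> torsion V" and "LV U R T \<phi> V X \<in> Ob T"
    and "\<And>Z f. \<lbrakk>Z \<in> torsion V; f \<in> Hom T Z (LV U R T \<phi> V X)\<rbrakk> \<Longrightarrow> f = Zer T Z (LV U R T \<phi> V X)"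
proof -
  obtain u v w where e: "localization_triangle U R T \<phi> V X = (u, v, w)" using prod_cases3 .
  have l: "(u, v, w) \<in> Tri T" "Cod T u = X" "Dom T u \<in> torsion V"
    "\<forall>Z\<in>torsion V. Hom T Z (Cod T v) = {Zer T Z (Cod T v)}"
    using localization_triangle[OF assms] unfolding e is_localization_triangle_def by auto
  have d: "GammaV U R T \<phi> V X = Dom T u" "LV U R T \<phi> V X = Cod T v"
    by (simp_all add: GammaV_def LV_def e)
  show "\<exists>u v w. (u, v, w) \<in> Tri T \<and> Cod T u = X \<and> Dom T u = GammaV U R T \<phi> V X \<and>
      Cod T v = LV U R T \<phi> V X"
    using l(1,2) d by metis
  show "GammaV U R T \<phi> V X \<in> torsion V" "LV U R T \<phi> V X \<in> Ob T"
    unfolding d using l(3) tri_simps(2)[OF l(1)] by simp_all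
  show "f = Zer T Z (LV U R T \<phi> V X)" if "Z \<in> torsion V" "f \<in> Hom T Z (LV U R T \<phi> V X)" for Z f
    using l(4) that unfolding d by blast
qed

text \<open>Torsion objects have the same maps into \<open>\<Gamma>\<close> as into
  \<open>X\<close>, and vanishing of maps out of torsion objects can be tested on the compact
  ones.\<close>

lemma GammaV_zero_iff:
  assumes V: "V \<subseteq> Spec R" and X: "X \<in> Ob T"
  shows "is_zero T (GammaV U R T \<phi> V X) \<longleftrightarrow>
    (\<forall>Z\<in>compacts \<inter> torsion V. \<forall>f\<in>Hom T Z X. f = Zer T Z X)"
proof -
  let ?\<Gamma> = "GammaV U R T \<phi> V X" and ?L = "LV U R T \<phi> V X"
  obtain u v w where t: "(u, v, w) \<in> Tri T" and d: "Cod T u = X" "Dom T u = ?\<Gamma>" "Cod T v = ?L"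
    using localization_props(1)[OF V X] by blast
  note \<Gamma> = localization_props(2)[OF V X] and L [simp] = localization_props(3)[OF V X]
    and perp = localization_props(4)[OF V X]
  note [simp] = tri_simps[OF t, unfolded d] d X torsion_Ob[OF V \<Gamma>]
  show ?thesis
  proof
    assume z: "is_zero T ?\<Gamma>"
    show "\<forall>Z\<in>compacts \<inter> torsion V. \<forall>f\<in>Hom T Z X. f = Zer T Z X"
    proof (intro ballI)
      fix Z f assume Z: "Z \<in> compacts \<inter> torsion V" and f: "f \<in> Hom T Z X"
      have "v \<bullet> f \<in> Hom T Z ?L" using f by simp
      then have "v \<bullet> f = Zer T Z ?L" using perp Z by blast
      then have "\<exists>b\<in>Hom T Z ?\<Gamma>. f = u \<bullet> b" using tri_lift[OF t, of f Z] f by simp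
      then obtain b where b: "b \<in> Hom T Z ?\<Gamma>" "f = u \<bullet> b" by blast
      have "b = Zer T Z ?\<Gamma>" by (rule is_zeroD[OF z b(1)])
      then show "f = Zer T Z X" using b(2) Hom_Ob(1)[OF f] by simp
    qed
  next
    assume z: "\<forall>Z\<in>compacts \<inter> torsion V. \<forall>f\<in>Hom T Z X. f = Zer T Z X"
    have uh: "u \<in> Hom T ?\<Gamma> X" by simp
    have u0: "u = Zer T ?\<Gamma> X"
      by (rule torsion_perp[OF V X _ \<Gamma> uh]) (use z in blast)
    \<comment> \<open>As \<open>u = 0\<close>, the identity of \<open>\<Gamma>\<close> lifts along
      the rotated triangle through the desuspension of \<open>L\<close>, to which the torsion object
      \<open>\<Gamma>\<close> has no nonzero map.\<close>
    have "u \<bullet> Ident T ?\<Gamma> = Zer T ?\<Gamma> X" using u0 by simp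
    with tri_lift[OF tri_unrot[OF t], of "Ident T ?\<Gamma>" ?\<Gamma>] obtain b where
      b: "b \<in> Hom T ?\<Gamma> (susp_pow T (-1) ?L)" "Ident T ?\<Gamma> = neg_mor T (susp_powM T (-1) w) \<bullet> b"
      by auto
    have "SuspM T b \<in> Hom T (susp_pow T 1 ?\<Gamma>) ?L" using b(1) by simp
    then have "SuspM T b = Zer T (susp_pow T 1 ?\<Gamma>) ?L" using perp torsion_susp_pow[OF V \<Gamma>] by blast
    then have "SuspM T b = SuspM T (Zer T ?\<Gamma> (susp_pow T (-1) ?L))" by simp
    then have "b = Zer T ?\<Gamma> (susp_pow T (-1) ?L)" by (rule SuspM_inj) (use b(1) in simp_all)
    then have "Ident T ?\<Gamma> = Zer T ?\<Gamma> ?\<Gamma>" using b(2) by simp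
    then show "is_zero T ?\<Gamma>" by (simp add: is_zero_iff)
  qed
qed

lemma VV_Spec: "VV R P \<subseteq> Spec R"
  and ZZ_Spec: "ZZ R P \<subseteq> Spec R"
  unfolding VV_def ZZ_def by auto

text \<open>The elementwise description of the support. On maps out of compact objects,
  \<open>L\<close> for \<open>ZZ R P\<close> inverts the homogeneous elements outside
  \<open>P\<close>, so the maps into \<open>?L\<close> vanish exactly when those into
  \<open>X\<close> are killed at \<open>P\<close>.\<close>

lemma Gamma_zero_iff:
  assumes P: "P \<in> Spec R" and X: "X \<in> Ob T"
  shows "is_zero T (Gamma U R T \<phi> P X) \<longleftrightarrow> X \<in> tor_class P (compacts \<inter> torsion (VV R P))"
proof -
  let ?W = "ZZ R P"
  let ?\<Gamma> = "GammaV U R T \<phi> ?W X" and ?L = "LV U R T \<phi> ?W X"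
  let ?\<C> = "compacts \<inter> torsion (VV R P)"
  obtain u v w where t: "(u, v, w) \<in> Tri T" and d: "Cod T u = X" "Dom T u = ?\<Gamma>" "Cod T v = ?L"
    using localization_props(1)[OF ZZ_Spec X] by blast
  note \<Gamma> = localization_props(2)[OF ZZ_Spec X] and L [simp] = localization_props(3)[OF ZZ_Spec X]
    and perp = localization_props(4)[OF ZZ_Spec X]
  note [simp] = tri_simps[OF t, unfolded d] d X torsion_Ob[OF ZZ_Spec \<Gamma>]
  have PW: "P \<notin> ?W" unfolding ZZ_def by blast
  have \<C>: "?\<C> \<subseteq> Ob T" "\<And>C n. C \<in> ?\<C> \<Longrightarrow> susp_pow T n C \<in> ?\<C>"
    using compact_Ob compact_susp_pow torsion_susp_pow[OF VV_Spec] by blast+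
  have "is_zero T (Gamma U R T \<phi> P X) \<longleftrightarrow> (\<forall>Z\<in>?\<C>. \<forall>f\<in>Hom T Z ?L. f = Zer T Z ?L)"
    unfolding Gamma_def by (rule GammaV_zero_iff[OF VV_Spec L])
  also have "\<dots> \<longleftrightarrow> X \<in> tor_class P ?\<C>"
  proof
    assume z: "\<forall>Z\<in>?\<C>. \<forall>f\<in>Hom T Z ?L. f = Zer T Z ?L"
    have "killed P x" if Z: "Z \<in> ?\<C>" and x: "x \<in> Hom T Z X" for Z x
    proof -
      have "v \<bullet> x \<in> Hom T Z ?L" using x by simp
      then have "v \<bullet> x = Zer T Z ?L" using z Z by blast
      then have "\<exists>b\<in>Hom T Z ?\<Gamma>. x = u \<bullet> b" using tri_lift[OF t, of x Z] x by simp
      then obtain b where b: "b \<in> Hom T Z ?\<Gamma>" "x = u \<bullet> b" by blast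
      have "killed P b" using torsion_killed[OF ZZ_Spec \<Gamma> _ b(1) P PW] Z by blast
      then show ?thesis using b killed_comp_left[of P b u] by simp
    qed
    then show "X \<in> tor_class P ?\<C>" unfolding tor_class_def by simp
  next
    assume tc: "X \<in> tor_class P ?\<C>"
    show "\<forall>Z\<in>?\<C>. \<forall>f\<in>Hom T Z ?L. f = Zer T Z ?L"
    proof (intro ballI)
      fix Z f assume Z: "Z \<in> ?\<C>" and f: "f \<in> Hom T Z ?L"
      have Zc: "Z \<in> compacts" using Z by blast
      note [simp] = HomD[OF f]
      \<comment> \<open>First \<open>f\<close> is shown to be killed at \<open>P\<close>:
        \<open>w \<bullet> f\<close> is, since \<open>?\<Gamma>\<close> is torsion and
        \<open>P\<close> lies outside \<open>?W\<close>; so a multiple of \<open>f\<close> by a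
        denominator comes from \<open>X\<close>, where \<open>tc\<close> applies.\<close>
      have "w \<bullet> f \<in> Hom T Z (susp_pow T 1 ?\<Gamma>)" by simp
      then have "killed P (w \<bullet> f)"
        using torsion_killed[OF ZZ_Spec torsion_susp_pow[OF ZZ_Spec \<Gamma>] Zc _ P PW] by blast
      then obtain n s where s: "s \<in> grade R n - P" "kills n s (w \<bullet> f)" unfolding killed_def by blast
      then have [simp]: "s \<in> grade R n" by simp
      have "susp_powM T n w \<bullet> (\<phi> n s ?L \<bullet> f) = (susp_powM T n w \<bullet> \<phi> n s ?L) \<bullet> f" by simp
      also have "\<dots> = (\<phi> n s (Susp T ?\<Gamma>) \<bullet> w) \<bullet> f"
        using phi_nat[of s n w ?L "Susp T ?\<Gamma>"] by simp
      also have "\<dots> = Zer T Z (susp_pow T n (Susp T ?\<Gamma>))"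
        using s(2) unfolding kills_def by simp
      finally obtain y where y: "y \<in> Hom T Z (susp_pow T n X)" "\<phi> n s ?L \<bullet> f = susp_powM T n v \<bullet> y"
        using tri_lift_pow[OF tri_rot[OF t], of "\<phi> n s ?L \<bullet> f" Z n] by auto
      have "susp_pow T n X \<in> tor_class P ?\<C>" using tor_class_susp[OF tc \<C>] .
      then have "killed P y" using y(1) Z unfolding tor_class_def by blast
      then have "killed P (\<phi> n s (Cod T f) \<bullet> f)" using y killed_comp_left[of P y "susp_powM T n v"] by simp
      then have "killed P f" using killed_phi[OF P s(1), of f] by simp
      then obtain m r where r: "r \<in> grade R m" "r \<notin> P" "kills m r f" unfolding killed_def by blast
      note [simp] = r(1)
      \<comment> \<open>The killed \<open>f\<close> extends, after a shift, to the cone of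
        \<open>r\<close> on \<open>Z\<close>. Because \<open>r \<notin> P\<close>, this cone is
        torsion for \<open>?W\<close> and has no nonzero map to a shift of
        \<open>?L\<close>.\<close>
      obtain v' w' where t': "(\<phi> m r Z, v', w') \<in> Tri T" using tri_complete[of "\<phi> m r Z"] by auto
      note [simp] = tri_simps[OF t', simplified]
      let ?D = "Cod T v'"
      have "susp_powM T m f \<bullet> \<phi> m r Z = Zer T Z (susp_pow T m ?L)" using kills_alt[of r m f] r(3) by simp
      then obtain g where g: "g \<in> Hom T ?D (susp_pow T m ?L)" "susp_powM T m f = g \<bullet> v'"
        using tri_ext[OF t', of "susp_powM T m f" "susp_pow T m ?L"] by auto
      have "?D \<in> compacts" by (rule compact_cone_phi[OF r(1) Zc t'])
      moreover have "esupp ?D \<subseteq> ?W"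
        using esupp_cone[OF r(1) _ t'] r(2) unfolding ZZ_def esupp_def by auto
      ultimately have D: "?D \<in> torsion ?W" using compact_torsion_iff[OF ZZ_Spec] by blast
      have "susp_powM T (-m) g \<in> Hom T (susp_pow T (-m) ?D) ?L" using g(1) by simp
      then have "susp_powM T (-m) g = Zer T (susp_pow T (-m) ?D) ?L"
        using perp torsion_susp_pow[OF ZZ_Spec D] by blast
      then have "g = Zer T ?D (susp_pow T m ?L)" using susp_powM_eq_Zer_iff[of g "-m"] g(1) by simp
      then have "susp_powM T m f = susp_powM T m (Zer T Z ?L)" using g(2) by simp
      then show "f = Zer T Z ?L" by (rule susp_powM_inj) simp_all
    qed
  qed
  finally show ?thesis .
qed

lemma Gamma_Ob: "X \<in> Ob T \<Longrightarrow> Gamma U R T \<phi> P X \<in> Ob T"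
  unfolding Gamma_def
  by (rule torsion_Ob[OF VV_Spec localization_props(2)[OF VV_Spec localization_props(3)[OF ZZ_Spec]]])

lemma supp_iff:
  assumes "X \<in> Ob T"
  shows "P \<in> supp U R T \<phi> X \<longleftrightarrow> P \<in> Spec R \<and> X \<notin> tor_class P (compacts \<inter> torsion (VV R P))"
  unfolding supp_def using Gamma_zero_iff[OF _ assms] by blast

end

context linear_tricat begin

section \<open>Nakayama's lemma\<close>

lemma phi_zero: "X \<in> Ob T \<Longrightarrow> \<phi> n \<zero>\<^bsub>R\<^esub> X = Zer T X (susp_pow T n X)"
  using phi_add[of "\<zero>\<^bsub>R\<^esub>" n "\<zero>\<^bsub>R\<^esub>" X] R.grade_zero[of n]
  by (intro Plus_self_Zer) simp_all

lemma phi_minus: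
  assumes r: "r \<in> grade R n" and X [simp]: "X \<in> Ob T"
  shows "\<phi> n (\<ominus>\<^bsub>R\<^esub> r) X = neg_mor T (\<phi> n r X)"
proof (rule neg_unique)
  have "r \<oplus>\<^bsub>R\<^esub> \<ominus>\<^bsub>R\<^esub> r = \<zero>\<^bsub>R\<^esub>" using R.grade_carrier[OF r] R.r_neg by blast
  then show "Plus T (\<phi> n r X) (\<phi> n (\<ominus>\<^bsub>R\<^esub> r) X) = Zer T X (susp_pow T n X)"
    using phi_add[OF r R.grade_minus[OF r] X] by (simp add: phi_zero)
qed (use r R.grade_minus[OF r] in simp_all)

text \<open>Multiplication by \<open>s\<close> of degree \<open>n\<close> on an element
  \<open>x\<close> of degree \<open>j\<close> of \<open>Hom\<^sup>*(C, X)\<close>, in the form used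
  by \<open>hom_star\<close>.\<close>

definition act :: "'o \<Rightarrow> int \<Rightarrow> int \<Rightarrow> 'r \<Rightarrow> 'm \<Rightarrow> 'm" where
  "act X j n s x = susp_powM T j (\<phi> n s X) \<bullet> x"

lemma act_hom:
  "\<lbrakk>X \<in> Ob T; s \<in> grade R n; x \<in> Hom T C (susp_pow T j X)\<rbrakk> \<Longrightarrow> act X j n s x \<in> Hom T C (susp_pow T (n + j) X)"
  unfolding act_def by (simp add: add.commute)

text \<open>Acting through a suspension of \<open>\<phi> n s X\<close>, and not through
  \<open>\<phi> n s\<close> at a suspension of \<open>X\<close>, makes the action multiplicative
  without signs.\<close>

lemma act_act:
  assumes "X \<in> Ob T" "s \<in> grade R n" "r \<in> grade R m" "x \<in> Hom T C (susp_pow T j X)"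
  shows "act X (n + j) m r (act X j n s x) = act X j (m + n) (r \<otimes>\<^bsub>R\<^esub> s) x"
proof -
  have "susp_powM T j (\<phi> (m + n) (r \<otimes>\<^bsub>R\<^esub> s) X) = susp_powM T (n + j) (\<phi> m r X) \<bullet> susp_powM T j (\<phi> n s X)"
    using assms susp_powM_comp[of "susp_powM T n (\<phi> m r X)" "\<phi> n s X" j] by (simp add: phi_mult add.commute)
  then show ?thesis unfolding act_def using assms by (simp add: add.commute)
qed

lemma act_Plus:
  assumes "X \<in> Ob T" "s \<in> grade R n" "x \<in> Hom T C (susp_pow T j X)" "y \<in> Hom T C (susp_pow T j X)"
  shows "act X j n s (Plus T x y) = Plus T (act X j n s x) (act X j n s y)"
  unfolding act_def using assms by (simp add: comp_Plus)

lemma act_add: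
  assumes "X \<in> Ob T" "r \<in> grade R n" "s \<in> grade R n" "x \<in> Hom T C (susp_pow T j X)"
  shows "act X j n (r \<oplus>\<^bsub>R\<^esub> s) x = Plus T (act X j n r x) (act X j n s x)"
  unfolding act_def using assms by (simp add: phi_add susp_powM_Plus Plus_comp)

text \<open>The degree \<open>k\<close> part of the submodule of \<open>Hom\<^sup>*(C, X)\<close> consisting of the combinations of the
  homogeneous elements in the list with coefficients in \<open>A\<close>.\<close>

primrec span :: "'o \<Rightarrow> 'o \<Rightarrow> 'r set \<Rightarrow> (int \<times> 'm) list \<Rightarrow> int \<Rightarrow> 'm set" where
  "span C X A [] k = {Zer T C (susp_pow T k X)}"
| "span C X A (e # L) k = {Plus T (act X (fst e) (k - fst e) a (snd e)) y | a y.
     a \<in> grade R (k - fst e) \<and> a \<in> A \<and> y \<in> span C X A L k}"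

definition homs :: "'o \<Rightarrow> 'o \<Rightarrow> (int \<times> 'm) list \<Rightarrow> bool" where
  "homs C X L \<longleftrightarrow> C \<in> Ob T \<and> X \<in> Ob T \<and> (\<forall>(j, m)\<in>set L. m \<in> Hom T C (susp_pow T j X))"

lemma homs_Cons: "homs C X ((j, m) # L) \<longleftrightarrow> homs C X L \<and> m \<in> Hom T C (susp_pow T j X)"
  unfolding homs_def by auto

lemma act_hom':
  "\<lbrakk>X \<in> Ob T; a \<in> grade R (k - j); x \<in> Hom T C (susp_pow T j X)\<rbrakk> \<Longrightarrow> act X j (k - j) a x \<in> Hom T C (susp_pow T k X)"
  using act_hom[of X a "k - j" x C j] by simp

lemma span_hom: "\<lbrakk>homs C X L; y \<in> span C X A L k\<rbrakk> \<Longrightarrow> y \<in> Hom T C (susp_pow T k X)"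
proof (induction L arbitrary: y)
  case Nil then show ?case by (simp add: homs_def)
next
  case (Cons e L)
  obtain j m where e [simp]: "e = (j, m)" by (cases e)
  obtain a z where a: "a \<in> grade R (k - j)" and z: "z \<in> span C X A L k" and y: "y = Plus T (act X j (k - j) a m) z"
    using Cons.prems(2) by auto
  have h: "homs C X L" "m \<in> Hom T C (susp_pow T j X)" "X \<in> Ob T" using Cons.prems(1) homs_Cons unfolding e homs_def by auto
  show ?case unfolding y using act_hom'[OF h(3) a h(2)] Cons.IH[OF h(1) z] by simp
qed

lemma span_Zer:
  assumes "\<zero>\<^bsub>R\<^esub> \<in> A" shows "homs C X L \<Longrightarrow> Zer T C (susp_pow T k X) \<in> span C X A L k"
proof (induction L)
  case (Cons e L)
  obtain j m where e [simp]: "e = (j, m)" by (cases e)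
  have h: "homs C X L" "m \<in> Hom T C (susp_pow T j X)" "X \<in> Ob T" "C \<in> Ob T" using Cons.prems homs_Cons unfolding e homs_def by auto
  have "act X j (k - j) \<zero>\<^bsub>R\<^esub> m = Zer T C (susp_pow T k X)"
    unfolding act_def using h by (simp add: phi_zero add.commute)
  then have "Zer T C (susp_pow T k X) = Plus T (act X j (k - j) \<zero>\<^bsub>R\<^esub> m) (Zer T C (susp_pow T k X))"
    using h by simp
  then show ?case using Cons.IH[OF h(1)] R.grade_zero assms by auto
qed simp

lemma Plus_Plus_swap:
  assumes "a \<in> Hom T X Y" "b \<in> Hom T X Y" "c \<in> Hom T X Y" "d \<in> Hom T X Y"
  shows "Plus T (Plus T a b) (Plus T c d) = Plus T (Plus T a c) (Plus T b d)"
proof -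
  interpret abelian_group "hom_group T X Y" using hom_abelian_group Hom_Ob[OF assms(1)] by blast
  show ?thesis using a_ac assms by (metis (no_types, lifting) hom_group_simps(1,3) a_closed)
qed

lemma span_Plus:
  assumes A: "\<And>a b. \<lbrakk>a \<in> A; b \<in> A\<rbrakk> \<Longrightarrow> a \<oplus>\<^bsub>R\<^esub> b \<in> A"
  shows "\<lbrakk>homs C X L; x \<in> span C X A L k; y \<in> span C X A L k\<rbrakk> \<Longrightarrow> Plus T x y \<in> span C X A L k"
proof (induction L arbitrary: x y)
  case Nil then show ?case by (simp add: homs_def)
next
  case (Cons e L)
  obtain j m where e [simp]: "e = (j, m)" by (cases e)
  have h: "homs C X L" "m \<in> Hom T C (susp_pow T j X)" "X \<in> Ob T" using Cons.prems(1) homs_Cons unfolding e homs_def by auto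
  obtain a z where a: "a \<in> grade R (k - j)" "a \<in> A" and z: "z \<in> span C X A L k" and x: "x = Plus T (act X j (k - j) a m) z"
    using Cons.prems(2) by auto
  obtain b w where b: "b \<in> grade R (k - j)" "b \<in> A" and w: "w \<in> span C X A L k" and y: "y = Plus T (act X j (k - j) b m) w"
    using Cons.prems(3) by auto
  have "Plus T x y = Plus T (act X j (k - j) (a \<oplus>\<^bsub>R\<^esub> b) m) (Plus T z w)"
    unfolding x y act_add[OF h(3) a(1) b(1) h(2)]
    by (rule Plus_Plus_swap) (rule act_hom'[OF h(3) a(1) h(2)] act_hom'[OF h(3) b(1) h(2)]
      span_hom[OF h(1) z] span_hom[OF h(1) w])+
  then show ?case using Cons.IH[OF h(1) z w] R.grade_add[OF a(1) b(1)] A[OF a(2) b(2)] by auto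
qed

text \<open>Two coefficient sets cover the different uses: \<open>t \<in> P\<close> turns arbitrary
  coefficients into coefficients in \<open>P\<close>, and any homogeneous \<open>t\<close> preserves
  coefficients in an ideal.\<close>

lemma span_act:
  assumes t: "t \<in> grade R d" and tA: "\<And>a. \<lbrakk>a \<in> A; a \<in> carrier R\<rbrakk> \<Longrightarrow> t \<otimes>\<^bsub>R\<^esub> a \<in> B"
  shows "\<lbrakk>homs C X L; y \<in> span C X A L k\<rbrakk> \<Longrightarrow> act X k d t y \<in> span C X B L (d + k)"
proof (induction L arbitrary: y)
  case Nil then show ?case unfolding act_def using t by (simp add: homs_def add.commute)
next
  case (Cons e L)
  obtain j m where e [simp]: "e = (j, m)" by (cases e)
  have h: "homs C X L" "m \<in> Hom T C (susp_pow T j X)" "X \<in> Ob T" using Cons.prems(1) homs_Cons unfolding e homs_def by auto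
  obtain a z where a: "a \<in> grade R (k - j)" "a \<in> A" and z: "z \<in> span C X A L k" and y: "y = Plus T (act X j (k - j) a m) z"
    using Cons.prems(2) by auto
  have "act X k d t y = Plus T (act X k d t (act X j (k - j) a m)) (act X k d t z)"
    unfolding y by (rule act_Plus[OF h(3) t act_hom'[OF h(3) a(1) h(2)] span_hom[OF h(1) z]])
  also have "act X k d t (act X j (k - j) a m) = act X j (d + k - j) (t \<otimes>\<^bsub>R\<^esub> a) m"
    using act_act[OF h(3) a(1) t h(2)] by (simp add: algebra_simps)
  finally have "act X k d t y = Plus T (act X j (d + k - j) (t \<otimes>\<^bsub>R\<^esub> a) m) (act X k d t z)" .
  moreover have "t \<otimes>\<^bsub>R\<^esub> a \<in> grade R (d + k - j)" using R.grade_mult[OF t a(1)] by (simp add: algebra_simps)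
  moreover have "t \<otimes>\<^bsub>R\<^esub> a \<in> B" using tA[OF a(2) R.grade_carrier[OF a(1)]] .
  ultimately show ?case using Cons.IH[OF h(1) z] by auto
qed

lemma span_kills:
  assumes s: "s \<in> grade R n"
  shows "\<lbrakk>homs C X L; \<And>j m. (j, m) \<in> set L \<Longrightarrow> kills n s m; y \<in> span C X A L k\<rbrakk> \<Longrightarrow> kills n s y"
proof (induction L arbitrary: y)
  case Nil then show ?case using kills_Zer[OF s] by (simp add: homs_def)
next
  case (Cons e L)
  obtain j m where e [simp]: "e = (j, m)" by (cases e)
  have h: "homs C X L" "m \<in> Hom T C (susp_pow T j X)" "X \<in> Ob T" using Cons.prems(1) homs_Cons unfolding e homs_def by auto
  obtain a z where a: "a \<in> grade R (k - j)" "a \<in> A" and z: "z \<in> span C X A L k" and y: "y = Plus T (act X j (k - j) a m) z"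
    using Cons.prems(3) by auto
  have "kills n s m" by (rule Cons.prems(2)[of j]) simp
  then have "kills n s (act X j (k - j) a m)"
    unfolding act_def using kills_comp_left[of n s m] s h a(1) by simp
  moreover have "kills n s z"
  proof (rule Cons.IH[OF h(1) _ z])
    fix i b assume "(i, b) \<in> set L"
    then show "kills n s b" by (intro Cons.prems(2)[of i]) simp
  qed
  ultimately show ?case unfolding y
    using kills_Plus[OF _ _ s] act_hom'[OF h(3) a(1) h(2)] span_hom[OF h(1) z] by simp
qed

lemma span_gen:
  assumes L: "homs C X L" and e: "(j, m) \<in> set L" shows "m \<in> span C X (carrier R) L j"
  using L e
proof (induction L)
  case (Cons e L)
  obtain i b where ei [simp]: "e = (i, b)" by (cases e)
  have h: "homs C X L" "b \<in> Hom T C (susp_pow T i X)" "X \<in> Ob T" "C \<in> Ob T" using Cons.prems(1) homs_Cons unfolding ei homs_def by auto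
  show ?case
  proof (cases "(j, m) = (i, b)")
    case True
    then have [simp]: "j = i" "m = b" by auto
    have "m = Plus T (act X i 0 \<one>\<^bsub>R\<^esub> b) (Zer T C (susp_pow T i X))"
      unfolding act_def using h by (simp add: phi_one)
    then show ?thesis using span_Zer[OF R.zero_closed h(1), of i] R.grade_one R.one_closed by auto
  next
    case False
    then have m: "m \<in> span C X (carrier R) L j" using Cons h(1) by auto
    have "act X i (j - i) \<zero>\<^bsub>R\<^esub> b = Zer T C (susp_pow T j X)"
      unfolding act_def using h by (simp add: phi_zero add.commute)
    then have "m = Plus T (act X i (j - i) \<zero>\<^bsub>R\<^esub> b) m" using span_hom[OF h(1) m] by simp
    then show ?thesis using m R.grade_zero R.zero_closed by auto
  qed
qed simp

text \<open>Elimination of one generator after the other; it replaces the determinant trick, which is not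
  available over a graded-commutative ring.\<close>

lemma nakayama:
  assumes P: "P \<in> Spec R"
  shows "\<lbrakk>homs C X L; s \<in> grade R d - P; \<And>j m. (j, m) \<in> set L \<Longrightarrow> act X j d s m \<in> span C X P L (d + j)\<rbrakk>
    \<Longrightarrow> \<exists>n. \<exists>s'\<in>grade R n - P. \<forall>(j, m)\<in>set L. kills n s' m"
proof (induction L arbitrary: s d)
  case Nil
  then show ?case by auto
next
  case (Cons e L)
  note iP = R.Spec_props(1)[OF P]
  interpret P: ideal P R by (rule iP)
  obtain j m where e [simp]: "e = (j, m)" by (cases e)
  have h: "homs C X L" and mh: "m \<in> Hom T C (susp_pow T j X)" and X: "X \<in> Ob T"
    using Cons.prems(1) homs_Cons unfolding e homs_def by auto
  have s: "s \<in> grade R d" "s \<notin> P" and sR: "s \<in> carrier R" using Cons.prems(2) R.grade_carrier by auto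
  have "act X j d s m \<in> span C X P ((j, m) # L) (d + j)" using Cons.prems(3)[of j m] by simp
  then obtain a y where a: "a \<in> grade R d" "a \<in> P" and y: "y \<in> span C X P L (d + j)"
    and sm: "act X j d s m = Plus T (act X j d a m) y" by auto
  have aR: "a \<in> carrier R" using R.grade_carrier[OF a(1)] .
  \<comment> \<open>The relation for \<open>m\<close> reads \<open>s m = a m + y\<close> with
    \<open>a \<in> P\<close>; so \<open>t = s - a\<close> lies outside \<open>P\<close>, and
    \<open>t m = y\<close> involves only the remaining generators.\<close>
  define t where "t = s \<oplus>\<^bsub>R\<^esub> \<ominus>\<^bsub>R\<^esub> a"
  have tg: "t \<in> grade R d" unfolding t_def by (intro R.grade_add R.grade_minus s a)
  have tR: "t \<in> carrier R" using R.grade_carrier[OF tg] .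
  have s_ta: "s = a \<oplus>\<^bsub>R\<^esub> t" unfolding t_def
    using sR aR R.a_lcomm[of a s "\<ominus>\<^bsub>R\<^esub> a"] by (simp add: R.r_neg)
  have tP: "t \<notin> P" using s(2) P.a_closed[OF a(2)] unfolding s_ta by blast
  have "Plus T (act X j d a m) (act X j d t m) = Plus T (act X j d a m) y"
    using act_add[OF X a(1) tg mh] sm unfolding s_ta[symmetric] by simp
  then have tm: "act X j d t m = y"
    by (rule Plus_left_cancel[OF _ act_hom[OF X a(1) mh] act_hom[OF X tg mh] span_hom[OF h y]])
  have "\<exists>n. \<exists>s'\<in>grade R n - P. \<forall>(j, m)\<in>set L. kills n s' m"
  proof (rule Cons.IH[OF h])
    show "t \<otimes>\<^bsub>R\<^esub> s \<in> grade R (d + d) - P" using R.Spec_mult_notin[OF P] tg tP s by blast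
    fix i b assume ib: "(i, b) \<in> set L"
    then have bh: "b \<in> Hom T C (susp_pow T i X)" using h unfolding homs_def by blast
    have "act X i d s b \<in> span C X P ((j, m) # L) (d + i)" using Cons.prems(3)[of i b] ib by simp
    then obtain a' y' where a': "a' \<in> grade R (d + i - j)" "a' \<in> P" and y': "y' \<in> span C X P L (d + i)"
      and sb: "act X i d s b = Plus T (act X j (d + i - j) a' m) y'" by auto
    have a'R: "a' \<in> carrier R" using R.grade_carrier[OF a'(1)] .
    \<comment> \<open>In \<open>t (s b)\<close> the term \<open>t a' m\<close> has to become a
      coefficient times \<open>t m = y\<close>; \<open>a''\<close> is \<open>a'\<close> with the
      sign of commuting \<open>t\<close> past it. Thus \<open>t s\<close> plays the role of
      \<open>s\<close> for the shorter list.\<close>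
    define a'' where "a'' = (if even (d * (d + i - j)) then a' else \<ominus>\<^bsub>R\<^esub> a')"
    have a'': "a'' \<in> grade R (d + i - j)" "a'' \<in> P"
      unfolding a''_def using a' R.grade_minus P.a_inv_closed by auto
    have comm: "t \<otimes>\<^bsub>R\<^esub> a' = a'' \<otimes>\<^bsub>R\<^esub> t"
      using R.graded_comm[OF tg a'(1)] a'R tR unfolding a''_def by (auto simp: R.l_minus)
    have "act X i (d + d) (t \<otimes>\<^bsub>R\<^esub> s) b = act X (d + i) d t (act X i d s b)"
      by (rule act_act[OF X s(1) tg bh, symmetric])
    also have "\<dots> = Plus T (act X (d + i) d t (act X j (d + i - j) a' m)) (act X (d + i) d t y')"
      unfolding sb by (rule act_Plus[OF X tg act_hom'[OF X a'(1) mh] span_hom[OF h y']])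
    also have "act X (d + i) d t (act X j (d + i - j) a' m) = act X j (d + (d + i - j)) (t \<otimes>\<^bsub>R\<^esub> a') m"
      using act_act[OF X a'(1) tg mh] by simp
    also have "\<dots> = act X (d + j) (d + i - j) a'' y"
      using act_act[OF X tg a''(1) mh] unfolding comm tm by (simp add: add.commute)
    finally have *: "act X i (d + d) (t \<otimes>\<^bsub>R\<^esub> s) b = Plus T (act X (d + j) (d + i - j) a'' y) (act X (d + i) d t y')" .
    have "act X (d + j) (d + i - j) a'' y \<in> span C X P L (d + i - j + (d + j))"
      by (rule span_act[OF a''(1) _ h y]) (use P.I_r_closed a''(2) in blast)
    moreover have "act X (d + i) d t y' \<in> span C X P L (d + (d + i))"
      by (rule span_act[OF tg _ h y']) (use P.I_l_closed tR in blast)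
    ultimately show "act X i (d + d) (t \<otimes>\<^bsub>R\<^esub> s) b \<in> span C X P L (d + d + i)"
      unfolding * by (intro span_Plus[OF _ h]) (simp_all add: algebra_simps P.a_closed)
  qed
  then obtain n s' where s': "s' \<in> grade R n - P" and k: "\<And>i b. (i, b) \<in> set L \<Longrightarrow> kills n s' b" by blast
  then have s'g: "s' \<in> grade R n" by blast
  have mm [simp]: "m \<in> Mor T" "Dom T m = C" "Cod T m = susp_pow T j X" using mh by auto
  \<comment> \<open>The eliminated generator is recovered last: \<open>s'\<close> kills
    \<open>t m = y\<close>, so \<open>s' t\<close> kills \<open>m\<close>.\<close>
  have "kills n s' (act X j d t m)" unfolding tm by (rule span_kills[OF s'g h k y])
  then have "kills n s' (\<phi> d t (Cod T m) \<bullet> m)"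
    using phi_susp_pow[OF tg X, of j] kills_neg[of n s' "act X j d t m"] s'g tg X unfolding act_def by auto
  then have "kills (n + d) (s' \<otimes>\<^bsub>R\<^esub> t) m" by (rule kills_mult) (use s'g tg in simp_all)
  moreover have "kills (n + d) (s' \<otimes>\<^bsub>R\<^esub> t) b" if ib: "(i, b) \<in> set L" for i b
  proof -
    have "b \<in> Hom T C (susp_pow T i X)" using h ib unfolding homs_def by blast
    then show ?thesis using kills_mult_right[OF k[OF ib] s'g tg] by simp
  qed
  ultimately have "\<forall>(j, m)\<in>set (e # L). kills (n + d) (s' \<otimes>\<^bsub>R\<^esub> t) m" by auto
  moreover have "s' \<otimes>\<^bsub>R\<^esub> t \<in> grade R (n + d) - P" using R.Spec_mult_notin[OF P s'] tg tP by blast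
  ultimately show ?case by blast
qed

section \<open>From finite generation to graded spans\<close>

lemma hom_star_abelian_group:
  assumes C: "C \<in> Ob T" "X \<in> Ob T" shows "abelian_group (hom_star R T \<phi> C X)"
proof -
  let ?A = "\<lambda>i. add_monoid (hom_group T C (susp_pow T i X))"
  have ag: "abelian_group (hom_group T C (susp_pow T i X))" for i
    by (rule hom_abelian_group) (use C in simp_all)
  have gr: "Group.group (?A i)" for i by (rule abelian_group.a_group[OF ag])
  define G where "G = sum_group UNIV ?A"
  have sel: "carrier (hom_star R T \<phi> C X) = carrier G" "add (hom_star R T \<phi> C X) = monoid.mult G"
    "zero (hom_star R T \<phi> C X) = \<one>\<^bsub>G\<^esub>"
    unfolding hom_star_def hom_star_group_def G_def by simp_all
  interpret G: Group.group G unfolding G_def by (rule sum_group) (rule gr)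
  have comm: "x \<otimes>\<^bsub>G\<^esub> y = y \<otimes>\<^bsub>G\<^esub> x" if "x \<in> carrier G" "y \<in> carrier G" for x y
  proof -
    have "x i \<in> carrier (?A i)" "y i \<in> carrier (?A i)" for i
      using that gr unfolding G_def by (simp_all add: carrier_sum_group PiE_iff)
    then show ?thesis unfolding G_def using Plus_commute by (simp add: restrict_def)
  qed
  show ?thesis
  proof (rule abelian_groupI, unfold sel)
    fix x assume "x \<in> carrier G"
    then show "\<exists>y\<in>carrier G. y \<otimes>\<^bsub>G\<^esub> x = \<one>\<^bsub>G\<^esub>" using G.l_inv_ex by blast
  qed (use comm G.m_assoc in simp_all)
qed

lemma finsum_in_subset:
  assumes M: "abelian_group M" and A: "finite A" and N: "zero M \<in> N" "N \<subseteq> carrier M"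
    "\<And>x y. \<lbrakk>x \<in> N; y \<in> N\<rbrakk> \<Longrightarrow> x \<oplus>\<^bsub>M\<^esub> y \<in> N" and f: "\<And>a. a \<in> A \<Longrightarrow> f a \<in> N"
  shows "finsum M f A \<in> N"
proof -
  interpret abelian_group M by (rule M)
  show ?thesis using A f
  proof (induction A rule: finite_induct)
    case empty then show ?case using N(1) by simp
  next
    case (insert a A)
    then have "f a \<in> carrier M" "f \<in> A \<rightarrow> carrier M" using N(2) by auto
    then show ?case using insert N(3) by (simp add: finsum_insert)
  qed
qed

text \<open>The given generators need not be homogeneous, but their finitely many nonzero components
  generate as well; as coefficients are decomposed by \<open>hcomp\<close>, every degree is spanned
  with homogeneous coefficients.\<close>

lemma fg_span:
  assumes X: "X \<in> Ob T" and C: "C \<in> Ob T" and fg: "finitely_generated_module R (hom_star R T \<phi> C X)"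
  shows "\<exists>L. homs C X L \<and> (\<forall>k. Hom T C (susp_pow T k X) \<subseteq> span C X (carrier R) L k)"
proof -
  let ?M = "hom_star R T \<phi> C X"
  note car = hom_star_carrier[OF C X]
  interpret M: abelian_group ?M by (rule hom_star_abelian_group[OF C X])
  obtain F where F: "finite F" "F \<subseteq> carrier ?M"
    and gen: "\<And>x. x \<in> carrier ?M \<Longrightarrow> \<exists>c\<in>F \<rightarrow> carrier R. x = (\<Oplus>\<^bsub>?M\<^esub>m\<in>F. c m \<odot>\<^bsub>?M\<^esub> m)"
    using fg unfolding finitely_generated_module_def by blast
  define B where "B = (\<Union>f\<in>F. (\<lambda>k. (k, f k)) ` {k. f k \<noteq> Zer T C (susp_pow T k X)})"
  have "finite B" unfolding B_def using F car by auto
  then obtain L where L: "set L = B" using finite_list by blast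
  have fh: "f k \<in> Hom T C (susp_pow T k X)" if "f \<in> F" for f k using F(2) that unfolding car by blast
  have hL: "homs C X L" unfolding homs_def L B_def using fh C X by auto
  let ?S = "\<lambda>k. span C X (carrier R) L k"
  have SP: "Plus T x y \<in> ?S k" if "x \<in> ?S k" "y \<in> ?S k" for x y k
    using span_Plus[OF R.a_closed hL that] .
  have SZ: "Zer T C (susp_pow T k X) \<in> ?S k" for k by (rule span_Zer[OF R.zero_closed hL])
  have SF: "f k \<in> ?S k" if "f \<in> F" for f k
  proof (cases "f k = Zer T C (susp_pow T k X)")
    case False
    then have "(k, f k) \<in> set L" unfolding L B_def using that by blast
    then show ?thesis by (rule span_gen[OF hL])
  qed (use SZ in simp)
  have smult: "(r \<odot>\<^bsub>?M\<^esub> f) k \<in> ?S k" if r: "r \<in> carrier R" and f: "f \<in> F" for r f k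
  proof -
    have "(\<Oplus>\<^bsub>hom_group T C (susp_pow T k X)\<^esub>n\<in>{n. hcomp R r n \<noteq> \<zero>\<^bsub>R\<^esub>}.
        susp_powM T (k - n) (\<phi> n (hcomp R r n) X) \<bullet> f (k - n)) \<in> ?S k"
    proof (rule finsum_in_subset)
      show "abelian_group (hom_group T C (susp_pow T k X))" by (rule hom_abelian_group) (use C X in simp_all)
      show "finite {n. hcomp R r n \<noteq> \<zero>\<^bsub>R\<^esub>}" by (rule R.hcomp_props(2)[OF r])
      show "zero (hom_group T C (susp_pow T k X)) \<in> ?S k" using SZ by simp
      show "?S k \<subseteq> carrier (hom_group T C (susp_pow T k X))" using span_hom[OF hL] by (simp del: Hom_iff) blast
      show "\<And>x y. x \<in> ?S k \<Longrightarrow> y \<in> ?S k \<Longrightarrow> x \<oplus>\<^bsub>hom_group T C (susp_pow T k X)\<^esub> y \<in> ?S k" using SP by simp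
      fix n
      have "act X (k - n) n (hcomp R r n) (f (k - n)) \<in> ?S (n + (k - n))"
        by (rule span_act[OF R.hcomp_props(1)[OF r] _ hL SF[OF f]])
          (use R.grade_carrier[OF R.hcomp_props(1)[OF r]] in simp)
      then show "susp_powM T (k - n) (\<phi> n (hcomp R r n) X) \<bullet> f (k - n) \<in> ?S k" by (simp add: act_def)
    qed
    then show ?thesis unfolding hom_star_def by simp
  qed
  \<comment> \<open>A nonzero component of \<open>r f\<close> sits in a degree that is the sum of a
    degree of \<open>f\<close> and a degree of \<open>r\<close>, so finitely many occur.\<close>
  have smult_car: "r \<odot>\<^bsub>?M\<^esub> f \<in> carrier ?M" if r: "r \<in> carrier R" and f: "f \<in> F" for r f
  proof -
    let ?H = "{n. hcomp R r n \<noteq> \<zero>\<^bsub>R\<^esub>}" and ?K = "{k. f k \<noteq> Zer T C (susp_pow T k X)}"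
    have fin: "finite ?H" "finite ?K" using R.hcomp_props(2)[OF r] F(2) f unfolding car by auto
    have "{k. (r \<odot>\<^bsub>?M\<^esub> f) k \<noteq> Zer T C (susp_pow T k X)} \<subseteq> (\<lambda>(a, b). a + b) ` (?K \<times> ?H)"
    proof
      fix k assume k: "k \<in> {k. (r \<odot>\<^bsub>?M\<^esub> f) k \<noteq> Zer T C (susp_pow T k X)}"
      show "k \<in> (\<lambda>(a, b). a + b) ` (?K \<times> ?H)"
      proof (rule ccontr)
        assume n: "k \<notin> (\<lambda>(a, b). a + b) ` (?K \<times> ?H)"
        have z: "f (k - n) = Zer T C (susp_pow T (k - n) X)" if "n \<in> ?H" for n
        proof (rule ccontr)
          assume "f (k - n) \<noteq> Zer T C (susp_pow T (k - n) X)"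
          then have "(k - n, n) \<in> ?K \<times> ?H" using that by simp
          then have "(\<lambda>(a, b). a + b) (k - n, n) \<in> (\<lambda>(a, b). a + b) ` (?K \<times> ?H)" by (rule imageI)
          then show False using n by simp
        qed
        have "(r \<odot>\<^bsub>?M\<^esub> f) k \<in> {Zer T C (susp_pow T k X)}"
          unfolding hom_star_def module.select_convs
        proof (rule finsum_in_subset[OF _ fin(1)])
          show "abelian_group (hom_group T C (susp_pow T k X))" by (rule hom_abelian_group) (use C X in simp_all)
          fix n assume "n \<in> ?H"
          then show "susp_powM T (k - n) (\<phi> n (hcomp R r n) X) \<bullet> f (k - n) \<in> {Zer T C (susp_pow T k X)}"
            using z[of n] C X R.hcomp_props(1)[OF r, of n] by simp
        qed (use C X in simp_all)
        then show False using k by simp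
      qed
    qed
    then have "finite {k. (r \<odot>\<^bsub>?M\<^esub> f) k \<noteq> Zer T C (susp_pow T k X)}"
      by (rule finite_subset) (intro finite_imageI finite_cartesian_product fin)
    moreover have "(r \<odot>\<^bsub>?M\<^esub> f) k \<in> Hom T C (susp_pow T k X)" for k by (rule span_hom[OF hL smult[OF r f]])
    ultimately show ?thesis unfolding car by blast
  qed
  have "y \<in> ?S k" if y: "y \<in> Hom T C (susp_pow T k X)" for k y
  proof -
    define h where "h = (\<lambda>i. if i = k then y else Zer T C (susp_pow T i X))"
    have "finite {i. h i \<noteq> Zer T C (susp_pow T i X)}" by (rule finite_subset[of _ "{k}"]) (auto simp: h_def)
    then have "h \<in> carrier ?M" unfolding car using y C X by (simp add: h_def)
    from gen[OF this] obtain c where c: "c \<in> F \<rightarrow> carrier R" and hc: "h = (\<Oplus>\<^bsub>?M\<^esub>m\<in>F. c m \<odot>\<^bsub>?M\<^esub> m)" by blast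
    have "(\<Oplus>\<^bsub>?M\<^esub>m\<in>F. c m \<odot>\<^bsub>?M\<^esub> m) \<in> {g \<in> carrier ?M. \<forall>k. g k \<in> ?S k}"
    proof (rule finsum_in_subset[OF M.abelian_group_axioms F(1)])
      have "zero ?M = (\<lambda>k. Zer T C (susp_pow T k X))"
        unfolding hom_star_def hom_star_group_def by (simp add: restrict_def)
      then show "zero ?M \<in> {g \<in> carrier ?M. \<forall>k. g k \<in> ?S k}" using SZ M.zero_closed by simp
      fix x z assume "x \<in> {g \<in> carrier ?M. \<forall>k. g k \<in> ?S k}" "z \<in> {g \<in> carrier ?M. \<forall>k. g k \<in> ?S k}"
      moreover have "x \<oplus>\<^bsub>?M\<^esub> z = (\<lambda>k. Plus T (x k) (z k))"
        unfolding hom_star_def hom_star_group_def by (simp add: restrict_def)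
      ultimately show "x \<oplus>\<^bsub>?M\<^esub> z \<in> {g \<in> carrier ?M. \<forall>k. g k \<in> ?S k}"
        using SP M.a_closed[of x z] by simp
    next
      fix m assume "m \<in> F"
      then show "c m \<odot>\<^bsub>?M\<^esub> m \<in> {g \<in> carrier ?M. \<forall>k. g k \<in> ?S k}"
        using smult smult_car c by blast
    qed blast
    then have "h k \<in> ?S k" unfolding hc[symmetric] by blast
    then show ?thesis by (simp add: h_def)
  qed
  then show ?thesis using hL by blast
qed

end

context noetherian_tricat begin

section \<open>Supports of compact objects\<close>

text \<open>If \<open>P\<close> were lost, some \<open>s \<notin> P\<close> would kill
  \<open>v\<close>, and multiplication by \<open>s\<close> on a shift of \<open>Z\<close> would
  factor through multiplication by \<open>r\<close>. Then \<open>s\<close> carries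
  \<open>End\<^sup>*(Z)\<close> into \<open>P End\<^sup>*(Z)\<close>, and Nakayama's lemma gives a
  denominator killing the identity of \<open>Z\<close>.\<close>

lemma esupp_cone_mem:
  assumes fg: "finitely_generated_module R (hom_star R T \<phi> Z Z)" and Z: "Z \<in> Ob T"
    and P: "P \<in> esupp Z" and r: "r \<in> grade R d" "r \<in> P" and t: "(\<phi> d r Z, v, w) \<in> Tri T"
  shows "P \<in> esupp (Cod T v)"
proof (rule ccontr)
  note [simp] = Z r(1) tri_simps[OF t, simplified]
  have PS: "P \<in> Spec R" using P unfolding esupp_def by blast
  interpret P: ideal P R by (rule R.Spec_props(1)[OF PS])
  assume "P \<notin> esupp (Cod T v)"
  then have "killed P (Ident T (Cod T v))" using PS unfolding esupp_def by blast
  then have "killed P v" by (rule killed_of_Ident_Cod) simp_all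
  then obtain e s where s: "s \<in> grade R e - P" "kills e s v" unfolding killed_def by blast
  then have [simp]: "s \<in> grade R e" by blast
  have "susp_powM T e v \<bullet> \<phi> e s (susp_pow T d Z) = Zer T (susp_pow T d Z) (susp_pow T e (Cod T v))"
    using kills_alt[of s e v] s(2) by simp
  moreover have "\<phi> e s (susp_pow T d Z) \<in> Hom T (susp_pow T d Z) (susp_pow T e (Cod T (\<phi> d r Z)))" by simp
  ultimately obtain g where g: "g \<in> Hom T (susp_pow T d Z) (susp_pow T e Z)"
    and sg: "\<phi> e s (susp_pow T d Z) = susp_powM T e (\<phi> d r Z) \<bullet> g"
    using tri_lift_pow[OF t] phi_hom(2)[OF r(1) Z] by metis
  note [simp] = HomD[OF g]
  \<comment> \<open>The two ways of suspending \<open>\<phi> e s Z\<close> differ by a sign, which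
    is absorbed by taking \<open>q\<close> to be \<open>r\<close> or its negative.\<close>
  obtain q where q: "q \<in> grade R d" "q \<in> P" "susp_powM T d (\<phi> e s Z) = susp_powM T e (\<phi> d q Z) \<bullet> g"
  proof (cases "\<phi> e s (susp_pow T d Z) = susp_powM T d (\<phi> e s Z)")
    case True
    then show ?thesis using that[of r] r sg by simp
  next
    case False
    then have "\<phi> e s (susp_pow T d Z) = neg_mor T (susp_powM T d (\<phi> e s Z))"
      using phi_susp_pow[of s e Z d] by simp
    then have "susp_powM T d (\<phi> e s Z) = neg_mor T (susp_powM T e (\<phi> d r Z) \<bullet> g)"
      using sg neg_eq_iff(1)[of "susp_powM T d (\<phi> e s Z)"] neg_neg[of "susp_powM T d (\<phi> e s Z)"] by simp
    moreover have "\<phi> d (\<ominus>\<^bsub>R\<^esub> r) Z = neg_mor T (\<phi> d r Z)" by (rule phi_minus[OF r(1) Z])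
    ultimately show ?thesis using that[of "\<ominus>\<^bsub>R\<^esub> r"] R.grade_minus[OF r(1)] P.a_inv_closed[OF r(2)] by simp
  qed
  obtain L where L: "homs Z Z L" and span: "\<And>k. Hom T Z (susp_pow T k Z) \<subseteq> span Z Z (carrier R) L k"
    using fg_span[OF Z Z fg] by blast
  have "\<exists>n. \<exists>s'\<in>grade R n - P. \<forall>(j, m)\<in>set L. kills n s' m"
  proof (rule nakayama[OF PS L s(1)])
    fix j m assume jm: "(j, m) \<in> set L"
    then have mh: "m \<in> Hom T Z (susp_pow T j Z)" using L unfolding homs_def by blast
    then have [simp]: "m \<in> Mor T" "Dom T m = Z" "Cod T m = susp_pow T j Z" by auto
    \<comment> \<open>Composing the factorization with the generator \<open>m\<close> gives
      \<open>s m = q y\<close> for this endomorphism \<open>y\<close> of degree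
      \<open>j - d + e\<close>.\<close>
    let ?y = "susp_powM T (j - d) g \<bullet> m"
    have y: "?y \<in> span Z Z (carrier R) L (j - d + e)"
      using span[of "j - d + e"] by (rule subsetD) simp
    have [simp]: "\<phi> d q Z \<in> Mor T" "Dom T (\<phi> d q Z) = Z" "Cod T (\<phi> d q Z) = susp_pow T d Z" using q(1) by simp_all
    have "susp_powM T j (\<phi> e s Z) = susp_powM T (j - d) (susp_powM T d (\<phi> e s Z))" by simp
    also have "\<dots> = susp_powM T (j - d + e) (\<phi> d q Z) \<bullet> susp_powM T (j - d) g"
      unfolding q(3) by (subst susp_powM_comp) simp_all
    finally have "act Z j e s m = act Z (j - d + e) d q ?y" unfolding act_def by simp
    moreover have "act Z (j - d + e) d q ?y \<in> span Z Z P L (d + (j - d + e))"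
      by (rule span_act[OF q(1) _ L y]) (use P.I_r_closed q(2) in blast)
    ultimately show "act Z j e s m \<in> span Z Z P L (e + j)" by (simp add: add.commute)
  qed
  then obtain n s' where s': "s' \<in> grade R n - P" and k: "\<And>j m. (j, m) \<in> set L \<Longrightarrow> kills n s' m" by blast
  \<comment> \<open>The identity is a combination of the generators in degree 0, so
    \<open>s'\<close> kills it as well.\<close>
  have one: "Ident T Z \<in> span Z Z (carrier R) L 0" using span[of 0] by (rule subsetD) simp
  have "s' \<in> grade R n" using s' by blast
  then have "kills n s' (Ident T Z)" by (rule span_kills[OF _ L k one])
  then show False using P s' unfolding esupp_def killed_def by blast
qed

theorem supp_compact:
  assumes N: "noetherian_category U R T \<phi>" and C: "C \<in> compacts"
  shows "supp U R T \<phi> C = esupp C"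
proof (intro subset_antisym subsetI)
  fix P assume "P \<in> supp U R T \<phi> C"
  then have P: "P \<in> Spec R" "C \<notin> tor_class P (compacts \<inter> torsion (VV R P))"
    using supp_iff[OF compact_Ob[OF C]] by blast+
  then obtain x where x: "x \<in> Mor T" "Cod T x = C" "\<not> killed P x"
    unfolding tor_class_def using compact_Ob[OF C] by auto
  then show "P \<in> esupp C" using P(1) killed_of_Ident_Cod[of P C x] unfolding esupp_def by blast
next
  fix P assume P: "P \<in> esupp C"
  then have PS: "P \<in> Spec R" unfolding esupp_def by blast
  let ?\<C> = "compacts \<inter> torsion (VV R P)"
  have \<C>: "?\<C> \<subseteq> compacts" "\<And>C n. C \<in> ?\<C> \<Longrightarrow> susp_pow T n C \<in> ?\<C>"
    using compact_susp_pow torsion_susp_pow[OF VV_Spec] by blast+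
  interpret tc: triangulated_sub T "tor_class P ?\<C>"
    by (rule localizing_triangulated_sub[OF tor_class_localizing[OF PS \<C>]])
  \<comment> \<open>The recorded implication is stable under Koszul cones; it lets the failure of
    the final \<open>Z\<close> to lie in the class be pulled back to \<open>C\<close>.\<close>
  define \<A> where "\<A> = {Z \<in> compacts. P \<in> esupp Z \<and> (C \<in> tor_class P ?\<C> \<longrightarrow> Z \<in> tor_class P ?\<C>)}"
  have "\<A> \<noteq> {}" using C P unfolding \<A>_def by blast
  from rad_maximal[OF this] obtain Z where ZA: "Z \<in> \<A>"
    and max: "\<And>D. \<lbrakk>D \<in> \<A>; rad Z \<subseteq> rad D\<rbrakk> \<Longrightarrow> rad D = rad Z" by blast
  have Z: "Z \<in> compacts" "P \<in> esupp Z" using ZA unfolding \<A>_def by blast+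
  note [simp] = compact_Ob[OF Z(1)]
  \<comment> \<open>By \<open>esupp_cone_mem\<close> the cone of \<open>r \<in> P\<close> stays in
    \<open>\<A>\<close>, and its radical contains \<open>r\<close>; maximality then puts
    \<open>r\<close> into the radical of \<open>Z\<close>.\<close>
  have "P \<subseteq> rad Z"
  proof (rule R.Spec_subset_homogeneous[OF PS rad_ideal])
    fix n r assume r: "r \<in> grade R n" "r \<in> P"
    note [simp] = r(1)
    obtain v w where t: "(\<phi> n r Z, v, w) \<in> Tri T" using tri_complete[of "\<phi> n r Z"] by auto
    note [simp] = tri_simps[OF t, simplified]
    have "finitely_generated_module R (hom_star R T \<phi> Z Z)"
      using N Z(1) unfolding noetherian_category_def by blast
    then have "P \<in> esupp (Cod T v)" using esupp_cone_mem[OF _ _ Z(2) r t] by simp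
    moreover have "Cod T v \<in> compacts" by (rule compact_cone_phi[OF r(1) Z(1) t])
    moreover have "Cod T v \<in> tor_class P ?\<C>" if "Z \<in> tor_class P ?\<C>"
      using tc.sub_cone[OF t] that tc.sub_susp_pow by simp
    ultimately have DA: "Cod T v \<in> \<A>" using ZA unfolding \<A>_def by blast
    have es: "Q \<in> esupp Z \<and> r \<in> Q" if "Q \<in> esupp (Cod T v)" for Q
      using esupp_cone[OF r(1) _ t] that by auto
    then have "rad Z \<subseteq> rad (Cod T v)" by (auto simp: rad_mem)
    then have "rad (Cod T v) = rad Z" by (rule max[OF DA])
    moreover have "r \<in> rad (Cod T v)" using es R.grade_carrier[OF r(1)] by (auto simp: rad_mem)
    ultimately show "r \<in> rad Z" by blast
  qed
  then have "esupp Z \<subseteq> VV R P" unfolding rad_def VV_def esupp_def by blast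
  then have ZC: "Z \<in> ?\<C>" using compact_torsion_iff[OF VV_Spec Z(1)] Z(1) by blast
  have "C \<notin> tor_class P ?\<C>"
  proof
    assume "C \<in> tor_class P ?\<C>"
    then have "Z \<in> tor_class P ?\<C>" using ZA unfolding \<A>_def by blast
    moreover have "Ident T Z \<in> Hom T Z Z" by simp
    ultimately have "killed P (Ident T Z)" using ZC unfolding tor_class_def by blast
    then show False using Z(2) unfolding esupp_def by blast
  qed
  then show "P \<in> supp U R T \<phi> C" using supp_iff[OF compact_Ob[OF C]] PS by blast
qed

text \<open>Enlarging the prime leaves fewer elements outside it that could annihilate the
  identity.\<close>

lemma esupp_specialization_closed: "specialization_closed R (esupp X)"
  unfolding specialization_closed_def esupp_def killed_def by blast

text \<open>The subcategory is the intersection of the compact objects with one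
  \<open>tor_class\<close> for each prime outside \<open>V\<close>; each of these is localizing and
  closed under retracts.\<close>

lemma supp_thick:
  "thick_subcategory T {C \<in> compacts. supp U R T \<phi> C \<subseteq> V}"
proof -
  let ?S = "{C \<in> compacts. supp U R T \<phi> C \<subseteq> V}"
  let ?\<C> = "\<lambda>P. compacts \<inter> torsion (VV R P)"
  define \<T> where "\<T> = insert compacts ((\<lambda>P. tor_class P (?\<C> P)) ` (Spec R - V))"
  have S: "?S = \<Inter>\<T>"
    unfolding \<T>_def using supp_iff[OF compact_Ob] by auto
  have \<C>: "?\<C> P \<subseteq> compacts" "\<And>C n. C \<in> ?\<C> P \<Longrightarrow> susp_pow T n C \<in> ?\<C> P" for P
    using compact_susp_pow torsion_susp_pow[OF VV_Spec] by blast+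
  have thick: "thick_subcategory T A" if A: "A \<in> \<T>" for A
  proof (cases "A = compacts")
    case True then show ?thesis using compact_thick by simp
  next
    case False
    then obtain P where P: "P \<in> Spec R" and A: "A = tor_class P (?\<C> P)" using A unfolding \<T>_def by blast
    have ts: "triangulated_subcategory T A"
      unfolding A by (rule triangulated_sub.tsub[OF localizing_triangulated_sub[OF tor_class_localizing[OF P \<C>]]])
    have retract: "X \<in> A" if i: "i \<in> Hom T X Z" and p: "p \<in> Hom T Z X" and pi: "p \<bullet> i = Ident T X" and Z: "Z \<in> A" for X Z i p
    proof -
      have "killed P x" if C: "C \<in> ?\<C> P" and x: "x \<in> Hom T C X" for C x
      proof -
        have "i \<bullet> x \<in> Hom T C Z" using i x by simp
        then have "killed P (i \<bullet> x)" using Z C unfolding A tor_class_def by blast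
        then have "killed P (p \<bullet> (i \<bullet> x))" using i p x by (simp add: killed_comp_left)
        moreover have "p \<bullet> (i \<bullet> x) = (p \<bullet> i) \<bullet> x" using i p x by simp
        moreover have "(p \<bullet> i) \<bullet> x = x" unfolding pi using x by simp
        ultimately show ?thesis by simp
      qed
      then show ?thesis unfolding A tor_class_def using Hom_Ob(1)[OF i] by blast
    qed
    show ?thesis unfolding thick_subcategory_def
    proof (intro conjI allI impI)
      show "triangulated_subcategory T A" by (rule ts)
      fix X Y Z assume "is_biproduct T X Y Z \<and> Z \<in> A"
      then show "X \<in> A" "Y \<in> A" unfolding is_biproduct_def using retract by blast+
    qed
  qed
  have ts: "triangulated_sub T A" if "A \<in> \<T>" for A
    using thick[OF that] unfolding thick_subcategory_def by unfold_locales blast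
  obtain N' where N': "is_zero T N'" using zero_object by blast
  have "N' \<in> \<Inter>\<T>" using triangulated_sub.sub_zero[OF ts N'] by blast
  moreover have "\<Inter>\<T> \<subseteq> Ob T" unfolding \<T>_def using compact_Ob by blast
  moreover have "X \<in> \<Inter>\<T> \<longleftrightarrow> Susp T X \<in> \<Inter>\<T>" if "X \<in> Ob T" for X
    using triangulated_sub.sub_Susp[OF ts that] by blast
  moreover have "Cod T v \<in> \<Inter>\<T>" if "(u, v, w) \<in> Tri T" "Dom T u \<in> \<Inter>\<T>" "Cod T u \<in> \<Inter>\<T>" for u v w
    using triangulated_sub.sub_cone[OF ts that(1)] that(2,3) by blast
  ultimately have "triangulated_subcategory T (\<Inter>\<T>)" unfolding triangulated_subcategory_def by blast
  moreover have "X \<in> \<Inter>\<T> \<and> Y \<in> \<Inter>\<T>" if "is_biproduct T X Y Z" "Z \<in> \<Inter>\<T>" for X Y Z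
    using that thick unfolding thick_subcategory_def by blast
  ultimately show ?thesis unfolding S thick_subcategory_def by blast
qed

section \<open>The classification\<close>

lemma Gamma_in_image: "X \<in> Ob T \<Longrightarrow> Gamma U R T \<phi> P X \<in> Gamma_image U R T \<phi> P"
proof -
  assume X: "X \<in> Ob T"
  let ?G = "Gamma U R T \<phi> P X"
  have G: "?G \<in> Ob T" by (rule Gamma_Ob[OF X])
  then have "isomorphic T ?G ?G" unfolding isomorphic_def using is_iso_Ident[OF G] by (intro bexI[of _ "Ident T ?G"]) simp_all
  then show ?thesis unfolding Gamma_image_def using G X by blast
qed

text \<open>If \<open>P\<close> lies in the support of \<open>Y \<in> S\<close>, then
  \<open>Loc U T S\<close> meets the image of \<open>Gamma\<close> at \<open>P\<close> in a nonzero
  object, so by minimality it contains the whole image and thus \<open>Gamma\<close> of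
  \<open>X\<close>. The local-global principle serves twice: for \<open>Y\<close> to enter
  \<open>Loc U T S\<close>, and for \<open>X\<close> to be reassembled.\<close>

lemma stratified_Loc:
  assumes st: "stratified U R T \<phi>" and S: "S \<subseteq> Ob T" and X: "X \<in> Ob T"
    and supp: "supp U R T \<phi> X \<subseteq> supp_class U R T \<phi> S"
  shows "X \<in> Loc U T S"
proof -
  have lgp: "Loc U T {Y} = Loc U T {Gamma U R T \<phi> P Y | P. P \<in> Spec R}" if "Y \<in> Ob T" for Y
    using st that unfolding stratified_def local_global_principle_def by blast
  have locS: "localizing (Loc U T S)" by (rule Loc_localizing[OF S])
  interpret L: triangulated_sub T "Loc U T S" by (rule localizing_triangulated_sub[OF locS])
  have "Gamma U R T \<phi> P X \<in> Loc U T S" if P: "P \<in> Spec R" for P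
  proof (cases "P \<in> supp U R T \<phi> X")
    case False
    then have "is_zero T (Gamma U R T \<phi> P X)" using P unfolding supp_def by blast
    then show ?thesis by (rule L.sub_zero)
  next
    case True
    then obtain Y where Y: "Y \<in> S" "P \<in> supp U R T \<phi> Y" using supp unfolding supp_class_def by blast
    have YO: "Y \<in> Ob T" using Y(1) S by blast
    let ?M = "Gamma_image U R T \<phi> P"
    have GY: "Gamma U R T \<phi> P Y \<in> ?M" "\<not> is_zero T (Gamma U R T \<phi> P Y)"
      using Gamma_in_image[OF YO] Y(2) unfolding supp_def by blast+
    then have "\<not> zero_subcategory T ?M" unfolding zero_subcategory_def by blast
    then have "minimal_localizing U T ?M" using st P unfolding stratified_def by blast
    then have M: "localizing ?M" "\<And>S'. \<lbrakk>localizing S'; S' \<subseteq> ?M\<rbrakk> \<Longrightarrow> zero_subcategory T S' \<or> S' = ?M"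
      unfolding minimal_localizing_def by blast+
    have "Loc U T {Y} \<subseteq> Loc U T S" using Loc_mono[of "{Y}" S U] Y(1) by blast
    moreover have "Gamma U R T \<phi> P Y \<in> Loc U T {Y}"
      unfolding lgp[OF YO] by (rule subsetD[OF Loc_superset]) (use P in blast)
    ultimately have "Gamma U R T \<phi> P Y \<in> Loc U T S \<inter> ?M" using GY(1) by blast
    then have "\<not> zero_subcategory T (Loc U T S \<inter> ?M)" using GY(2) unfolding zero_subcategory_def by blast
    moreover have "localizing (Loc U T S \<inter> ?M)"
      using localizing_Inter[of "{Loc U T S, ?M}" U] locS M(1) by auto
    ultimately have "Loc U T S \<inter> ?M = ?M" using M(2) by blast
    then show ?thesis using Gamma_in_image[OF X, of P] by blast
  qed
  then have "Loc U T {X} \<subseteq> Loc U T S" unfolding lgp[OF X] by (intro Loc_least[OF locS]) blast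
  moreover have "X \<in> Loc U T {X}" by (rule subsetD[OF Loc_superset]) simp
  ultimately show ?thesis by blast
qed

lemma thick_eq_supp:
  assumes st: "stratified U R T \<phi>" and S: "thick_subcategory T S" "S \<subseteq> compacts"
  shows "{C \<in> compacts. supp U R T \<phi> C \<subseteq> supp_class U R T \<phi> S} = S"
proof (intro subset_antisym subsetI)
  fix C assume "C \<in> {C \<in> compacts. supp U R T \<phi> C \<subseteq> supp_class U R T \<phi> S}"
  then have C: "C \<in> compacts" "supp U R T \<phi> C \<subseteq> supp_class U R T \<phi> S" by auto
  have "S \<subseteq> Ob T" using S(2) compact_Ob by blast
  from stratified_Loc[OF st this compact_Ob[OF C(1)] C(2)] show "C \<in> S"
    by (rule compact_Loc_thick[OF S C(1)])
next
  fix C assume "C \<in> S"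
  then show "C \<in> {C \<in> compacts. supp U R T \<phi> C \<subseteq> supp_class U R T \<phi> S}"
    using S(2) unfolding supp_class_def by blast
qed

text \<open>The elementwise description of the support provides a compact \<open>Z\<close>, torsion
  for \<open>VV R P\<close>, with a map to \<open>X\<close> that is not killed at \<open>P\<close>.
  So \<open>P\<close> lies in the support of \<open>Z\<close>, and this support lies in
  \<open>VV R P\<close>, hence in \<open>V\<close>.\<close>

lemma supp_class_of_supp:
  assumes N: "noetherian_category U R T \<phi>" and V: "V \<subseteq> supp_class U R T \<phi> (Ob T)" "specialization_closed R V"
  shows "supp_class U R T \<phi> {C \<in> compacts. supp U R T \<phi> C \<subseteq> V} = V"
proof (intro subset_antisym subsetI)
  fix P assume "P \<in> supp_class U R T \<phi> {C \<in> compacts. supp U R T \<phi> C \<subseteq> V}"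
  then show "P \<in> V" unfolding supp_class_def by blast
next
  fix P assume PV: "P \<in> V"
  then obtain X where X: "X \<in> Ob T" "P \<in> supp U R T \<phi> X" using V(1) unfolding supp_class_def by blast
  then have P: "P \<in> Spec R" "X \<notin> tor_class P (compacts \<inter> torsion (VV R P))" using supp_iff by blast+
  then obtain Z x where Z: "Z \<in> compacts" "Z \<in> torsion (VV R P)" and x: "x \<in> Mor T" "Dom T x = Z" "\<not> killed P x"
    unfolding tor_class_def using X(1) by auto
  have "P \<in> supp U R T \<phi> Z"
    unfolding supp_compact[OF N Z(1)] esupp_def using P(1) killed_of_Ident_Dom[of P Z x] x by blast
  moreover have "supp U R T \<phi> Z \<subseteq> VV R P"
    unfolding supp_compact[OF N Z(1)] using compact_torsion_iff[OF VV_Spec Z(1)] Z(2) by blast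
  moreover have "VV R P \<subseteq> V" using V(2) PV unfolding specialization_closed_def VV_def by blast
  ultimately show "P \<in> supp_class U R T \<phi> {C \<in> compacts. supp U R T \<phi> C \<subseteq> V}"
    unfolding supp_class_def using Z(1) by blast
qed

lemma supp_class_specialization_closed:
  assumes N: "noetherian_category U R T \<phi>" and S: "S \<subseteq> compacts"
  shows "supp_class U R T \<phi> S \<subseteq> supp_class U R T \<phi> (Ob T)" "specialization_closed R (supp_class U R T \<phi> S)"
proof -
  show "supp_class U R T \<phi> S \<subseteq> supp_class U R T \<phi> (Ob T)"
    unfolding supp_class_def using S compact_Ob by blast
  have e: "supp_class U R T \<phi> S = (\<Union>C\<in>S. esupp C)"
    unfolding supp_class_def using supp_compact[OF N] S by blast
  show "specialization_closed R (supp_class U R T \<phi> S)"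
    unfolding e specialization_closed_def
  proof (intro conjI UN_least ballI impI)
    show "esupp C \<subseteq> Spec R" for C unfolding esupp_def by blast
    fix P Q assume "P \<in> (\<Union>C\<in>S. esupp C)" and Q: "Q \<in> Spec R" "P \<subseteq> Q"
    then obtain C where C: "C \<in> S" "P \<in> esupp C" by blast
    then have "Q \<in> esupp C"
      using esupp_specialization_closed[of C] Q unfolding specialization_closed_def by simp
    then show "Q \<in> (\<Union>C\<in>S. esupp C)" using C(1) by blast
  qed
qed

theorem classification:
  assumes N: "noetherian_category U R T \<phi>" and st: "stratified U R T \<phi>"
  defines "\<V> \<equiv> {V. V \<subseteq> supp_class U R T \<phi> (Ob T) \<and> specialization_closed R V}"
  shows "bij_betw (supp_class U R T \<phi>) (thick_subcategories_of_compacts U T) \<V>"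
    and "V \<in> \<V> \<Longrightarrow> the_inv_into (thick_subcategories_of_compacts U T) (supp_class U R T \<phi>) V =
      {C \<in> compacts. supp U R T \<phi> C \<subseteq> V}"
proof -
  let ?g = "\<lambda>V. {C \<in> compacts. supp U R T \<phi> C \<subseteq> V}"
  have gf: "?g (supp_class U R T \<phi> S) = S" if "S \<in> thick_subcategories_of_compacts U T" for S
    using that thick_eq_supp[OF st] unfolding thick_subcategories_of_compacts_def by blast
  have fg: "supp_class U R T \<phi> (?g V) = V" if "V \<in> \<V>" for V
    using that supp_class_of_supp[OF N] unfolding \<V>_def by blast
  have g: "?g V \<in> thick_subcategories_of_compacts U T" for V
    unfolding thick_subcategories_of_compacts_def using supp_thick by blast
  have f: "supp_class U R T \<phi> S \<in> \<V>" if "S \<in> thick_subcategories_of_compacts U T" for S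
    using that supp_class_specialization_closed[OF N] unfolding \<V>_def thick_subcategories_of_compacts_def by blast
  show bij: "bij_betw (supp_class U R T \<phi>) (thick_subcategories_of_compacts U T) \<V>"
    by (rule bij_betw_byWitness[where f' = ?g]) (use gf fg f g in auto)
  show "the_inv_into (thick_subcategories_of_compacts U T) (supp_class U R T \<phi>) V = ?g V" if "V \<in> \<V>"
    by (rule the_inv_into_f_eq[OF bij_betw_imp_inj_on[OF bij] fg[OF that] g])
qed

end

theorem theorem1p2:
  fixes U :: "'u itself"
    and R :: "('a, 'y) gring_scheme"
    and T :: "('o, 'm, 'z) tricat_scheme"
    and \<phi> :: "int \<Rightarrow> 'a \<Rightarrow> 'o \<Rightarrow> 'm"
  assumes "universe U"
    and "graded_commutative_ring R" and "noetherian_ring R" and "small U (carrier R)"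
    and "triangulated_category T" and "locally_small U T" and "has_coproducts U T"
    and "compactly_generated U T"
    and "R_linear R T \<phi>"
    and "noetherian_category U R T \<phi>"
    and "stratified U R T \<phi>"
  shows "bij_betw (supp_class U R T \<phi>)
           (thick_subcategories_of_compacts U T)
           {V. V \<subseteq> supp_class U R T \<phi> (Ob T) \<and> specialization_closed R V} \<and>
         (\<forall>V. V \<subseteq> supp_class U R T \<phi> (Ob T) \<and> specialization_closed R V \<longrightarrow>
           the_inv_into (thick_subcategories_of_compacts U T) (supp_class U R T \<phi>) V =
             {C \<in> compact_objects U T. supp U R T \<phi> C \<subseteq> V})"
proof -
  interpret noetherian_tricat T U R \<phi>
    by (intro noetherian_tricat.intro linear_tricat.intro coproduct_tricat.intro
      coproduct_tricat_axioms.intro linear_tricat_axioms.intro noetherian_tricat_axioms.intro assms)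
  show ?thesis
  proof (intro conjI allI impI)
    fix V assume "V \<subseteq> supp_class U R T \<phi> (Ob T) \<and> specialization_closed R V"
    then show "the_inv_into (thick_subcategories_of_compacts U T) (supp_class U R T \<phi>) V =
        {C \<in> compact_objects U T. supp U R T \<phi> C \<subseteq> V}"
      by (intro classification(2)[OF assms(10,11)]) simp
  qed (rule classification(1)[OF assms(10,11)])
qed

end
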